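(* For every $\alpha\in(0,1)$, the permuton \[\mu^r_\alpha=\sum_{i=1}^\infty(1-\alpha)\alpha^{i-1}\lambda_{[1-\alpha^{i-1},1-\alpha^i]\times[1-\alpha^{i-1},1-\alpha^i]}\] is finitely forcible.
   Context: A permuton is a probability measure $\mu$ on the Borel sets of $[0,1]^2$ with uniform marginals, i.e., $\mu([\alpha,\beta]\times[0,1])=\mu([0,1]\times[\alpha,\beta])=\beta-\alpha$ for all $0\le\alpha\le\beta\le1$. For a square $A$, $\lambda_A$ is the uniform probability measure on $A$. A $\mu$-random permutation of order $n$ is obtained by sampling $n$ points independently according to $\mu$, ordering them by $x$-coordinate as $x_{i_1}<\dots<x_{i_n}$ and letting $\pi(j)<\pi(j')$ iff $y_{i_j}<y_{i_{j'}}$; $d(\sigma,\mu)$ is the probability that a $\mu$-random permutation of order $|\sigma|$ equals $\sigma$. A permuton $\mu$ is finitely forcible if there is a finite set $S$ of permutations such that every permuton $\mu'$ with $d(\sigma,\mu')=d(\sigma,\mu)$ for all $\sigma\in S$ equals $\mu$. *)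

theory Defs
  imports "HOL-Probability.Probability" "HOL-Combinatorics.Permutations"
begin

definition unit_square :: "(real \<times> real) set" where
  "unit_square = {0..1} \<times> {0..1}"

definition permuton :: "(real \<times> real) measure \<Rightarrow> bool" where
  "permuton \<mu> \<longleftrightarrow>
     prob_space \<mu> \<and> sets \<mu> = sets (restrict_space borel unit_square) \<and>
     (\<forall>a b. 0 \<le> a \<and> a \<le> b \<and> b \<le> 1 \<longrightarrow>
        measure \<mu> ({a..b} \<times> {0..1}) = b - a \<and>
        measure \<mu> ({0..1} \<times> {a..b}) = b - a)"

text \<open>
  A permutation of order \<open>n\<close> is a function \<open>\<sigma>\<close> with \<open>\<sigma> permutes {1..n}\<close>.  The points
  \<open>p 1, \<dots>, p n\<close> induce \<open>\<sigma>\<close> if \<open>\<sigma>\<close> compares positions as the vertical coordinates do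
  once the points are listed from left to right, by \<open>i\<close>.  If two points share a coordinate,
  then no permutation is induced; for points sampled from a permuton this has probability 0.
\<close>

definition induces :: "nat \<Rightarrow> (nat \<Rightarrow> real \<times> real) \<Rightarrow> (nat \<Rightarrow> nat) \<Rightarrow> bool" where
  "induces n p \<sigma> \<longleftrightarrow> \<sigma> permutes {1..n} \<and>
     (\<exists>i. i permutes {1..n} \<and> strict_mono_on {1..n} (\<lambda>j. fst (p (i j))) \<and>
        (\<forall>j\<in>{1..n}. \<forall>k\<in>{1..n}. \<sigma> j < \<sigma> k \<longleftrightarrow> snd (p (i j)) < snd (p (i k))))"

definition perm_density :: "nat \<Rightarrow> (nat \<Rightarrow> nat) \<Rightarrow> (real \<times> real) measure \<Rightarrow> real" where
  "perm_density n \<sigma> \<mu> =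
     measure (Pi\<^sub>M {1..n} (\<lambda>_. \<mu>)) {p \<in> space (Pi\<^sub>M {1..n} (\<lambda>_. \<mu>)). induces n p \<sigma>}"

definition finitely_forcible :: "(real \<times> real) measure \<Rightarrow> bool" where
  "finitely_forcible \<mu> \<longleftrightarrow> permuton \<mu> \<and>
     (\<exists>S :: (nat \<times> (nat \<Rightarrow> nat)) set. finite S \<and> (\<forall>(n, \<sigma>)\<in>S. \<sigma> permutes {1..n}) \<and>
        (\<forall>\<mu>'. permuton \<mu>' \<and> (\<forall>(n, \<sigma>)\<in>S. perm_density n \<sigma> \<mu>' = perm_density n \<sigma> \<mu>)
           \<longrightarrow> \<mu>' = \<mu>))"

definition uniform_on :: "(real \<times> real) set \<Rightarrow> (real \<times> real) measure" where
  "uniform_on A = uniform_measure (restrict_space lborel unit_square) A"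

text \<open>The squares are indexed from 0, so the \<open>i\<close>th one starts at \<open>1 - \<alpha> ^ i\<close>.\<close>

definition mu_square :: "real \<Rightarrow> nat \<Rightarrow> (real \<times> real) set" where
  "mu_square \<alpha> i = {1 - \<alpha> ^ i .. 1 - \<alpha> ^ Suc i} \<times> {1 - \<alpha> ^ i .. 1 - \<alpha> ^ Suc i}"

definition mu_r :: "real \<Rightarrow> (real \<times> real) measure" where
  "mu_r \<alpha> = measure_of unit_square (sets (restrict_space borel unit_square))
     (\<lambda>B. \<Sum>i. ennreal ((1 - \<alpha>) * \<alpha> ^ i) * emeasure (uniform_on (mu_square \<alpha> i)) B)"

text \<open>The next two facts show that the set function is countably additive (so \<open>measure_of\<close>
  does not collapse to the zero measure) and that the event in \<open>perm_density\<close> is measurable.\<close>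

lemma emeasure_mu_r:
  assumes "B \<in> sets (restrict_space borel unit_square)"
  shows "emeasure (mu_r \<alpha>) B =
    (\<Sum>i. ennreal ((1 - \<alpha>) * \<alpha> ^ i) * emeasure (uniform_on (mu_square \<alpha> i)) B)"
proof -
  let ?N = "restrict_space borel unit_square :: (real \<times> real) measure"
  let ?f = "\<lambda>B. \<Sum>i. ennreal ((1 - \<alpha>) * \<alpha> ^ i) * emeasure (uniform_on (mu_square \<alpha> i)) B"
  have sp: "space ?N = unit_square" by (simp add: space_restrict_space)
  have sa: "sigma_algebra unit_square (sets ?N)"
    using sets.sigma_algebra_axioms[of ?N] sp by simp
  have su: "sets (uniform_on A) = sets ?N" for A
    by (simp add: uniform_on_def cong: sets_restrict_space_cong)
  have "countably_additive (sets ?N) ?f"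
  proof (rule countably_additiveI)
    fix A :: "nat \<Rightarrow> (real \<times> real) set"
    assume A: "range A \<subseteq> sets ?N" "disjoint_family A"
    let ?w = "\<lambda>i. ennreal ((1 - \<alpha>) * \<alpha> ^ i)" and ?u = "\<lambda>i. uniform_on (mu_square \<alpha> i)"
    have "(\<Sum>j. ?f (A j)) = (\<Sum>i. \<Sum>j. ?w i * emeasure (?u i) (A j))"
      unfolding nn_integral_count_space_nat[symmetric, of "\<lambda>j. \<Sum>i. ?w i * emeasure (?u i) (A j)"]
        nn_integral_count_space_nat[symmetric, of "\<lambda>j. ?w i * emeasure (?u i) (A j)" for i]
      by (rule nn_integral_suminf) simp
    also have "\<dots> = ?f (\<Union>i. A i)"
      using A su by (simp add: suminf_emeasure)
    finally show "(\<Sum>j. ?f (A j)) = ?f (\<Union>i. A i)" .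
  qed
  then have "measure_space unit_square (sets ?N) ?f"
    using sa by (simp add: measure_space_def positive_def)
  then show ?thesis
    unfolding mu_r_def using sa assms by (intro emeasure_measure_of_sigma)
      (auto simp: measure_space_def)
qed

lemma sets_perm_density_event:
  assumes "sets \<mu> = sets (restrict_space borel unit_square)"
  shows "{p \<in> space (Pi\<^sub>M {1..n} (\<lambda>_. \<mu>)). induces n p \<sigma>} \<in> sets (Pi\<^sub>M {1..n} (\<lambda>_. \<mu>))"
proof -
  let ?P = "Pi\<^sub>M {1..n} (\<lambda>_. \<mu>)"
  have "(\<lambda>x. x) \<in> measurable (restrict_space borel unit_square) (borel :: (real \<times> real) measure)"
    by (rule measurable_restrict_space1) simp
  then have id: "(\<lambda>x. x) \<in> measurable \<mu> (borel :: (real \<times> real) measure)"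
    by (subst measurable_cong_sets[OF assms refl])
  have c: "(\<lambda>p. p m) \<in> measurable ?P borel" if "m \<in> {1..n}" for m
    using measurable_compose[OF measurable_component_singleton[OF that] id] by simp
  have fs: "(fst :: real \<times> real \<Rightarrow> real) \<in> borel_measurable borel"
           "(snd :: real \<times> real \<Rightarrow> real) \<in> borel_measurable borel"
    by (auto simp: borel_prod[symmetric])
  have x: "(\<lambda>p. fst (p m)) \<in> borel_measurable ?P" if "m \<in> {1..n}" for m
    using measurable_compose[OF c[OF that] fs(1)] .
  have y: "(\<lambda>p. snd (p m)) \<in> borel_measurable ?P" if "m \<in> {1..n}" for m
    using measurable_compose[OF c[OF that] fs(2)] .
  let ?E = "\<lambda>i. {p \<in> space ?P. \<forall>j\<in>{1..n}. \<forall>k\<in>{1..n}.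
      (j < k \<longrightarrow> fst (p (i j)) < fst (p (i k))) \<and>
      (\<sigma> j < \<sigma> k \<longleftrightarrow> snd (p (i j)) < snd (p (i k)))}"
  have E: "?E i \<in> sets ?P" if "i permutes {1..n}" for i
  proof -
    have i: "i j \<in> {1..n}" if "j \<in> {1..n}" for j
      using that \<open>i permutes {1..n}\<close> by (simp only: permutes_in_image)
    have "Measurable.pred ?P (\<lambda>p. fst (p (i j)) < fst (p (i k)))"
         "Measurable.pred ?P (\<lambda>p. snd (p (i j)) < snd (p (i k)))"
      if "j \<in> {1..n}" "k \<in> {1..n}" for j k
      using borel_measurable_less[OF x[OF i[OF that(1)]] x[OF i[OF that(2)]]]
        borel_measurable_less[OF y[OF i[OF that(1)]] y[OF i[OF that(2)]]]
      by (simp_all add: pred_def)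
    then have "Measurable.pred ?P (\<lambda>p. (j < k \<longrightarrow> fst (p (i j)) < fst (p (i k))) \<and>
        (\<sigma> j < \<sigma> k \<longleftrightarrow> snd (p (i j)) < snd (p (i k))))"
      if "j \<in> {1..n}" "k \<in> {1..n}" for j k
      using that by (cases "j < k"; cases "\<sigma> j < \<sigma> k"; simp add: pred_intros_logic)
    then have "Measurable.pred ?P (\<lambda>p. \<forall>j\<in>{1..n}. \<forall>k\<in>{1..n}.
        (j < k \<longrightarrow> fst (p (i j)) < fst (p (i k))) \<and>
        (\<sigma> j < \<sigma> k \<longleftrightarrow> snd (p (i j)) < snd (p (i k))))"
      by (intro pred_intros_finite(3)[OF finite_atLeastAtMost])
    then show ?thesis unfolding pred_def .
  qed
  have mono: "strict_mono_on {1..n} f \<longleftrightarrow> (\<forall>j\<in>{1..n}. \<forall>k\<in>{1..n}. j < k \<longrightarrow> f j < f k)"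
    for f :: "nat \<Rightarrow> real"
    unfolding strict_mono_on_def by blast
  have UN: "{p \<in> S. \<exists>i. R i \<and> Q i p} = (\<Union>i\<in>{i. R i}. {p \<in> S. Q i p})"
    for S :: "(nat \<Rightarrow> real \<times> real) set" and R :: "(nat \<Rightarrow> nat) \<Rightarrow> bool" and Q
    by blast
  have "{p \<in> space ?P. induces n p \<sigma>} =
      (if \<sigma> permutes {1..n} then \<Union>i\<in>{i. i permutes {1..n}}. ?E i else {})"
  proof (cases "\<sigma> permutes {1..n}")
    case True
    show ?thesis
      unfolding induces_def mono ball_conj_distrib by (simp only: True if_True simp_thms UN)
  qed (simp add: induces_def)
  moreover have "(\<Union>i\<in>{i. i permutes {1..n}}. ?E i) \<in> sets ?P"
    by (rule sets.finite_UN) (simp_all only: finite_permutations finite_atLeastAtMost mem_Collect_eq E)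
  ultimately show ?thesis by (simp only: sets.empty_sets simp_thms split: if_split)
qed

end

theory Submission imports Defs begin

text \<open>
  Write \<open>F(x, y) = \<mu>([0, x] \<times> [0, y])\<close>.  A polynomial in numbers \<open>x\<^sub>i\<close>, \<open>y\<^sub>j\<close> and
  \<open>F(x\<^sub>i, y\<^sub>j)\<close>, integrated over all \<open>x\<^sub>i\<close> and \<open>y\<^sub>j\<close>, is a linear combination of finitely many pattern
  densities, since \<open>F(x, y)\<close> is the probability that a sample point lies below \<open>(x, y)\<close>.
  Applying this to the square of a polynomial shows that every polynomial identity satisfied by \<open>F\<close> can
  be forced by finitely many densities.

  For \<open>\<mu>\<^sup>r\<close> the product \<open>(x - F)(y - F)\<close> is positive inside the diagonal squares and zero elsewhere.
  Multiplying by such factors, one identity says that \<open>(1 - x) / (1 - (1 - \<alpha>) \<partial>F/\<partial>y)\<close> is constant within a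
  component of \<open>(x - F)(y - F) > 0\<close>; in particular \<open>F\<close> is affine in \<open>y\<close> there. A second identity says
  that this constant \<open>b\<close> is the distance from the lower end \<open>1 - b\<close> of the component to \<open>1\<close>.  It follows
  that the component is a square with corners \<open>1 - b\<close> and \<open>1 - \<alpha> b\<close>, with uniform mass.  Disjointness
  leaves at most one value of \<open>b\<close>, called \<open>\<beta>\<^sub>n\<close>, in each interval from \<open>\<alpha>\<close> to the power \<open>n + 1\<close>
  (excluded) to \<open>\<alpha>\<close> to the power \<open>n\<close>.  Since the integral of \<open>(x - F)(y - F)\<close> is a constant times the
  sum of the fourth powers of the \<open>\<beta>\<^sub>n\<close>, prescribing its value forces every \<open>\<beta>\<^sub>n\<close> to be as large
  as possible.
\<close>

section \<open>Order types of finite point sets\<close>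

text \<open>The ratio comes from a single square. On the square with corners \<open>1 - b\<close>
  and \<open>1 - \<alpha> * b\<close>, the slope of \<open>F\<close> in \<open>y\<close> is
  \<open>(x - (1 - b)) / ((1 - \<alpha>) * b)\<close>, so one minus \<open>1 - \<alpha>\<close>
  times this slope is \<open>(1 - x) / b\<close>: the unknown \<open>b\<close> becomes a quotient of
  quantities that can be read off from \<open>F\<close>. Derivatives are not polynomial in
  \<open>F\<close>, hence difference quotients at free heights, with denominators cleared. Two
  obstacles shape the rest. Only one coordinate of a sample point can be prescribed freely, because
  a permuton may give no mass to a neighbourhood of a given point of the square; x-variables and
  y-variables are therefore taken from different sample points. Moreover, an identity multiplied by
  gap factors says nothing where the gap vanishes: the diagonal permuton with
  \<open>F x y = min x y\<close> satisfies both identities, and so does every function that is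
  \<open>tiled\<close>. Missing or smaller blocks are excluded only by the integral of the
  gap.\<close>

definition same_order :: "nat \<Rightarrow> (nat \<Rightarrow> 'a::linorder) \<Rightarrow> (nat \<Rightarrow> 'b::linorder) \<Rightarrow> bool" where
  "same_order n f g \<longleftrightarrow> (\<forall>j\<in>{1..n}. \<forall>k\<in>{1..n}. f j < f k \<longleftrightarrow> g j < g k)"

lemma same_order_sym: "same_order n f g \<Longrightarrow> same_order n g f"
  by (simp add: same_order_def)

lemma same_order_trans: "same_order n f g \<Longrightarrow> same_order n g h \<Longrightarrow> same_order n f h"
  by (simp add: same_order_def)

lemma same_order_comp:
  assumes "\<pi> permutes {1..n}"
  shows "same_order n (f \<circ> \<pi>) (g \<circ> \<pi>) \<longleftrightarrow> same_order n f g"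
proof -
  have *: "(\<forall>j\<in>{1..n}. Q (\<pi> j)) \<longleftrightarrow> (\<forall>j\<in>{1..n}. Q j)" for Q :: "nat \<Rightarrow> bool"
    using permutes_image[OF assms] permutes_in_image[OF assms] by (metis imageE)
  let ?P = "\<lambda>j k. f j < f k \<longleftrightarrow> g j < g k"
  show ?thesis
    unfolding same_order_def o_apply
    using *[of "\<lambda>j. \<forall>k\<in>{1..n}. ?P j k"] *[of "?P (\<pi> j)" for j] by (simp only:)
qed

lemma card_below_permutes:
  assumes "\<rho> permutes {1..n}" "j \<in> {1..n}"
  shows "card {k\<in>{1..n}. \<rho> k < \<rho> j} = \<rho> j - 1"
proof -
  have j: "\<rho> j \<in> {1..n}" using permutes_in_image[OF assms(1)] assms(2) by simp
  have "bij_betw \<rho> {k\<in>{1..n}. \<rho> k < \<rho> j} {1..<\<rho> j}"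
    unfolding bij_betw_def
  proof (intro conjI set_eqI iffI)
    show "inj_on \<rho> {k \<in> {1..n}. \<rho> k < \<rho> j}"
      using permutes_inj[OF assms(1)] by (rule inj_on_subset) auto
    fix x
    {
      assume "x \<in> \<rho> ` {k \<in> {1..n}. \<rho> k < \<rho> j}"
      then obtain k where "k \<in> {1..n}" "x = \<rho> k" "\<rho> k < \<rho> j" by blast
      moreover from this have "\<rho> k \<in> {1..n}" using permutes_in_image[OF assms(1)] by simp
      ultimately show "x \<in> {1..<\<rho> j}" by auto
    }
    {
      assume x: "x \<in> {1..<\<rho> j}"
      then have "x \<in> {1..n}" using j by auto
      then have "inv \<rho> x \<in> {1..n}"
        using permutes_in_image[OF permutes_inv[OF assms(1)], of x] by simp
      moreover have "\<rho> (inv \<rho> x) = x" using permutes_inverses[OF assms(1)] by auto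
      ultimately show "x \<in> \<rho> ` {k \<in> {1..n}. \<rho> k < \<rho> j}"
        using x by (intro image_eqI[of _ _ "inv \<rho> x"]) auto
    }
  qed
  from bij_betw_same_card[OF this] show ?thesis by simp
qed

lemma permutes_same_order_unique:
  assumes "\<rho> permutes {1..n}" "\<rho>' permutes {1..n}" "same_order n \<rho> \<rho>'"
  shows "\<rho> = \<rho>'"
proof
  fix j
  show "\<rho> j = \<rho>' j"
  proof (cases "j \<in> {1..n}")
    case True
    have "{k\<in>{1..n}. \<rho> k < \<rho> j} = {k\<in>{1..n}. \<rho>' k < \<rho>' j}"
      using assms(3) True by (auto simp: same_order_def)
    then have "\<rho> j - 1 = \<rho>' j - 1"
      using card_below_permutes[OF assms(1) True] card_below_permutes[OF assms(2) True] by simp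
    moreover have "\<rho> j \<in> {1..n}" "\<rho>' j \<in> {1..n}"
      using True permutes_in_image[OF assms(1)] permutes_in_image[OF assms(2)] by simp_all
    ultimately show ?thesis by auto
  next
    case False
    then show ?thesis using permutes_not_in[OF assms(1)] permutes_not_in[OF assms(2)] by simp
  qed
qed

lemma ex_permutes_same_order:
  fixes f :: "nat \<Rightarrow> real"
  assumes "inj_on f {1..n}"
  shows "\<exists>\<rho>. \<rho> permutes {1..n} \<and> same_order n \<rho> f"
proof -
  \<comment> \<open>The rank of \<open>f j\<close>, counted from 1 because of \<open>\<le>\<close>;
    outside \<open>{1..n}\<close> it is the identity, as \<open>permutes\<close> demands.\<close>
  define \<rho> where "\<rho> j = (if j \<in> {1..n} then card {k\<in>{1..n}. f k \<le> f j} else j)" for j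
  have lt: "\<rho> i < \<rho> j" if "i \<in> {1..n}" "j \<in> {1..n}" "f i < f j" for i j
  proof -
    have "{k\<in>{1..n}. f k \<le> f i} \<subset> {k\<in>{1..n}. f k \<le> f j}"
      using that by (intro psubsetI) (auto simp: set_eq_iff intro!: exI[of _ j])
    then have "card {k\<in>{1..n}. f k \<le> f i} < card {k\<in>{1..n}. f k \<le> f j}"
      by (intro psubset_card_mono) auto
    then show ?thesis using that by (simp add: \<rho>_def)
  qed
  have so: "same_order n \<rho> f"
    unfolding same_order_def
  proof (intro ballI iffI)
    fix j k assume jk: "j \<in> {1..n}" "k \<in> {1..n}"
    show "f j < f k \<Longrightarrow> \<rho> j < \<rho> k" using lt jk by blast
    assume "\<rho> j < \<rho> k"
    then have "\<not> f k < f j" "f k \<noteq> f j"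
      using lt[of k j] jk inj_onD[OF assms, of j k] by auto
    then show "f j < f k" by simp
  qed
  have inj: "inj_on \<rho> {1..n}"
  proof (rule inj_onI)
    fix j k assume jk: "j \<in> {1..n}" "k \<in> {1..n}" "\<rho> j = \<rho> k"
    then have "f j = f k" using lt[of j k] lt[of k j] by (metis less_irrefl linorder_neqE)
    then show "j = k" using assms jk by (auto dest: inj_onD)
  qed
  have "\<rho> ` {1..n} \<subseteq> {1..n}"
  proof
    fix x assume "x \<in> \<rho> ` {1..n}"
    then obtain j where j: "j \<in> {1..n}" "x = card {k\<in>{1..n}. f k \<le> f j}" by (auto simp: \<rho>_def)
    have "x \<le> card {1..n}" unfolding j by (rule card_mono) auto
    moreover have "x > 0" unfolding j using j(1) by (auto simp: card_gt_0_iff)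
    ultimately show "x \<in> {1..n}" by simp
  qed
  then have "\<rho> permutes {1..n}"
    using inj endo_inj_surj[of "{1..n}" \<rho>]
    by (intro bij_imp_permutes) (simp_all add: bij_betw_def, auto simp: \<rho>_def)
  with so show ?thesis by blast
qed

text \<open>The permutation \<open>i\<close> in \<open>induces\<close> lists labels from left to
  right, so its inverse \<open>\<rho>\<close> is the rank of the x-coordinate and
  \<open>\<sigma> \<circ> \<rho>\<close> the rank of the y-coordinate. In this form the event splits
  into cells given by the two rank functions of a labelled sample.\<close>

lemma induces_iff:
  "induces n p \<sigma> \<longleftrightarrow> \<sigma> permutes {1..n} \<and>
     (\<exists>\<rho>. \<rho> permutes {1..n} \<and> same_order n \<rho> (fst \<circ> p) \<and> same_order n (\<sigma> \<circ> \<rho>) (snd \<circ> p))"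
proof -
  have *: "strict_mono_on {1..n} (\<lambda>j. fst (p (i j))) \<and>
        (\<forall>j\<in>{1..n}. \<forall>k\<in>{1..n}. \<sigma> j < \<sigma> k \<longleftrightarrow> snd (p (i j)) < snd (p (i k))) \<longleftrightarrow>
      same_order n (inv i) (fst \<circ> p) \<and> same_order n (\<sigma> \<circ> inv i) (snd \<circ> p)"
    if "i permutes {1..n}" for i
  proof -
    have "strict_mono_on {1..n} (\<lambda>j. fst (p (i j))) \<longleftrightarrow> same_order n id (fst \<circ> p \<circ> i)"
    proof
      assume "strict_mono_on {1..n} (\<lambda>j. fst (p (i j)))"
      then show "same_order n id (fst \<circ> p \<circ> i)"
        unfolding same_order_def o_apply id_apply
        by (intro ballI strict_mono_on_less[symmetric])
    next
      assume "same_order n id (fst \<circ> p \<circ> i)"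
      then have "fst (p (i j)) < fst (p (i k))" if "j \<in> {1..n}" "k \<in> {1..n}" "j < k" for j k
        using that unfolding same_order_def o_apply id_apply by blast
      then show "strict_mono_on {1..n} (\<lambda>j. fst (p (i j)))"
        by (intro strict_mono_onI)
    qed
    also have "\<dots> \<longleftrightarrow> same_order n (inv i \<circ> i) (fst \<circ> p \<circ> i)"
      using permutes_inv_o[OF that] by simp
    also have "\<dots> \<longleftrightarrow> same_order n (inv i) (fst \<circ> p)"
      by (rule same_order_comp[OF that])
    finally have 1: "strict_mono_on {1..n} (\<lambda>j. fst (p (i j))) \<longleftrightarrow> same_order n (inv i) (fst \<circ> p)" .
    have "(\<forall>j\<in>{1..n}. \<forall>k\<in>{1..n}. \<sigma> j < \<sigma> k \<longleftrightarrow> snd (p (i j)) < snd (p (i k))) \<longleftrightarrow>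
        same_order n \<sigma> (snd \<circ> p \<circ> i)"
      by (simp add: same_order_def)
    also have "\<dots> \<longleftrightarrow> same_order n (\<sigma> \<circ> inv i \<circ> i) (snd \<circ> p \<circ> i)"
      using permutes_inv_o[OF that] by (simp add: o_assoc[symmetric])
    also have "\<dots> \<longleftrightarrow> same_order n (\<sigma> \<circ> inv i) (snd \<circ> p)"
      by (rule same_order_comp[OF that])
    finally show ?thesis using 1 by simp
  qed
  show ?thesis (is "_ \<longleftrightarrow> _ \<and> (\<exists>\<rho>. ?R \<rho>)")
  proof -
    have "(\<exists>i. i permutes {1..n} \<and> strict_mono_on {1..n} (\<lambda>j. fst (p (i j))) \<and>
        (\<forall>j\<in>{1..n}. \<forall>k\<in>{1..n}. \<sigma> j < \<sigma> k \<longleftrightarrow> snd (p (i j)) < snd (p (i k)))) \<longleftrightarrow>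
      (\<exists>i. i permutes {1..n} \<and> ?R (inv i))"
    proof (intro arg_cong[where f = Ex] ext)
      fix i
      show "(i permutes {1..n} \<and> strict_mono_on {1..n} (\<lambda>j. fst (p (i j))) \<and>
        (\<forall>j\<in>{1..n}. \<forall>k\<in>{1..n}. \<sigma> j < \<sigma> k \<longleftrightarrow> snd (p (i j)) < snd (p (i k)))) \<longleftrightarrow>
        (i permutes {1..n} \<and> ?R (inv i))"
        by (rule conj_cong[OF refl]) (simp only: *[of i] permutes_inv simp_thms)
    qed
    also have "\<dots> \<longleftrightarrow> (\<exists>\<rho>. ?R \<rho>)"
    proof
      assume "\<exists>i. i permutes {1..n} \<and> ?R (inv i)"
      then show "\<exists>\<rho>. ?R \<rho>" by blast
    next
      assume "\<exists>\<rho>. ?R \<rho>"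
      then obtain \<rho> where \<rho>: "?R \<rho>" ..
      then have "inv \<rho> permutes {1..n} \<and> ?R (inv (inv \<rho>))"
        using permutes_inv[OF conjunct1[OF \<rho>]]
        by (simp only: permutes_inv_inv[OF conjunct1[OF \<rho>]] simp_thms)
      then show "\<exists>i. i permutes {1..n} \<and> ?R (inv i)" by (rule exI[where x = "inv \<rho>"])
    qed
    finally show ?thesis unfolding induces_def by (simp only:)
  qed
qed

section \<open>Order events under a permuton\<close>

definition order_cell :: "(real \<times> real) measure \<Rightarrow> nat \<Rightarrow> (nat \<Rightarrow> nat) \<Rightarrow> (nat \<Rightarrow> nat) \<Rightarrow> (nat \<Rightarrow> real \<times> real) set" where
  "order_cell \<mu> n \<rho> \<tau> = {p \<in> space (Pi\<^sub>M {1..n} (\<lambda>_. \<mu>)).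
     same_order n \<rho> (fst \<circ> p) \<and> same_order n \<tau> (snd \<circ> p)}"

definition order_event :: "nat \<Rightarrow> ((nat \<Rightarrow> real \<times> real) \<Rightarrow> bool) \<Rightarrow> bool" where
  "order_event n A \<longleftrightarrow> (\<forall>p q. same_order n (fst \<circ> p) (fst \<circ> q) \<longrightarrow>
     same_order n (snd \<circ> p) (snd \<circ> q) \<longrightarrow> A p \<longrightarrow> A q)"

context
  fixes \<mu> :: "(real \<times> real) measure"
  assumes permuton: "permuton \<mu>"
begin

lemma prob_space_permuton: "prob_space \<mu>"
  and sets_permuton: "sets \<mu> = sets (restrict_space borel unit_square)"
  using permuton by (simp_all add: permuton_def)

lemma space_permuton: "space \<mu> = unit_square"
  using sets_eq_imp_space_eq[OF sets_permuton] by (simp add: space_restrict_space)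

lemma id_measurable_permuton: "(\<lambda>q. q) \<in> measurable \<mu> borel"
proof -
  have "(\<lambda>q. q) \<in> measurable (restrict_space borel unit_square) (borel :: (real \<times> real) measure)"
    by (rule measurable_restrict_space1) simp
  then show ?thesis
    by (subst measurable_cong_sets[OF sets_permuton refl])
qed

lemma fst_measurable_permuton: "fst \<in> borel_measurable \<mu>"
  and snd_measurable_permuton: "snd \<in> borel_measurable \<mu>"
proof -
  have "(fst :: real \<times> real \<Rightarrow> real) \<in> borel_measurable borel"
       "(snd :: real \<times> real \<Rightarrow> real) \<in> borel_measurable borel"
    by (auto simp: borel_prod[symmetric])
  from measurable_compose[OF id_measurable_permuton this(1)]
    measurable_compose[OF id_measurable_permuton this(2)]
  show "fst \<in> borel_measurable \<mu>" "snd \<in> borel_measurable \<mu>" by simp_all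
qed

lemma fst_component_measurable:
  "j \<in> I \<Longrightarrow> (\<lambda>p. fst (p j)) \<in> borel_measurable (Pi\<^sub>M I (\<lambda>_. \<mu>))"
  using measurable_compose[OF measurable_component_singleton[of j I "\<lambda>_. \<mu>"] fst_measurable_permuton] .

lemma snd_component_measurable:
  "j \<in> I \<Longrightarrow> (\<lambda>p. snd (p j)) \<in> borel_measurable (Pi\<^sub>M I (\<lambda>_. \<mu>))"
  using measurable_compose[OF measurable_component_singleton[of j I "\<lambda>_. \<mu>"] snd_measurable_permuton] .

lemma measure_permuton_strip:
  assumes "0 \<le> a" "a \<le> b" "b \<le> 1"
  shows "measure \<mu> {q \<in> space \<mu>. fst q \<in> {a..b}} = b - a"
    and "measure \<mu> {q \<in> space \<mu>. snd q \<in> {a..b}} = b - a"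
proof -
  have "{q \<in> space \<mu>. fst q \<in> {a..b}} = {a..b} \<times> {0..1}"
       "{q \<in> space \<mu>. snd q \<in> {a..b}} = {0..1} \<times> {a..b}"
    using assms unfolding space_permuton unit_square_def by auto
  then show "measure \<mu> {q \<in> space \<mu>. fst q \<in> {a..b}} = b - a"
      "measure \<mu> {q \<in> space \<mu>. snd q \<in> {a..b}} = b - a"
    using permuton assms by (simp_all add: permuton_def)
qed

text \<open>A vertical or horizontal line is a strip of width zero, so the uniform marginals make it
  a null set; a line outside the unit square does not meet the space.\<close>

lemma AE_fst_neq: "AE q in \<mu>. fst q \<noteq> t"
  and AE_snd_neq: "AE q in \<mu>. snd q \<noteq> t"
proof -
  interpret prob_space \<mu> by (rule prob_space_permuton)
  note [measurable] = fst_measurable_permuton snd_measurable_permuton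
  have "{q \<in> space \<mu>. fst q = t} \<in> null_sets \<mu> \<and> {q \<in> space \<mu>. snd q = t} \<in> null_sets \<mu>"
  proof (cases "t \<in> {0..1}")
    case True
    with measure_permuton_strip[of t t]
    show ?thesis by (auto simp: emeasure_eq_measure intro!: null_setsI)
  next
    case False
    then have "{q \<in> space \<mu>. fst q = t} = {}" "{q \<in> space \<mu>. snd q = t} = {}"
      by (auto simp: space_permuton unit_square_def)
    then show ?thesis by (simp only: null_sets.empty_sets simp_thms)
  qed
  then show "AE q in \<mu>. fst q \<noteq> t" "AE q in \<mu>. snd q \<noteq> t"
    using AE_I'[of "{q \<in> space \<mu>. fst q = t}" \<mu> "\<lambda>q. fst q \<noteq> t"]
      AE_I'[of "{q \<in> space \<mu>. snd q = t}" \<mu> "\<lambda>q. snd q \<noteq> t"] by auto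
qed

lemma product_sigma_finite_permuton: "product_sigma_finite (\<lambda>_. \<mu>)"
  using prob_space_permuton
  by (simp add: product_sigma_finite_def prob_space_imp_sigma_finite)

text \<open>Fubini with the \<open>i\<close>th point in the inner integral: once \<open>p j\<close>
  is fixed, a tie means that \<open>f (p i)\<close> hits a single value, which has probability
  zero.\<close>

lemma AE_PiM_component_neq:
  assumes f: "f \<in> borel_measurable \<mu>" and neq: "\<And>t::real. AE q in \<mu>. f q \<noteq> t"
    and I: "finite I" "i \<in> I" "j \<in> I" "i \<noteq> j"
  shows "AE p in Pi\<^sub>M I (\<lambda>_. \<mu>). f (p i) \<noteq> f (p j)"
proof -
  let ?J = "I - {i}" and ?M = "Pi\<^sub>M I (\<lambda>_. \<mu>)"
  interpret product_sigma_finite "\<lambda>_. \<mu>" by (rule product_sigma_finite_permuton)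
  have I': "insert i ?J = I" using I by blast
  note [measurable] = f
  have m: "(\<lambda>p. f (p k)) \<in> borel_measurable ?M" if "k \<in> I" for k
    using that by measurable
  have E: "{p \<in> space ?M. f (p i) = f (p j)} \<in> sets ?M"
    using m[OF I(2)] m[OF I(3)] by measurable
  have "emeasure ?M {p \<in> space ?M. f (p i) = f (p j)} =
      (\<integral>\<^sup>+ p. indicator {p \<in> space ?M. f (p i) = f (p j)} p \<partial>Pi\<^sub>M (insert i ?J) (\<lambda>_. \<mu>))"
    using E by (simp only: I' nn_integral_indicator)
  also have "\<dots> = (\<integral>\<^sup>+ p. \<integral>\<^sup>+ q. indicator {p \<in> space ?M. f (p i) = f (p j)} (p(i := q)) \<partial>\<mu>
      \<partial>Pi\<^sub>M ?J (\<lambda>_. \<mu>))"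
    using I E by (intro product_nn_integral_insert)
      (simp_all only: I' finite_Diff borel_measurable_indicator Diff_iff singletonI simp_thms)
  also have "\<dots> = (\<integral>\<^sup>+ p. 0 \<partial>Pi\<^sub>M ?J (\<lambda>_. \<mu>))"
  proof (intro nn_integral_cong)
    fix p
    have "(\<integral>\<^sup>+ q. indicator {p \<in> space ?M. f (p i) = f (p j)} (p(i := q)) \<partial>\<mu>) = (\<integral>\<^sup>+ q. 0 \<partial>\<mu>)"
      using neq[of "f (p j)"] I by (intro nn_integral_cong_AE) (auto split: split_indicator)
    then show "(\<integral>\<^sup>+ q. indicator {p \<in> space ?M. f (p i) = f (p j)} (p(i := q)) \<partial>\<mu>) = 0" by simp
  qed
  finally have "{p \<in> space ?M. f (p i) = f (p j)} \<in> null_sets ?M"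
    using E by (intro null_setsI) simp_all
  then show ?thesis by (rule AE_I') auto
qed

lemma AE_PiM_no_ties:
  fixes n :: nat
  shows "AE p in Pi\<^sub>M {1..n} (\<lambda>_. \<mu>). inj_on (fst \<circ> p) {1..n} \<and> inj_on (snd \<circ> p) {1..n}"
proof -
  have fin: "finite {1..n}" by simp
  have "AE p in Pi\<^sub>M {1..n} (\<lambda>_. \<mu>). \<forall>i\<in>{1..n}. \<forall>j\<in>{1..n}. i \<noteq> j \<longrightarrow>
      fst (p i) \<noteq> fst (p j) \<and> snd (p i) \<noteq> snd (p j)"
  proof (intro AE_finite_allI fin)
    fix i j assume ij: "i \<in> {1..n}" "j \<in> {1..n}"
    show "AE p in Pi\<^sub>M {1..n} (\<lambda>_. \<mu>). i \<noteq> j \<longrightarrow> fst (p i) \<noteq> fst (p j) \<and> snd (p i) \<noteq> snd (p j)"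
    proof (cases "i = j")
      case False
      from AE_PiM_component_neq[OF fst_measurable_permuton AE_fst_neq fin ij False]
        AE_PiM_component_neq[OF snd_measurable_permuton AE_snd_neq fin ij False]
      show ?thesis by (simp add: eventually_conj_iff)
    qed simp
  qed
  then show ?thesis by eventually_elim (auto simp: inj_on_def)
qed

lemma order_cell_measurable: "order_cell \<mu> n \<rho> \<tau> \<in> sets (Pi\<^sub>M {1..n} (\<lambda>_. \<mu>))"
proof -
  have "Measurable.pred (Pi\<^sub>M {1..n} (\<lambda>_. \<mu>)) (\<lambda>p. \<forall>j\<in>{1..n}. \<forall>k\<in>{1..n}. P j k \<longleftrightarrow> f (p j) < (f (p k) :: real))"
    if "\<And>j. j \<in> {1..n} \<Longrightarrow> (\<lambda>p. f (p j)) \<in> borel_measurable (Pi\<^sub>M {1..n} (\<lambda>_. \<mu>))" for P f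
  proof (intro pred_intros_finite(3)[OF finite_atLeastAtMost])
    fix j k assume "j \<in> {1..n}" "k \<in> {1..n}"
    from borel_measurable_less[OF that[OF this(1)] that[OF this(2)]]
    have "Measurable.pred (Pi\<^sub>M {1..n} (\<lambda>_. \<mu>)) (\<lambda>p. f (p j) < f (p k))" by (simp only: pred_def)
    then show "Measurable.pred (Pi\<^sub>M {1..n} (\<lambda>_. \<mu>)) (\<lambda>p. P j k \<longleftrightarrow> f (p j) < f (p k))"
      by (cases "P j k") (simp_all add: pred_intros_logic)
  qed
  from this[OF fst_component_measurable] this[OF snd_component_measurable]
  have "Measurable.pred (Pi\<^sub>M {1..n} (\<lambda>_. \<mu>)) (\<lambda>p. same_order n \<rho> (fst \<circ> p) \<and> same_order n \<tau> (snd \<circ> p))"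
    unfolding same_order_def o_apply by (intro pred_intros_logic)
  then show ?thesis unfolding order_cell_def pred_def .
qed

lemma order_cell_disjoint:
  assumes "\<rho> permutes {1..n}" "\<rho>' permutes {1..n}" "\<tau> permutes {1..n}" "\<tau>' permutes {1..n}"
    and "p \<in> order_cell \<mu> n \<rho> \<tau>" "p \<in> order_cell \<mu> n \<rho>' \<tau>'"
  shows "\<rho> = \<rho>'" "\<tau> = \<tau>'"
proof -
  from assms(5,6) have "same_order n \<rho> (fst \<circ> p)" "same_order n \<rho>' (fst \<circ> p)"
      "same_order n \<tau> (snd \<circ> p)" "same_order n \<tau>' (snd \<circ> p)"
    by (simp_all add: order_cell_def)
  then have "same_order n \<rho> \<rho>'" "same_order n \<tau> \<tau>'"
    by (blast intro: same_order_sym same_order_trans)+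
  with assms show "\<rho> = \<rho>'" "\<tau> = \<tau>'"
    by (auto intro: permutes_same_order_unique)
qed

text \<open>Exchangeability: relabelling independent, identically distributed points by
  \<open>\<pi>\<close> preserves the product measure and composes both rank functions with
  \<open>\<pi>\<close>.\<close>

lemma measure_order_cell_comp:
  assumes \<pi>: "\<pi> permutes {1..n}"
  shows "measure (Pi\<^sub>M {1..n} (\<lambda>_. \<mu>)) (order_cell \<mu> n (\<rho> \<circ> \<pi>) (\<tau> \<circ> \<pi>)) =
    measure (Pi\<^sub>M {1..n} (\<lambda>_. \<mu>)) (order_cell \<mu> n \<rho> \<tau>)"
proof -
  let ?M = "Pi\<^sub>M {1..n} (\<lambda>_. \<mu>)" and ?t = "\<lambda>p. \<lambda>j\<in>{1..n}. p (\<pi> j)"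
  have \<pi>in: "\<pi> j \<in> {1..n}" if "j \<in> {1..n}" for j
    using permutes_in_image[OF \<pi>] that by simp
  have d: "distr ?M ?M ?t = ?M"
    using permutes_inj[OF \<pi>] \<pi>in prob_space_permuton
    by (intro distr_PiM_reindex) (auto intro: inj_on_subset)
  have t: "?t \<in> measurable ?M ?M"
    using \<pi>in by (intro measurable_restrict measurable_component_singleton)
  have so: "same_order n (\<rho> \<circ> \<pi>) (f \<circ> ?t p) \<longleftrightarrow> same_order n \<rho> (f \<circ> p)"
    for \<rho> :: "nat \<Rightarrow> nat" and f :: "real \<times> real \<Rightarrow> real" and p
  proof -
    have "same_order n (\<rho> \<circ> \<pi>) (f \<circ> ?t p) \<longleftrightarrow> same_order n (\<rho> \<circ> \<pi>) (f \<circ> p \<circ> \<pi>)"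
      unfolding same_order_def by (intro ball_cong refl) simp
    then show ?thesis using same_order_comp[OF \<pi>] by blast
  qed
  have "measure ?M (order_cell \<mu> n (\<rho> \<circ> \<pi>) (\<tau> \<circ> \<pi>)) =
      measure (distr ?M ?M ?t) (order_cell \<mu> n (\<rho> \<circ> \<pi>) (\<tau> \<circ> \<pi>))"
    by (simp only: d)
  also have "\<dots> = measure ?M (?t -` order_cell \<mu> n (\<rho> \<circ> \<pi>) (\<tau> \<circ> \<pi>) \<inter> space ?M)"
    by (rule measure_distr[OF t order_cell_measurable])
  also have "?t -` order_cell \<mu> n (\<rho> \<circ> \<pi>) (\<tau> \<circ> \<pi>) \<inter> space ?M = order_cell \<mu> n \<rho> \<tau>"
    using measurable_space[OF t] unfolding order_cell_def vimage_def by (auto simp only: so)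
  finally show ?thesis .
qed

text \<open>The event of inducing \<open>\<tau> \<circ> inv \<rho>\<close> is the disjoint union of
  \<open>fact n\<close> cells, one for each labelling of the points, and by exchangeability all of
  them are equally likely.\<close>

lemma measure_order_cell:
  assumes \<rho>: "\<rho> permutes {1..n}" and \<tau>: "\<tau> permutes {1..n}"
  shows "measure (Pi\<^sub>M {1..n} (\<lambda>_. \<mu>)) (order_cell \<mu> n \<rho> \<tau>) = perm_density n (\<tau> \<circ> inv \<rho>) \<mu> / fact n"
proof -
  let ?M = "Pi\<^sub>M {1..n} (\<lambda>_. \<mu>)" and ?\<sigma> = "\<tau> \<circ> inv \<rho>" and ?P = "{\<rho>. \<rho> permutes {1..n}}"
  interpret prob_space ?M using prob_space_permuton by (intro prob_space_PiM)
  have \<sigma>: "?\<sigma> permutes {1..n}"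
    by (rule permutes_compose[OF permutes_inv[OF \<rho>] \<tau>])
  have fin: "finite ?P" by (simp add: finite_permutations)
  have "{p \<in> space ?M. induces n p ?\<sigma>} = (\<Union>\<rho>'\<in>?P. order_cell \<mu> n \<rho>' (?\<sigma> \<circ> \<rho>'))"
    using \<sigma> unfolding induces_iff order_cell_def by blast
  then have "perm_density n ?\<sigma> \<mu> = measure ?M (\<Union>\<rho>'\<in>?P. order_cell \<mu> n \<rho>' (?\<sigma> \<circ> \<rho>'))"
    unfolding perm_density_def by simp
  also have "\<dots> = (\<Sum>\<rho>'\<in>?P. measure ?M (order_cell \<mu> n \<rho>' (?\<sigma> \<circ> \<rho>')))"
  proof (rule finite_measure_finite_Union[OF fin])
    show "(\<lambda>\<rho>'. order_cell \<mu> n \<rho>' (?\<sigma> \<circ> \<rho>')) ` ?P \<subseteq> sets ?M"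
      using order_cell_measurable by blast
    show "disjoint_family_on (\<lambda>\<rho>'. order_cell \<mu> n \<rho>' (?\<sigma> \<circ> \<rho>')) ?P"
      unfolding disjoint_family_on_def
      using order_cell_disjoint(1) permutes_compose[OF _ \<sigma>] by blast
  qed
  also have "\<dots> = (\<Sum>\<rho>'\<in>?P. measure ?M (order_cell \<mu> n \<rho> \<tau>))"
  proof (rule sum.cong[OF refl])
    fix \<rho>' assume "\<rho>' \<in> ?P"
    then have \<rho>': "\<rho>' permutes {1..n}" by simp
    \<comment> \<open>Both cells are relabellings of the one in which the points are numbered from
      left to right.\<close>
    have "measure ?M (order_cell \<mu> n (id \<circ> \<rho>') (?\<sigma> \<circ> \<rho>')) = measure ?M (order_cell \<mu> n id ?\<sigma>)"
      by (rule measure_order_cell_comp[OF \<rho>'])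
    also have "\<dots> = measure ?M (order_cell \<mu> n (id \<circ> \<rho>) (?\<sigma> \<circ> \<rho>))"
      by (rule measure_order_cell_comp[OF \<rho>, symmetric])
    also have "?\<sigma> \<circ> \<rho> = \<tau>"
      by (simp add: o_assoc[symmetric] permutes_inv_o[OF \<rho>])
    finally show "measure ?M (order_cell \<mu> n \<rho>' (?\<sigma> \<circ> \<rho>')) = measure ?M (order_cell \<mu> n \<rho> \<tau>)"
      by (simp only: id_o)
  qed
  also have "\<dots> = fact n * measure ?M (order_cell \<mu> n \<rho> \<tau>)"
    by (simp add: card_permutations[of _ n])
  finally show ?thesis by simp
qed

text \<open>Almost surely there are no ties, so a sample lies in exactly one cell, and
  \<open>A\<close> is constant on each cell; the points \<open>(\<rho> j, \<tau> j)\<close> with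
  integer coordinates serve as representative. The summation range does not mention
  \<open>\<mu>\<close>, so the densities alone determine the probability.\<close>

lemma prob_order_event:
  assumes A: "order_event n A"
    and meas: "{p \<in> space (Pi\<^sub>M {1..n} (\<lambda>_. \<mu>)). A p} \<in> sets (Pi\<^sub>M {1..n} (\<lambda>_. \<mu>))"
  shows "measure (Pi\<^sub>M {1..n} (\<lambda>_. \<mu>)) {p \<in> space (Pi\<^sub>M {1..n} (\<lambda>_. \<mu>)). A p} =
    (\<Sum>(\<rho>, \<tau>)\<in>{(\<rho>, \<tau>). \<rho> permutes {1..n} \<and> \<tau> permutes {1..n} \<and>
        A (\<lambda>j. (real (\<rho> j), real (\<tau> j)))}. perm_density n (\<tau> \<circ> inv \<rho>) \<mu> / fact n)"
proof -
  let ?M = "Pi\<^sub>M {1..n} (\<lambda>_. \<mu>)" and ?E = "{p \<in> space (Pi\<^sub>M {1..n} (\<lambda>_. \<mu>)). A p}"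
  let ?S = "{(\<rho>, \<tau>). \<rho> permutes {1..n} \<and> \<tau> permutes {1..n} \<and>
        A (\<lambda>j. (real (\<rho> j), real (\<tau> j)))}"
  let ?C = "\<lambda>(\<rho>, \<tau>). order_cell \<mu> n \<rho> \<tau>"
  interpret prob_space ?M using prob_space_permuton by (intro prob_space_PiM)
  have fin: "finite ?S"
    by (rule finite_subset[of _ "{\<rho>. \<rho> permutes {1..n}} \<times> {\<rho>. \<rho> permutes {1..n}}"])
      (auto simp: finite_permutations)
  have cell: "A p \<longleftrightarrow> A (\<lambda>j. (real (\<rho> j), real (\<tau> j)))" if "p \<in> order_cell \<mu> n \<rho> \<tau>" for p \<rho> \<tau>
  proof -
    let ?q = "\<lambda>j. (real (\<rho> j), real (\<tau> j))"
    have "same_order n (fst \<circ> p) (fst \<circ> ?q)" "same_order n (snd \<circ> p) (snd \<circ> ?q)"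
      using that by (auto simp: order_cell_def same_order_def)
    then show ?thesis
      using A unfolding order_event_def by (meson same_order_sym)
  qed
  have "measure ?M ?E = measure ?M (\<Union>(?C ` ?S))"
  proof (rule finite_measure_eq_AE)
    show "AE p in ?M. (p \<in> ?E) = (p \<in> \<Union>(?C ` ?S))"
      using AE_PiM_no_ties[of n] AE_space
    proof eventually_elim
      fix p
      assume "inj_on (fst \<circ> p) {1..n} \<and> inj_on (snd \<circ> p) {1..n}" and p: "p \<in> space ?M"
      then obtain \<rho> \<tau> where \<rho>\<tau>: "\<rho> permutes {1..n}" "\<tau> permutes {1..n}"
          "same_order n \<rho> (fst \<circ> p)" "same_order n \<tau> (snd \<circ> p)"
        using ex_permutes_same_order by blast
      then have "p \<in> order_cell \<mu> n \<rho> \<tau>" using p by (simp add: order_cell_def)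
      moreover have "p \<in> order_cell \<mu> n \<rho>' \<tau>' \<Longrightarrow> A p = A (\<lambda>j. (real (\<rho>' j), real (\<tau>' j)))" for \<rho>' \<tau>'
        by (rule cell)
      ultimately show "(p \<in> ?E) = (p \<in> \<Union>(?C ` ?S))"
        using p \<rho>\<tau>(1,2) by fast
    qed
    show "\<Union>(?C ` ?S) \<in> sets ?M"
      using fin order_cell_measurable by (intro sets.finite_Union) auto
  qed (rule meas)
  also have "\<dots> = (\<Sum>s\<in>?S. measure ?M (?C s))"
  proof (rule finite_measure_finite_Union[OF fin])
    show "?C ` ?S \<subseteq> sets ?M"
      using order_cell_measurable by auto
    show "disjoint_family_on ?C ?S"
      unfolding disjoint_family_on_def using order_cell_disjoint by fast
  qed
  also have "\<dots> = (\<Sum>(\<rho>, \<tau>)\<in>?S. perm_density n (\<tau> \<circ> inv \<rho>) \<mu> / fact n)"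
    by (rule sum.cong[OF refl]) (auto simp: measure_order_cell simp del: One_nat_def)
  finally show ?thesis .
qed

end

section \<open>Moments of the distribution function\<close>

definition cdf2 :: "(real \<times> real) measure \<Rightarrow> real \<Rightarrow> real \<Rightarrow> real" where
  "cdf2 \<mu> x y = measure \<mu> {q \<in> space \<mu>. fst q \<le> x \<and> snd q \<le> y}"

context
  fixes \<mu> :: "(real \<times> real) measure"
  assumes permuton: "permuton \<mu>"
begin

interpretation prob_space \<mu> by (rule prob_space_permuton[OF permuton])

lemmas [measurable] = fst_measurable_permuton[OF permuton] snd_measurable_permuton[OF permuton]

lemma measure_permuton_strip_le:
  assumes "a \<le> b"
  shows "measure \<mu> {q \<in> space \<mu>. fst q \<in> {a..b}} \<le> b - a"
    and "measure \<mu> {q \<in> space \<mu>. snd q \<in> {a..b}} \<le> b - a"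
proof -
  let ?a = "max 0 a" and ?b = "min 1 b"
  have eq: "{q \<in> space \<mu>. fst q \<in> {a..b}} = {q \<in> space \<mu>. fst q \<in> {?a..?b}}"
           "{q \<in> space \<mu>. snd q \<in> {a..b}} = {q \<in> space \<mu>. snd q \<in> {?a..?b}}"
    by (auto simp: space_permuton[OF permuton] unit_square_def)
  have "measure \<mu> {q \<in> space \<mu>. fst q \<in> {?a..?b}} \<le> b - a \<and>
      measure \<mu> {q \<in> space \<mu>. snd q \<in> {?a..?b}} \<le> b - a"
  proof (cases "?a \<le> ?b")
    case True
    then show ?thesis using measure_permuton_strip[OF permuton, of ?a ?b] by linarith
  next
    case False
    then have "{?a..?b} = {}" by simp
    then show ?thesis using assms by (simp only: empty_iff) simp
  qed
  then show "measure \<mu> {q \<in> space \<mu>. fst q \<in> {a..b}} \<le> b - a"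
       "measure \<mu> {q \<in> space \<mu>. snd q \<in> {a..b}} \<le> b - a"
    unfolding eq by blast+
qed

lemma cdf2_nonneg: "0 \<le> cdf2 \<mu> x y" and cdf2_le_1: "cdf2 \<mu> x y \<le> 1"
  by (simp_all add: cdf2_def)

lemma cdf2_mono: "x \<le> x' \<Longrightarrow> y \<le> y' \<Longrightarrow> cdf2 \<mu> x y \<le> cdf2 \<mu> x' y'"
  unfolding cdf2_def by (rule finite_measure_mono) auto

text \<open>The larger quadrant is covered by the smaller one, a vertical strip and a horizontal
  strip, and the marginals bound the mass of a strip by its width. This is where the continuity of
  \<open>F\<close> comes from.\<close>

lemma cdf2_diff_le:
  assumes "x \<le> x'" "y \<le> y'"
  shows "cdf2 \<mu> x' y' - cdf2 \<mu> x y \<le> (x' - x) + (y' - y)"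
proof -
  let ?A = "{q \<in> space \<mu>. fst q \<in> {x..x'}}" and ?B = "{q \<in> space \<mu>. snd q \<in> {y..y'}}"
  let ?C = "{q \<in> space \<mu>. fst q \<le> x \<and> snd q \<le> y}"
  have "cdf2 \<mu> x' y' \<le> measure \<mu> (?A \<union> ?B \<union> ?C)"
    unfolding cdf2_def by (rule finite_measure_mono) auto
  also have "\<dots> \<le> measure \<mu> (?A \<union> ?B) + measure \<mu> ?C"
    by (rule measure_Un_le) auto
  also have "measure \<mu> (?A \<union> ?B) \<le> measure \<mu> ?A + measure \<mu> ?B"
    by (rule measure_Un_le) auto
  finally show ?thesis
    using measure_permuton_strip_le(1)[OF assms(1)] measure_permuton_strip_le(2)[OF assms(2)]
    by (simp add: cdf2_def)
qed

lemma cdf2_lipschitz: "\<bar>cdf2 \<mu> x y - cdf2 \<mu> x' y'\<bar> \<le> \<bar>x - x'\<bar> + \<bar>y - y'\<bar>"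
proof -
  let ?u = "min x x'" and ?v = "max x x'" and ?s = "min y y'" and ?t = "max y y'"
  have "cdf2 \<mu> ?u ?s \<le> cdf2 \<mu> x y" "cdf2 \<mu> x y \<le> cdf2 \<mu> ?v ?t"
       "cdf2 \<mu> ?u ?s \<le> cdf2 \<mu> x' y'" "cdf2 \<mu> x' y' \<le> cdf2 \<mu> ?v ?t"
    by (auto intro!: cdf2_mono)
  with cdf2_diff_le[of ?u ?v ?s ?t] show ?thesis by (auto simp: min_def max_def abs_if split: if_splits)
qed

lemma tendsto_cdf2:
  assumes "(f \<longlongrightarrow> x) G" "(g \<longlongrightarrow> y) G"
  shows "((\<lambda>t. cdf2 \<mu> (f t) (g t)) \<longlongrightarrow> cdf2 \<mu> x y) G"
proof -
  have lim: "((\<lambda>t. \<bar>f t - x\<bar> + \<bar>g t - y\<bar>) \<longlongrightarrow> \<bar>x - x\<bar> + \<bar>y - y\<bar>) G"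
    by (intro tendsto_intros assms)
  have "((\<lambda>t. cdf2 \<mu> (f t) (g t) - cdf2 \<mu> x y) \<longlongrightarrow> 0) G"
  proof (rule Lim_null_comparison)
    show "\<forall>\<^sub>F t in G. norm (cdf2 \<mu> (f t) (g t) - cdf2 \<mu> x y) \<le> \<bar>f t - x\<bar> + \<bar>g t - y\<bar>"
      by (rule always_eventually) (simp add: cdf2_lipschitz)
    show "((\<lambda>t. \<bar>f t - x\<bar> + \<bar>g t - y\<bar>) \<longlongrightarrow> 0) G"
      using lim by simp
  qed
  then show ?thesis by (simp add: LIM_zero_iff)
qed

lemma continuous_on_cdf2:
  "continuous_on S f \<Longrightarrow> continuous_on S g \<Longrightarrow> continuous_on S (\<lambda>t. cdf2 \<mu> (f t) (g t))"
  unfolding continuous_on_def using tendsto_cdf2 by blast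

lemma measurable_cdf2:
  assumes "f \<in> borel_measurable M" "g \<in> borel_measurable M"
  shows "(\<lambda>t. cdf2 \<mu> (f t) (g t)) \<in> borel_measurable M"
proof -
  have "(\<lambda>z. cdf2 \<mu> (fst z) (snd z)) \<in> borel_measurable borel"
    by (intro borel_measurable_continuous_onI continuous_on_cdf2 continuous_intros)
  from measurable_compose[OF borel_measurable_Pair[OF assms] this] show ?thesis by simp
qed

lemma cdf2_right: "x \<in> {0..1} \<Longrightarrow> cdf2 \<mu> x 1 = x" and cdf2_top: "y \<in> {0..1} \<Longrightarrow> cdf2 \<mu> 1 y = y"
proof -
  have "{q \<in> space \<mu>. fst q \<le> x \<and> snd q \<le> 1} = {q \<in> space \<mu>. fst q \<in> {0..x}}"
       "{q \<in> space \<mu>. fst q \<le> 1 \<and> snd q \<le> y} = {q \<in> space \<mu>. snd q \<in> {0..y}}"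
    by (auto simp: space_permuton[OF permuton] unit_square_def)
  then show "x \<in> {0..1} \<Longrightarrow> cdf2 \<mu> x 1 = x" "y \<in> {0..1} \<Longrightarrow> cdf2 \<mu> 1 y = y"
    unfolding cdf2_def using measure_permuton_strip[OF permuton] by auto
qed

end

text \<open>Index \<open>0\<close> stands for the coordinate \<open>1\<close>, so that the numbers \<open>x i\<close> and \<open>y j\<close> are themselves
  values \<open>F (x i) (y 0)\<close> and \<open>F (x 0) (y j)\<close> of the distribution function.\<close>

definition grid_x :: "(nat \<Rightarrow> real \<times> real) \<Rightarrow> nat \<Rightarrow> real" where
  "grid_x p i = (if i = 0 then 1 else fst (p i))"

definition grid_y :: "(nat \<Rightarrow> real \<times> real) \<Rightarrow> nat \<Rightarrow> real" where
  "grid_y p j = (if j = 0 then 1 else snd (p j))"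

text \<open>Index 0 drops the condition instead of comparing with the coordinate 1. On the unit
  square both mean the same, but in this form the event is determined by the order of the sample
  points, among whose coordinates 1 need not occur.\<close>

definition below :: "nat \<times> nat \<Rightarrow> (nat \<Rightarrow> real \<times> real) \<Rightarrow> real \<times> real \<Rightarrow> bool" where
  "below a p q \<longleftrightarrow> (fst a = 0 \<or> fst q \<le> fst (p (fst a))) \<and> (snd a = 0 \<or> snd q \<le> snd (p (snd a)))"

text \<open>A monomial in values of the distribution function at the first \<open>m\<close> points is the conditional
  probability that the points after the \<open>m\<close>th one lie below the corresponding grid points.\<close>

fun all_below :: "nat \<Rightarrow> (nat \<times> nat) list \<Rightarrow> (nat \<Rightarrow> real \<times> real) \<Rightarrow> bool" where
  "all_below m [] p \<longleftrightarrow> True"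
| "all_below m (a # as) p \<longleftrightarrow> below a p (p (m + Suc (length as))) \<and> all_below m as p"

definition monom_eval :: "(real \<Rightarrow> real \<Rightarrow> real) \<Rightarrow> (nat \<Rightarrow> real) \<Rightarrow> (nat \<Rightarrow> real) \<Rightarrow> (nat \<times> nat) list \<Rightarrow> real" where
  "monom_eval F x y as = (\<Prod>(i, j)\<leftarrow>as. F (x i) (y j))"

lemma order_event_below:
  assumes "fst a \<le> n" "snd a \<le> n" "k \<in> {1..n}"
  shows "order_event n (\<lambda>p. below a p (p k))"
proof -
  have "f (q k) \<le> f (q i)"
    if "same_order n (f \<circ> p) (f \<circ> q)" "i \<le> n" "i \<noteq> 0" "f (p k) \<le> f (p i)"
    for f :: "real \<times> real \<Rightarrow> real" and p q :: "nat \<Rightarrow> real \<times> real" and i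
  proof -
    have "i \<in> {1..n}" using that(2,3) by simp
    then have "f (p i) < f (p k) \<longleftrightarrow> f (q i) < f (q k)"
      using that(1) assms(3) by (simp only: same_order_def o_apply)
    then show ?thesis using that(4) by (simp add: not_less[symmetric])
  qed
  note * = this[of fst] this[of snd]
  show ?thesis
    unfolding order_event_def below_def using * assms(1,2) by blast
qed

lemma order_event_all_below:
  assumes "set as \<subseteq> {..m} \<times> {..m}" "m + length as \<le> n"
  shows "order_event n (all_below m as)"
  using assms
proof (induction as)
  case Nil
  have "all_below m [] = (\<lambda>_. True)" by (rule ext) simp
  then show ?case by (simp add: order_event_def)
next
  case (Cons a as)
  have "order_event n (\<lambda>p. below a p (p (m + Suc (length as))))"
    using Cons.prems by (intro order_event_below) auto
  moreover have "order_event n (all_below m as)"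
    using Cons by simp
  ultimately show ?case
    unfolding order_event_def all_below.simps by blast
qed

lemma all_below_upd:
  assumes "set as \<subseteq> {..m} \<times> {..m}" "m + length as < k"
  shows "all_below m as (p(k := q)) \<longleftrightarrow> all_below m as p"
  using assms by (induction as) (auto simp: below_def)

context
  fixes \<mu> :: "(real \<times> real) measure"
  assumes permuton: "permuton \<mu>"
begin

interpretation prob_space \<mu> by (rule prob_space_permuton[OF permuton])

lemmas [measurable] = fst_measurable_permuton[OF permuton] snd_measurable_permuton[OF permuton]

lemma measurable_grid_x: "i \<le> m \<Longrightarrow> (\<lambda>p. grid_x p i) \<in> borel_measurable (Pi\<^sub>M {1..m} (\<lambda>_. \<mu>))"
  and measurable_grid_y: "i \<le> m \<Longrightarrow> (\<lambda>p. grid_y p i) \<in> borel_measurable (Pi\<^sub>M {1..m} (\<lambda>_. \<mu>))"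
  unfolding grid_x_def grid_y_def
  using fst_component_measurable[OF permuton, of i "{1..m}"] snd_component_measurable[OF permuton, of i "{1..m}"]
  by (cases "i = 0"; simp)+

lemma measurable_monom_eval:
  assumes "set as \<subseteq> {..m} \<times> {..m}"
  shows "(\<lambda>p. monom_eval (cdf2 \<mu>) (grid_x p) (grid_y p) as) \<in> borel_measurable (Pi\<^sub>M {1..m} (\<lambda>_. \<mu>))"
  using assms
proof (induction as)
  case (Cons a as)
  then have "(\<lambda>p. monom_eval (cdf2 \<mu>) (grid_x p) (grid_y p) as) \<in> borel_measurable (Pi\<^sub>M {1..m} (\<lambda>_. \<mu>))"
    by simp
  moreover have "(\<lambda>p. cdf2 \<mu> (grid_x p (fst a)) (grid_y p (snd a))) \<in> borel_measurable (Pi\<^sub>M {1..m} (\<lambda>_. \<mu>))"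
    using Cons.prems by (intro measurable_cdf2[OF permuton] measurable_grid_x measurable_grid_y) auto
  ultimately show ?case
    by (simp add: monom_eval_def case_prod_beta borel_measurable_times)
qed (simp add: monom_eval_def)

lemma monom_eval_bounds:
  "0 \<le> monom_eval (cdf2 \<mu>) x y as" "monom_eval (cdf2 \<mu>) x y as \<le> 1"
  by (induction as) (auto simp: monom_eval_def cdf2_nonneg[OF permuton] cdf2_le_1[OF permuton]
      intro!: mult_le_one)

lemma measurable_below:
  assumes "fst a \<le> n" "snd a \<le> n" "k \<in> {1..n}"
  shows "Measurable.pred (Pi\<^sub>M {1..n} (\<lambda>_. \<mu>)) (\<lambda>p. below a p (p k))"
proof -
  let ?M = "Pi\<^sub>M {1..n} (\<lambda>_. \<mu>)"
  have "Measurable.pred ?M (\<lambda>p. i = 0 \<or> f (p k) \<le> (f (p i) :: real))"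
    if "i \<le> n" "\<And>i. i \<in> {1..n} \<Longrightarrow> (\<lambda>p. f (p i)) \<in> borel_measurable ?M" for f i
  proof (cases "i = 0")
    case False
    then have "i \<in> {1..n}" using that(1) by simp
    from borel_measurable_le[OF that(2)[OF assms(3)] that(2)[OF this]] False
    show ?thesis by (simp add: pred_def)
  qed simp
  from this[OF assms(1) fst_component_measurable[OF permuton]]
    this[OF assms(2) snd_component_measurable[OF permuton]]
  show ?thesis unfolding below_def by (rule pred_intros_logic)
qed

lemma measurable_all_below:
  assumes "set as \<subseteq> {..m} \<times> {..m}" "m + length as \<le> n"
  shows "Measurable.pred (Pi\<^sub>M {1..n} (\<lambda>_. \<mu>)) (all_below m as)"
  using assms
proof (induction as)
  case Nil
  have "all_below m [] = (\<lambda>_. True)" by (rule ext) simp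
  then show ?case by simp
next
  case (Cons a as)
  have "Measurable.pred (Pi\<^sub>M {1..n} (\<lambda>_. \<mu>)) (\<lambda>p. below a p (p (m + Suc (length as))))"
    using Cons.prems by (intro measurable_below) auto
  moreover have "Measurable.pred (Pi\<^sub>M {1..n} (\<lambda>_. \<mu>)) (all_below m as)"
    using Cons by simp
  ultimately show ?case
    unfolding all_below.simps by (rule pred_intros_logic)
qed

lemma emeasure_below:
  "emeasure \<mu> {q \<in> space \<mu>. below a p q} = ennreal (cdf2 \<mu> (grid_x p (fst a)) (grid_y p (snd a)))"
proof -
  have "{q \<in> space \<mu>. below a p q} = {q \<in> space \<mu>. fst q \<le> grid_x p (fst a) \<and> snd q \<le> grid_y p (snd a)}"
    by (auto simp: space_permuton[OF permuton] unit_square_def below_def grid_x_def grid_y_def)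
  then show ?thesis by (simp add: cdf2_def emeasure_eq_measure)
qed

text \<open>Induction by integrating out the last sample point, which contributes one factor
  \<open>F (x i) (y j)\<close>. The weight \<open>h\<close> collects the factors already split off;
  it depends on the first \<open>m\<close> points alone and so passes unchanged through the
  integration of the later ones.\<close>

lemma nn_integral_all_below:
  assumes "set as \<subseteq> {..m} \<times> {..m}"
    and "\<And>k. m \<le> k \<Longrightarrow> h \<in> borel_measurable (Pi\<^sub>M {1..k} (\<lambda>_. \<mu>))"
    and "\<And>p k q. m < k \<Longrightarrow> h (p(k := q)) = h p"
  shows "(\<integral>\<^sup>+ p. h p * indicator {p. all_below m as p} p \<partial>Pi\<^sub>M {1..m + length as} (\<lambda>_. \<mu>)) =
    (\<integral>\<^sup>+ p. h p * ennreal (monom_eval (cdf2 \<mu>) (grid_x p) (grid_y p) as) \<partial>Pi\<^sub>M {1..m} (\<lambda>_. \<mu>))"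
  using assms
proof (induction as arbitrary: h)
  case Nil
  then show ?case by (simp add: monom_eval_def)
next
  case (Cons a as)
  interpret product_sigma_finite "\<lambda>_::nat. \<mu>" by (rule product_sigma_finite_permuton[OF permuton])
  let ?n = "m + length as"
  let ?e = "\<lambda>p. ennreal (cdf2 \<mu> (grid_x p (fst a)) (grid_y p (snd a)))"
  \<comment> \<open>The head of the list belongs to the point with the largest index, so removing
    the head removes exactly the last coordinate of the product.\<close>
  have I: "{1..m + length (a # as)} = insert (Suc ?n) {1..?n}" by auto
  have sub: "set as \<subseteq> {..m} \<times> {..m}" and a: "fst a \<le> m" "snd a \<le> m"
    using Cons.prems(1) by auto
  have meas: "(\<lambda>p. h p * indicator {p. all_below m (a # as) p} p)
      \<in> borel_measurable (Pi\<^sub>M (insert (Suc ?n) {1..?n}) (\<lambda>_. \<mu>))"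
  proof -
    have "Measurable.pred (Pi\<^sub>M {1..m + length (a # as)} (\<lambda>_. \<mu>)) (all_below m (a # as))"
      using Cons.prems(1) by (intro measurable_all_below) auto
    moreover have "h \<in> borel_measurable (Pi\<^sub>M {1..m + length (a # as)} (\<lambda>_. \<mu>))"
      by (rule Cons.prems(2)) simp
    ultimately show ?thesis
      unfolding I by measurable
  qed
  have em: "?e \<in> borel_measurable (Pi\<^sub>M {1..k} (\<lambda>_. \<mu>))" if "m \<le> k" for k
    using a that by (intro measurable_compose[OF _ measurable_ennreal] measurable_cdf2[OF permuton]
        measurable_grid_x measurable_grid_y) auto
  have "(\<integral>\<^sup>+ p. h p * indicator {p. all_below m (a # as) p} p \<partial>Pi\<^sub>M {1..m + length (a # as)} (\<lambda>_. \<mu>)) =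
      (\<integral>\<^sup>+ p. (\<integral>\<^sup>+ q. h (p(Suc ?n := q)) * indicator {p. all_below m (a # as) p} (p(Suc ?n := q)) \<partial>\<mu>)
        \<partial>Pi\<^sub>M {1..?n} (\<lambda>_. \<mu>))"
    unfolding I by (rule product_nn_integral_insert[OF _ _ meas]) auto
  also have "\<dots> = (\<integral>\<^sup>+ p. (h p * ?e p) * indicator {p. all_below m as p} p \<partial>Pi\<^sub>M {1..?n} (\<lambda>_. \<mu>))"
  proof (rule nn_integral_cong)
    fix p assume "p \<in> space (Pi\<^sub>M {1..?n} (\<lambda>_. \<mu>))"
    have S: "{q \<in> space \<mu>. below a p q} \<in> sets \<mu>"
      unfolding below_def by measurable
    have upd: "all_below m (a # as) (p(Suc ?n := q)) \<longleftrightarrow> below a p q \<and> all_below m as p"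
      "h (p(Suc ?n := q)) = h p" for q
      using a all_below_upd[OF sub, of "Suc ?n" p q] Cons.prems(3)[of "Suc ?n" p q]
      by (simp_all add: below_def del: fun_upd_apply) (simp add: below_def)
    have "(\<integral>\<^sup>+ q. h (p(Suc ?n := q)) * indicator {p. all_below m (a # as) p} (p(Suc ?n := q)) \<partial>\<mu>) =
        (\<integral>\<^sup>+ q. (h p * indicator {p. all_below m as p} p) * indicator {q \<in> space \<mu>. below a p q} q \<partial>\<mu>)"
      by (intro nn_integral_cong) (simp add: upd indicator_def del: fun_upd_apply all_below.simps)
    also have "\<dots> = (h p * indicator {p. all_below m as p} p) * ?e p"
      using S by (simp only: nn_integral_cmult_indicator emeasure_below)
    finally show "(\<integral>\<^sup>+ q. h (p(Suc ?n := q)) * indicator {p. all_below m (a # as) p} (p(Suc ?n := q)) \<partial>\<mu>) =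
        (h p * ?e p) * indicator {p. all_below m as p} p"
      by (simp only: mult.assoc mult.commute mult.left_commute)
  qed
  also have "\<dots> = (\<integral>\<^sup>+ p. (h p * ?e p) * ennreal (monom_eval (cdf2 \<mu>) (grid_x p) (grid_y p) as) \<partial>Pi\<^sub>M {1..m} (\<lambda>_. \<mu>))"
  proof (rule Cons.IH[OF sub])
    show "(\<lambda>p. h p * ?e p) \<in> borel_measurable (Pi\<^sub>M {1..k} (\<lambda>_. \<mu>))" if "m \<le> k" for k
      using Cons.prems(2)[OF that] em[OF that] by (rule borel_measurable_times_ennreal)
    show "h (p(k := q)) * ?e (p(k := q)) = h p * ?e p" if "m < k" for p k q
    proof -
      have "grid_x (p(k := q)) (fst a) = grid_x p (fst a)" "grid_y (p(k := q)) (snd a) = grid_y p (snd a)"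
        using a that by (simp_all add: grid_x_def grid_y_def)
      then show ?thesis by (simp only: Cons.prems(3)[OF that])
    qed
  qed
  also have "\<dots> = (\<integral>\<^sup>+ p. h p * ennreal (monom_eval (cdf2 \<mu>) (grid_x p) (grid_y p) (a # as)) \<partial>Pi\<^sub>M {1..m} (\<lambda>_. \<mu>))"
    by (simp add: monom_eval_def case_prod_beta ennreal_mult' cdf2_nonneg[OF permuton] mult.assoc)
  finally show ?case .
qed

lemma integral_monom_eval:
  assumes "set as \<subseteq> {..m} \<times> {..m}"
  shows "(\<integral> p. monom_eval (cdf2 \<mu>) (grid_x p) (grid_y p) as \<partial>Pi\<^sub>M {1..m} (\<lambda>_. \<mu>)) =
    measure (Pi\<^sub>M {1..m + length as} (\<lambda>_. \<mu>))
      {p \<in> space (Pi\<^sub>M {1..m + length as} (\<lambda>_. \<mu>)). all_below m as p}"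
proof -
  let ?M = "Pi\<^sub>M {1..m} (\<lambda>_. \<mu>)" and ?N = "Pi\<^sub>M {1..m + length as} (\<lambda>_. \<mu>)"
  have E: "{p \<in> space ?N. all_below m as p} \<in> sets ?N"
    using measurable_all_below[OF assms order_refl] by (simp only: pred_def)
  have "(\<integral>\<^sup>+ p. ennreal (monom_eval (cdf2 \<mu>) (grid_x p) (grid_y p) as) \<partial>?M) =
      (\<integral>\<^sup>+ p. indicator {p. all_below m as p} p \<partial>?N)"
    using nn_integral_all_below[OF assms, of "\<lambda>_. 1"] by simp
  also have "\<dots> = (\<integral>\<^sup>+ p. indicator {p \<in> space ?N. all_below m as p} p \<partial>?N)"
    by (intro nn_integral_cong) (auto split: split_indicator)
  also have "\<dots> = emeasure ?N {p \<in> space ?N. all_below m as p}"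
    using E by (rule nn_integral_indicator)
  finally show ?thesis
    using measurable_monom_eval[OF assms]
    by (subst integral_eq_nn_integral) (simp_all add: monom_eval_bounds measure_def)
qed

end

section \<open>Polynomial functionals of the distribution function\<close>

type_synonym grid_functional =
  "(real \<Rightarrow> real \<Rightarrow> real) \<Rightarrow> (nat \<Rightarrow> real) \<Rightarrow> (nat \<Rightarrow> real) \<Rightarrow> real"

text \<open>The list of coefficients and monomials is chosen before \<open>F\<close>, so one
  polynomial serves all permutons at once. \<open>I\<close> and \<open>J\<close> record which points
  may supply an x-coordinate and which a y-coordinate.\<close>

definition grid_poly :: "nat set \<Rightarrow> nat set \<Rightarrow> grid_functional \<Rightarrow> bool" where
  "grid_poly I J f \<longleftrightarrow> (\<exists>ps. (\<forall>(c, as)\<in>set ps. set as \<subseteq> I \<times> J) \<and>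
     (\<forall>F x y. f F x y = (\<Sum>(c, as)\<leftarrow>ps. c * monom_eval F x y as)))"

lemma grid_poly_const: "grid_poly I J (\<lambda>F x y. c)"
  unfolding grid_poly_def by (rule exI[of _ "[(c, [])]"]) (simp add: monom_eval_def)

lemma grid_poly_atom:
  assumes "i \<in> I" "j \<in> J"
  shows "grid_poly I J (\<lambda>F x y. F (x i) (y j))"
  unfolding grid_poly_def using assms by (intro exI[of _ "[(1, [(i, j)])]"]) (simp add: monom_eval_def)

lemma grid_poly_add:
  assumes "grid_poly I J f" "grid_poly I J g"
  shows "grid_poly I J (\<lambda>F x y. f F x y + g F x y)"
proof -
  from assms obtain ps qs where "\<forall>(c, as)\<in>set ps. set as \<subseteq> I \<times> J"
    "\<forall>F x y. f F x y = (\<Sum>(c, as)\<leftarrow>ps. c * monom_eval F x y as)"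
    "\<forall>(c, as)\<in>set qs. set as \<subseteq> I \<times> J"
    "\<forall>F x y. g F x y = (\<Sum>(c, as)\<leftarrow>qs. c * monom_eval F x y as)"
    unfolding grid_poly_def by blast
  then show ?thesis
    unfolding grid_poly_def by (intro exI[of _ "ps @ qs"]) auto
qed

lemma grid_poly_mult:
  assumes "grid_poly I J f" "grid_poly I J g"
  shows "grid_poly I J (\<lambda>F x y. f F x y * g F x y)"
proof -
  from assms obtain ps qs where ps: "\<forall>(c, as)\<in>set ps. set as \<subseteq> I \<times> J"
    "\<forall>F x y. f F x y = (\<Sum>(c, as)\<leftarrow>ps. c * monom_eval F x y as)"
    and qs: "\<forall>(c, as)\<in>set qs. set as \<subseteq> I \<times> J"
    "\<forall>F x y. g F x y = (\<Sum>(c, as)\<leftarrow>qs. c * monom_eval F x y as)"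
    unfolding grid_poly_def by blast
  define rs where "rs = concat (map (\<lambda>(c, as). map (\<lambda>(d, bs). (c * d, as @ bs)) qs) ps)"
  have app: "monom_eval F x y (as @ bs) = monom_eval F x y as * monom_eval F x y bs" for F x y as bs
    by (simp add: monom_eval_def)
  have row: "(\<Sum>(e, cs)\<leftarrow>map (\<lambda>(d, bs). (c * d, as @ bs)) qs. e * monom_eval F x y cs) =
      c * monom_eval F x y as * g F x y" for c as F x y
    unfolding qs(2)[rule_format]
    by (induction qs) (auto simp: app algebra_simps)
  have "(\<Sum>(e, cs)\<leftarrow>rs. e * monom_eval F x y cs) = f F x y * g F x y" for F x y
    unfolding ps(2)[rule_format] rs_def
    by (induction ps) (auto simp: row[unfolded map_map] distrib_right)
  moreover have "\<forall>(c, as)\<in>set rs. set as \<subseteq> I \<times> J"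
    using ps(1) qs(1) unfolding rs_def by fastforce
  ultimately show ?thesis
    unfolding grid_poly_def by (intro exI[of _ rs]) simp
qed

lemma grid_poly_diff:
  assumes "grid_poly I J f" "grid_poly I J g"
  shows "grid_poly I J (\<lambda>F x y. f F x y - g F x y)"
  using grid_poly_add[OF assms(1) grid_poly_mult[OF grid_poly_const[of I J "-1"] assms(2)]] by simp

lemmas grid_poly_intros =
  grid_poly_const grid_poly_atom grid_poly_add grid_poly_mult grid_poly_diff

lemma grid_poly_mono:
  assumes "grid_poly I J f" "I \<subseteq> I'" "J \<subseteq> J'"
  shows "grid_poly I' J' f"
proof -
  from assms(1) obtain ps where ps: "\<forall>(c, as)\<in>set ps. set as \<subseteq> I \<times> J"
    "\<forall>F x y. f F x y = (\<Sum>(c, as)\<leftarrow>ps. c * monom_eval F x y as)"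
    unfolding grid_poly_def by blast
  have "I \<times> J \<subseteq> I' \<times> J'" using assms(2,3) by blast
  then have "\<forall>(c, as)\<in>set ps. set as \<subseteq> I' \<times> J'" using ps(1) by fast
  with ps(2) show ?thesis unfolding grid_poly_def by blast
qed

lemma grid_poly_cong:
  assumes "grid_poly I J f" "\<And>i. i \<in> I \<Longrightarrow> x i = x' i" "\<And>j. j \<in> J \<Longrightarrow> y j = y' j"
  shows "f F x y = f F x' y'"
proof -
  from assms(1) obtain ps where ps: "\<forall>(c, as)\<in>set ps. set as \<subseteq> I \<times> J"
    "\<forall>F x y. f F x y = (\<Sum>(c, as)\<leftarrow>ps. c * monom_eval F x y as)"
    unfolding grid_poly_def by blast
  have "monom_eval F x y as = monom_eval F x' y' as" if "set as \<subseteq> I \<times> J" for as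
    using that assms(2,3) unfolding monom_eval_def by (intro arg_cong[of _ _ prod_list] map_cong) auto
  then show ?thesis
    unfolding ps(2)[rule_format] using ps(1) by (intro arg_cong[of _ _ sum_list] map_cong) auto
qed

definition same_densities :: "nat \<Rightarrow> (real \<times> real) measure \<Rightarrow> (real \<times> real) measure \<Rightarrow> bool" where
  "same_densities N \<mu> \<mu>' \<longleftrightarrow>
     (\<forall>n\<le>N. \<forall>\<sigma>. \<sigma> permutes {1..n} \<longrightarrow> perm_density n \<sigma> \<mu> = perm_density n \<sigma> \<mu>')"

lemma same_densities_mono: "same_densities N \<mu> \<mu>' \<Longrightarrow> M \<le> N \<Longrightarrow> same_densities M \<mu> \<mu>'"
  by (simp add: same_densities_def)

definition expect :: "nat \<Rightarrow> grid_functional \<Rightarrow> (real \<times> real) measure \<Rightarrow> real" where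
  "expect m f \<mu> = (\<integral> p. f (cdf2 \<mu>) (grid_x p) (grid_y p) \<partial>Pi\<^sub>M {1..m} (\<lambda>_. \<mu>))"

lemma integral_monom_eval_eq:
  assumes "permuton \<mu>" "permuton \<mu>'" "same_densities (m + length as) \<mu> \<mu>'"
    and sub: "set as \<subseteq> {..m} \<times> {..m}"
  shows "expect m (\<lambda>F x y. monom_eval F x y as) \<mu> = expect m (\<lambda>F x y. monom_eval F x y as) \<mu>'"
proof -
  let ?n = "m + length as"
  have ev: "order_event ?n (all_below m as)"
    using sub by (rule order_event_all_below) simp
  have meas: "{p \<in> space (Pi\<^sub>M {1..?n} (\<lambda>_. \<nu>)). all_below m as p} \<in> sets (Pi\<^sub>M {1..?n} (\<lambda>_. \<nu>))"
    if "permuton \<nu>" for \<nu>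
    using measurable_all_below[OF that sub order_refl] by (simp only: pred_def)
  have "perm_density ?n (\<tau> \<circ> inv \<rho>) \<mu> = perm_density ?n (\<tau> \<circ> inv \<rho>) \<mu>'"
    if "\<rho> permutes {1..?n}" "\<tau> permutes {1..?n}" for \<rho> \<tau>
    using assms(3) permutes_compose[OF permutes_inv[OF that(1)] that(2)]
    unfolding same_densities_def by blast
  then show ?thesis
    unfolding expect_def integral_monom_eval[OF assms(1) sub] integral_monom_eval[OF assms(2) sub]
      prob_order_event[OF assms(1) ev meas[OF assms(1)]] prob_order_event[OF assms(2) ev meas[OF assms(2)]]
    by (intro sum.cong refl) (auto simp del: One_nat_def)
qed

lemma integrable_monom_eval:
  assumes "permuton \<mu>" "set as \<subseteq> {..m} \<times> {..m}"
  shows "integrable (Pi\<^sub>M {1..m} (\<lambda>_. \<mu>)) (\<lambda>p. monom_eval (cdf2 \<mu>) (grid_x p) (grid_y p) as)"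
proof -
  interpret prob_space "Pi\<^sub>M {1..m} (\<lambda>_. \<mu>)"
    using prob_space_permuton[OF assms(1)] by (intro prob_space_PiM)
  show ?thesis
    using monom_eval_bounds[OF assms(1)]
    by (intro integrable_const_bound[of _ 1] measurable_monom_eval[OF assms]) simp
qed

lemma integrable_grid_poly:
  assumes "permuton \<mu>" "grid_poly {..m} {..m} f"
  shows "integrable (Pi\<^sub>M {1..m} (\<lambda>_. \<mu>)) (\<lambda>p. f (cdf2 \<mu>) (grid_x p) (grid_y p))"
proof -
  from assms(2) obtain ps where ps: "\<forall>(c, as)\<in>set ps. set as \<subseteq> {..m} \<times> {..m}"
    "\<forall>F x y. f F x y = (\<Sum>(c, as)\<leftarrow>ps. c * monom_eval F x y as)"
    unfolding grid_poly_def by blast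
  show ?thesis
    unfolding ps(2)[rule_format] using ps(1)
    by (induction ps) (auto intro!: Bochner_Integration.integrable_add integrable_mult_right
        integrable_monom_eval[OF assms(1)] simp del: One_nat_def)
qed

lemma expect_eq:
  assumes "grid_poly {..m} {..m} f"
  shows "\<exists>N. \<forall>\<mu> \<mu>'. permuton \<mu> \<longrightarrow> permuton \<mu>' \<longrightarrow> same_densities N \<mu> \<mu>' \<longrightarrow> expect m f \<mu> = expect m f \<mu>'"
proof -
  from assms obtain ps where ps: "\<forall>(c, as)\<in>set ps. set as \<subseteq> {..m} \<times> {..m}"
    "\<forall>F x y. f F x y = (\<Sum>(c, as)\<leftarrow>ps. c * monom_eval F x y as)"
    unfolding grid_poly_def by blast
  have eq: "expect m f \<nu> = (\<Sum>(c, as)\<leftarrow>ps. c * expect m (\<lambda>F x y. monom_eval F x y as) \<nu>)"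
    if "permuton \<nu>" for \<nu>
    unfolding expect_def ps(2)[rule_format] using ps(1)
  proof (induction ps)
    case (Cons a ps)
    then obtain c as where a: "a = (c, as)" "set as \<subseteq> {..m} \<times> {..m}" by (cases a) auto
    have "grid_poly {..m} {..m} (\<lambda>F x y. \<Sum>(c, as)\<leftarrow>ps. c * monom_eval F x y as)"
      unfolding grid_poly_def using Cons.prems by (intro exI[of _ ps]) auto
    from integrable_grid_poly[OF that this] integrable_monom_eval[OF that a(2)] Cons
    show ?case by (simp add: a)
  qed simp
  \<comment> \<open>A monomial with \<open>length as\<close> factors uses that many points beyond
    the first \<open>m\<close>. Inserting 0 keeps the maximum defined for the empty list.\<close>
  define N where "N = Max (insert 0 ((\<lambda>(c, as). m + length as) ` set ps))"
  have N: "m + length as \<le> N" if "(c, as) \<in> set ps" for c as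
    unfolding N_def using that by (intro Max_ge) (auto intro!: image_eqI[of _ _ "(c, as)"])
  show ?thesis
  proof (intro exI[of _ N] allI impI)
    fix \<mu> \<mu>' assume \<mu>: "permuton \<mu>" "permuton \<mu>'" "same_densities N \<mu> \<mu>'"
    have "expect m (\<lambda>F x y. monom_eval F x y as) \<mu> = expect m (\<lambda>F x y. monom_eval F x y as) \<mu>'"
      if "(c, as) \<in> set ps" for c as
      using ps(1) that N[OF that] same_densities_mono[OF \<mu>(3)]
      by (intro integral_monom_eval_eq \<mu>) auto
    then show "expect m f \<mu> = expect m f \<mu>'"
      unfolding eq[OF \<mu>(1)] eq[OF \<mu>(2)] by (intro arg_cong[of _ _ sum_list] map_cong refl) auto
  qed
qed

lemma tendsto_grid_poly:
  assumes "permuton \<mu>" "grid_poly I J f"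
    and "\<And>i. i \<in> I \<Longrightarrow> ((\<lambda>t. x t i) \<longlongrightarrow> x' i) G" "\<And>j. j \<in> J \<Longrightarrow> ((\<lambda>t. y t j) \<longlongrightarrow> y' j) G"
  shows "((\<lambda>t. f (cdf2 \<mu>) (x t) (y t)) \<longlongrightarrow> f (cdf2 \<mu>) x' y') G"
proof -
  from assms(2) obtain ps where ps: "\<forall>(c, as)\<in>set ps. set as \<subseteq> I \<times> J"
    "\<forall>F x y. f F x y = (\<Sum>(c, as)\<leftarrow>ps. c * monom_eval F x y as)"
    unfolding grid_poly_def by blast
  have mono: "((\<lambda>t. monom_eval (cdf2 \<mu>) (x t) (y t) as) \<longlongrightarrow> monom_eval (cdf2 \<mu>) x' y' as) G"
    if "set as \<subseteq> I \<times> J" for as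
    using that unfolding monom_eval_def
    by (induction as) (auto intro!: tendsto_mult tendsto_cdf2[OF assms(1)] assms(3,4))
  show ?thesis
    unfolding ps(2)[rule_format] using ps(1)
    by (induction ps) (auto intro!: tendsto_add tendsto_mult_left mono)
qed

text \<open>The zero set of the square of a polynomial has full measure, hence meets every box that
  restricts only one coordinate of each sample point.\<close>

lemma grid_poly_zero_transfer:
  assumes \<mu>: "permuton \<mu>" and f: "grid_poly I J f"
    and IJ: "I \<subseteq> {..m}" "J \<subseteq> {..m}" "I \<inter> J \<subseteq> {0}"
    and zero: "\<And>x y. range x \<subseteq> {0..1} \<Longrightarrow> range y \<subseteq> {0..1} \<Longrightarrow> x 0 = 1 \<Longrightarrow> y 0 = 1 \<Longrightarrow> f (cdf2 \<mu>) x y = 0"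
  shows "\<exists>N. \<forall>\<mu>' x y. permuton \<mu>' \<longrightarrow> same_densities N \<mu> \<mu>' \<longrightarrow> range x \<subseteq> {0..1} \<longrightarrow> range y \<subseteq> {0..1} \<longrightarrow>
    x 0 = 1 \<longrightarrow> y 0 = 1 \<longrightarrow> f (cdf2 \<mu>') x y = 0"
proof -
  let ?g = "\<lambda>F x y. f F x y * f F x y"
  have fm: "grid_poly {..m} {..m} f"
    using f IJ(1,2) by (rule grid_poly_mono)
  then have g: "grid_poly {..m} {..m} ?g" by (intro grid_poly_mult)
  from expect_eq[OF this] obtain N where
    N: "\<And>\<mu> \<mu>'. permuton \<mu> \<Longrightarrow> permuton \<mu>' \<Longrightarrow> same_densities N \<mu> \<mu>' \<Longrightarrow> expect m ?g \<mu> = expect m ?g \<mu>'"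
    by blast
  have "f (cdf2 \<mu>') x y = 0"
    if \<mu>': "permuton \<mu>'" "same_densities N \<mu> \<mu>'" and x: "range x \<subseteq> {0..1}" "x 0 = 1"
      and y: "range y \<subseteq> {0..1}" "y 0 = 1" for \<mu>' x y
  proof -
    let ?M = "Pi\<^sub>M {1..m} (\<lambda>_. \<mu>')" and ?h = "\<lambda>p. f (cdf2 \<mu>') (grid_x p) (grid_y p)"
    interpret prob_space \<mu>' by (rule prob_space_permuton[OF \<mu>'(1)])
    interpret product_sigma_finite "\<lambda>_::nat. \<mu>'" by (rule product_sigma_finite_permuton[OF \<mu>'(1)])
    note [measurable] = fst_measurable_permuton[OF \<mu>'(1)] snd_measurable_permuton[OF \<mu>'(1)]
    have "expect m ?g \<mu> = 0"
    proof -
      have "?g (cdf2 \<mu>) (grid_x p) (grid_y p) = 0" if "p \<in> space (Pi\<^sub>M {1..m} (\<lambda>_. \<mu>))" for p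
      proof -
        \<comment> \<open>Beyond index \<open>m\<close> a point of the product space is
          \<open>undefined\<close>, so the sequences are padded with 1 to stay in the unit interval;
          \<open>f\<close> does not read these entries.\<close>
        let ?x = "\<lambda>i. if i \<le> m then grid_x p i else 1" and ?y = "\<lambda>j. if j \<le> m then grid_y p j else 1"
        have mem: "p i \<in> unit_square" if "i \<in> {1..m}" for i
          using \<open>p \<in> _\<close> that unfolding space_PiM space_permuton[OF \<mu>] by (rule PiE_mem)
        have "fst (p i) \<in> {0..1}" "snd (p i) \<in> {0..1}" if "i \<noteq> 0" "i \<le> m" for i
          using mem[of i] that by (simp_all add: unit_square_def mem_Times_iff)
        then have "range ?x \<subseteq> {0..1}" "range ?y \<subseteq> {0..1}"
          by (auto simp: grid_x_def grid_y_def)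
        then have "f (cdf2 \<mu>) ?x ?y = 0"
          by (rule zero) (simp_all add: grid_x_def grid_y_def)
        moreover have "f (cdf2 \<mu>) (grid_x p) (grid_y p) = f (cdf2 \<mu>) ?x ?y"
          by (rule grid_poly_cong[OF fm]) auto
        ultimately show ?thesis by simp
      qed
      then have "expect m ?g \<mu> = (\<integral> p. 0 \<partial>Pi\<^sub>M {1..m} (\<lambda>_. \<mu>))"
        unfolding expect_def by (intro Bochner_Integration.integral_cong refl)
      then show ?thesis by simp
    qed
    then have "expect m ?g \<mu>' = 0" using N[OF \<mu> \<mu>'] by simp
    then have ae: "AE p in ?M. ?h p = 0"
      using integral_nonneg_eq_0_iff_AE[OF integrable_grid_poly[OF \<mu>'(1) g]] by (simp add: expect_def)
    have "\<exists>p. ?h p = 0 \<and> (\<forall>i\<in>I. \<bar>grid_x p i - x i\<bar> \<le> e) \<and> (\<forall>j\<in>J. \<bar>grid_y p j - y j\<bar> \<le> e)" if "e > 0" for e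
    proof -
      \<comment> \<open>Since \<open>I\<close> and \<open>J\<close> share at most 0, each
        \<open>B k\<close> with \<open>k\<close> positive restricts at most one coordinate. It is
        thus a strip or the whole space and has positive mass by the marginals, whereas restricting
        both coordinates could produce a null set.\<close>
      define B where "B k = {q \<in> space \<mu>'. (k \<in> I \<longrightarrow> fst q \<in> {x k - e..x k + e}) \<and>
        (k \<in> J \<longrightarrow> snd q \<in> {y k - e..y k + e})}" for k
      have Bm: "B k \<in> sets \<mu>'" for k unfolding B_def by measurable
      have strip: "measure \<mu>' {q \<in> space \<mu>'. fst q \<in> {t - e..t + e}} > 0"
        "measure \<mu>' {q \<in> space \<mu>'. snd q \<in> {t - e..t + e}} > 0" if "t \<in> {0..1}" for t
      proof -
        let ?a = "max 0 (t - e)" and ?b = "min 1 (t + e)"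
        have eq: "{q \<in> space \<mu>'. fst q \<in> {t - e..t + e}} = {q \<in> space \<mu>'. fst q \<in> {?a..?b}}"
          "{q \<in> space \<mu>'. snd q \<in> {t - e..t + e}} = {q \<in> space \<mu>'. snd q \<in> {?a..?b}}"
          by (auto simp: space_permuton[OF \<mu>'(1)] unit_square_def)
        have ab: "?a < ?b" using that \<open>e > 0\<close> by (auto simp: min_def max_def)
        have "measure \<mu>' {q \<in> space \<mu>'. fst q \<in> {?a..?b}} = ?b - ?a"
          "measure \<mu>' {q \<in> space \<mu>'. snd q \<in> {?a..?b}} = ?b - ?a"
          using measure_permuton_strip[OF \<mu>'(1), of ?a ?b] ab by simp_all
        with ab show "measure \<mu>' {q \<in> space \<mu>'. fst q \<in> {t - e..t + e}} > 0"
          "measure \<mu>' {q \<in> space \<mu>'. snd q \<in> {t - e..t + e}} > 0"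
          unfolding eq by linarith+
      qed
      have pos: "emeasure \<mu>' (B k) > 0" if "k \<in> {1..m}" for k
      proof -
        have "x k \<in> {0..1}" "y k \<in> {0..1}" using x(1) y(1) by blast+
        note s = strip(1)[OF this(1)] strip(2)[OF this(2)]
        have "k \<noteq> 0" using that by simp
        then consider "k \<in> I" "k \<notin> J" | "k \<notin> I" "k \<in> J" | "k \<notin> I" "k \<notin> J" using IJ(3) by blast
        then have "measure \<mu>' (B k) > 0"
        proof cases
          case 1
          then have "B k = {q \<in> space \<mu>'. fst q \<in> {x k - e..x k + e}}" by (simp add: B_def)
          then show ?thesis using s(1) by simp
        next
          case 2
          then have "B k = {q \<in> space \<mu>'. snd q \<in> {y k - e..y k + e}}" by (simp add: B_def)
          then show ?thesis using s(2) by simp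
        next
          case 3
          then have "B k = space \<mu>'" by (simp add: B_def)
          then show ?thesis using prob_space by simp
        qed
        then show ?thesis by (simp add: emeasure_eq_measure)
      qed
      have "emeasure ?M (Pi\<^sub>E {1..m} B) = (\<Prod>k\<in>{1..m}. emeasure \<mu>' (B k))"
        using Bm by (intro emeasure_PiM) auto
      also have "\<dots> > 0"
        using pos by (simp add: less_le prod_zero_iff del: One_nat_def)
      finally have "emeasure ?M (Pi\<^sub>E {1..m} B) > 0" .
      moreover have "emeasure ?M (Pi\<^sub>E {1..m} B) = 0" if "\<forall>p\<in>Pi\<^sub>E {1..m} B. ?h p \<noteq> 0"
      proof -
        have "Pi\<^sub>E {1..m} B \<subseteq> {p \<in> space ?M. \<not> ?h p = 0}"
          using that sets.sets_into_space[OF Bm] by (auto simp: space_PiM PiE_iff)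
        from AE_E[OF ae] obtain Z where "{p \<in> space ?M. \<not> ?h p = 0} \<subseteq> Z" "emeasure ?M Z = 0" "Z \<in> sets ?M" .
        then show ?thesis
          using \<open>Pi\<^sub>E {1..m} B \<subseteq> _\<close> emeasure_mono[of "Pi\<^sub>E {1..m} B" Z ?M] by auto
      qed
      ultimately have "\<not> (\<forall>p\<in>Pi\<^sub>E {1..m} B. ?h p \<noteq> 0)" by (auto simp only: less_irrefl)
      then obtain p where p: "p \<in> Pi\<^sub>E {1..m} B" "?h p = 0" by blast
      have "\<bar>grid_x p i - x i\<bar> \<le> e" if "i \<in> I" for i
      proof (cases "i = 0")
        case False
        then have "p i \<in> B i" using IJ(1) that by (intro PiE_mem[OF p(1)]) auto
        then show ?thesis using False that by (auto simp: B_def grid_x_def abs_le_iff)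
      qed (use x(2) \<open>e > 0\<close> in \<open>simp add: grid_x_def\<close>)
      moreover have "\<bar>grid_y p j - y j\<bar> \<le> e" if "j \<in> J" for j
      proof (cases "j = 0")
        case False
        then have "p j \<in> B j" using IJ(2) that by (intro PiE_mem[OF p(1)]) auto
        then show ?thesis using False that by (auto simp: B_def grid_y_def abs_le_iff)
      qed (use y(2) \<open>e > 0\<close> in \<open>simp add: grid_y_def\<close>)
      ultimately show ?thesis using p(2) by blast
    qed
    \<comment> \<open>Zeros at distance at most \<open>1 / (n + 1)\<close> from the prescribed
      variables exist for each \<open>n\<close>, and the polynomial is continuous in its
      variables.\<close>
    then have "\<forall>n. \<exists>p. ?h p = 0 \<and> (\<forall>i\<in>I. \<bar>grid_x p i - x i\<bar> \<le> 1 / real (Suc n)) \<and>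
        (\<forall>j\<in>J. \<bar>grid_y p j - y j\<bar> \<le> 1 / real (Suc n))" by simp
    then obtain p where p: "\<And>n. ?h (p n) = 0"
      "\<And>n i. i \<in> I \<Longrightarrow> \<bar>grid_x (p n) i - x i\<bar> \<le> 1 / real (Suc n)"
      "\<And>n j. j \<in> J \<Longrightarrow> \<bar>grid_y (p n) j - y j\<bar> \<le> 1 / real (Suc n)" by metis
    have lim: "u \<longlonglongrightarrow> t" if "\<And>n. \<bar>u n - t\<bar> \<le> 1 / real (Suc n)" for u :: "nat \<Rightarrow> real" and t
    proof (rule LIM_zero_cancel, rule Lim_null_comparison)
      show "\<forall>\<^sub>F n in sequentially. norm (u n - t) \<le> 1 / real (Suc n)"
        using that by (intro always_eventually allI) (simp only: real_norm_def)
      show "(\<lambda>n. 1 / real (Suc n)) \<longlonglongrightarrow> 0"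
        using LIMSEQ_inverse_real_of_nat by (simp only: inverse_eq_divide)
    qed
    have "(\<lambda>n. ?h (p n)) \<longlonglongrightarrow> f (cdf2 \<mu>') x y"
      by (rule tendsto_grid_poly[OF \<mu>'(1) f]) (blast intro: lim p(2,3))+
    then show ?thesis by (simp add: p(1) LIMSEQ_const_iff)
  qed
  then show ?thesis by blast
qed

section \<open>Distribution functions with forced block structure\<close>

text \<open>For the distribution function of a permuton and \<open>x\<close>, \<open>y\<close> in
  the unit interval, the factors are the masses of the upper left and of the lower right quadrant at
  \<open>(x, y)\<close>. Hence the gap is nonnegative there and vanishes exactly when
  \<open>F x y = min x y\<close>.\<close>

definition gap :: "(real \<Rightarrow> real \<Rightarrow> real) \<Rightarrow> real \<Rightarrow> real \<Rightarrow> real" where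
  "gap F x y = (x - F x y) * (y - F x y)"

text \<open>Up to the factors \<open>gap\<close>, the first identity equates the values of \<open>(1 - x) / (1 - c m)\<close> at \<open>x\<close>
  and \<open>x'\<close>, where \<open>m\<close> is a difference quotient of \<open>F(x, \<cdot>)\<close>, with denominators cleared.  If
  \<open>F(x, \<cdot>)\<close> has slope \<open>m\<close> from the point \<open>(l, l)\<close> on, then the second one is
  \<open>(1 - x) (1 - m) = (1 - c m) (1 - m) (1 - l)\<close> multiplied by \<open>(y1 - y2)\<^sup>2\<close>.\<close>

definition slope_identity :: "real \<Rightarrow> (real \<Rightarrow> real \<Rightarrow> real) \<Rightarrow> real \<Rightarrow> real \<Rightarrow> real \<Rightarrow> real \<Rightarrow> real \<Rightarrow> real \<Rightarrow> bool" where
  "slope_identity c F x x' y1 y2 y3 y4 \<longleftrightarrow>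
    gap F x y1 * gap F x y2 * gap F x y3 * gap F x y4 *
    (gap F x' y1 * gap F x' y2 * gap F x' y3 * gap F x' y4) *
    ((1 - x) * (y1 - y2) * ((y3 - y4) - c * (F x' y3 - F x' y4)) -
     (1 - x') * (y3 - y4) * ((y1 - y2) - c * (F x y1 - F x y2))) = 0"

definition size_identity :: "real \<Rightarrow> (real \<Rightarrow> real \<Rightarrow> real) \<Rightarrow> real \<Rightarrow> real \<Rightarrow> real \<Rightarrow> bool" where
  "size_identity c F x y1 y2 \<longleftrightarrow>
    gap F x y1 * gap F x y2 *
    ((1 - x) * (y1 - y2) * ((y1 - y2) - (F x y1 - F x y2)) -
     ((y1 - y2) - c * (F x y1 - F x y2)) *
     ((y1 - y2) - (F x y1 - F x y2) - F x y1 * (y1 - y2) + (F x y1 - F x y2) * y1)) = 0"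

text \<open>The parameter \<open>b\<close> is the distance of the lower end to 1. The interval is
  open, so \<open>b = 0\<close> gives the empty set.\<close>

definition block :: "real \<Rightarrow> real \<Rightarrow> real set" where
  "block \<alpha> b = {1 - b<..<1 - \<alpha> * b}"

text \<open>Mass \<open>(1 - \<alpha>) * b\<close> spread evenly over a square of the same side
  length has density \<open>1 / ((1 - \<alpha>) * b)\<close>; the summand \<open>1 - b\<close> is
  the mass to the left of the square, all of which lies below it too.\<close>

definition block_row :: "real \<Rightarrow> real \<Rightarrow> real \<Rightarrow> real \<Rightarrow> real" where
  "block_row \<alpha> b x y = (if y \<in> block \<alpha> b
     then (1 - b) + (x - (1 - b)) * (y - (1 - b)) / ((1 - \<alpha>) * b) else min x y)"

text \<open>The value \<open>\<beta> n = 0\<close> encodes an absent block. Equality in all bounds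
  \<open>\<beta> n \<le> \<alpha> ^ n\<close> describes \<open>mu_r\<close>.\<close>

definition tiled :: "real \<Rightarrow> (real \<Rightarrow> real \<Rightarrow> real) \<Rightarrow> (nat \<Rightarrow> real) \<Rightarrow> bool" where
  "tiled \<alpha> F \<beta> \<longleftrightarrow> (\<forall>n. 0 \<le> \<beta> n \<and> \<beta> n \<le> \<alpha> ^ n) \<and>
     (\<forall>m n x. x \<in> block \<alpha> (\<beta> m) \<longrightarrow> x \<in> block \<alpha> (\<beta> n) \<longrightarrow> m = n) \<and>
     (\<forall>n. \<forall>x\<in>block \<alpha> (\<beta> n). \<forall>y\<in>{0..1}. F x y = block_row \<alpha> (\<beta> n) x y) \<and>
     (\<forall>x\<in>{0..1}. (\<forall>n. x \<notin> block \<alpha> (\<beta> n)) \<longrightarrow> (\<forall>y\<in>{0..1}. F x y = min x y))"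

text \<open>Cross-multiplied form of \<open>a / e = a' / e'\<close>, where the two quotients are
  \<open>b\<close> and \<open>b'\<close>.\<close>

lemma proportional_cancel:
  fixes a :: real
  assumes "a * e' = a' * e" "a = b * e" "a' = b' * e'" "0 < a" "0 < a'"
  shows "b = b'"
proof -
  have "a * e' * b = a' * (b * e)" unfolding assms(1) by (simp only: ac_simps)
  also have "\<dots> = a * a'" unfolding assms(2)[symmetric] by (rule mult.commute)
  finally have "a * e' * b = a * a'" .
  moreover have "a * e' * b' = a * a'" unfolding assms(3) by (simp only: ac_simps)
  ultimately have "a * e' * (b - b') = 0" by (simp only: right_diff_distrib)
  moreover have "e' \<noteq> 0" using assms(3,5) by auto
  ultimately show ?thesis using assms(4) by simp
qed

lemma ex_power_strip:
  fixes \<alpha> b :: real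
  assumes \<alpha>: "0 < \<alpha>" "\<alpha> < 1" and b: "0 < b" "b \<le> 1"
  shows "\<exists>n. \<alpha> ^ Suc n < b \<and> b \<le> \<alpha> ^ n"
proof -
  have ex: "\<exists>n. \<alpha> ^ Suc n < b"
  proof -
    obtain n where "\<alpha> ^ n < b" using real_arch_pow_inv[OF b(1) \<alpha>(2)] by blast
    moreover have "\<alpha> ^ Suc n \<le> \<alpha> ^ n" using \<alpha> by (intro power_decreasing) auto
    ultimately show ?thesis by (meson le_less_trans)
  qed
  define n where "n = (LEAST n. \<alpha> ^ Suc n < b)"
  have "\<alpha> ^ Suc n < b" unfolding n_def using ex by (rule LeastI_ex)
  moreover have "b \<le> \<alpha> ^ n"
  proof (cases n)
    case (Suc k)
    then have "\<not> \<alpha> ^ Suc k < b" unfolding n_def by (metis lessI not_less_Least)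
    then show ?thesis by (simp add: Suc)
  qed (use b in simp)
  ultimately show ?thesis by blast
qed

section \<open>Rows of a distribution function with uniform marginals\<close>

locale copula =
  fixes F :: "real \<Rightarrow> real \<Rightarrow> real"
  assumes nonneg: "0 \<le> F x y"
    and mono: "x \<le> x' \<Longrightarrow> y \<le> y' \<Longrightarrow> F x y \<le> F x' y'"
    and lipschitz: "\<bar>F x y - F x' y'\<bar> \<le> \<bar>x - x'\<bar> + \<bar>y - y'\<bar>"
    and right: "x \<in> {0..1} \<Longrightarrow> F x 1 = x"
    and top: "y \<in> {0..1} \<Longrightarrow> F 1 y = y"
    and continuous: "continuous_on (S :: real set) f \<Longrightarrow> continuous_on S g \<Longrightarrow> continuous_on S (\<lambda>t. F (f t) (g t))"
begin

lemma F_le: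
  assumes "x \<in> {0..1}" "y \<in> {0..1}"
  shows "F x y \<le> x" "F x y \<le> y"
  using mono[of x x y 1] mono[of x 1 y y] right[OF assms(1)] top[OF assms(2)] assms by auto

lemma F_diff_le: "y \<le> y' \<Longrightarrow> F x y' - F x y \<le> y' - y"
  using lipschitz[of x y' x y] by simp

lemma continuous_row: "continuous_on S (F x)"
  using continuous[OF continuous_on_const continuous_on_id, of S x] by simp

text \<open>Along a row, \<open>F x\<close> starts at 0 with slope at most 1 and ends at
  \<open>x\<close>. It agrees with \<open>y\<close> up to \<open>lo x\<close> and with the constant
  \<open>x\<close> from \<open>hi x\<close> on, so the heights of positive gap form the interval
  between the two.\<close>

definition lo :: "real \<Rightarrow> real" where "lo x = Sup {y \<in> {0..1}. F x y = y}"
definition hi :: "real \<Rightarrow> real" where "hi x = Inf {y \<in> {0..1}. F x y = x}"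

text \<open>The difference \<open>y - F x y\<close> is nonnegative and nondecreasing in
  \<open>y\<close>, so its zeros form an initial interval. Continuity makes this interval closed,
  and the supremum is attained.\<close>

lemma lo_props:
  assumes x: "x \<in> {0..1}"
  shows "lo x \<in> {0..1}" "\<And>y. y \<in> {0..1} \<Longrightarrow> F x y = y \<longleftrightarrow> y \<le> lo x"
proof -
  let ?S = "{y \<in> {0..1}. F x y = y}"
  have "F x 0 = 0" using F_le(2)[OF x, of 0] nonneg[of x 0] by simp
  then have ne: "?S \<noteq> {}" by force
  have "compact ?S"
  proof -
    have "closed {y. F x y = y}"
      by (intro closed_Collect_eq continuous_row continuous continuous_intros)
    then have "compact ({0..1} \<inter> {y. F x y = y})" by (intro compact_Int_closed compact_Icc)
    moreover have "{0..1} \<inter> {y. F x y = y} = ?S" by blast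
    ultimately show ?thesis by simp
  qed
  then have S: "lo x \<in> ?S"
    unfolding lo_def by (intro closed_contains_Sup ne bdd_aboveI[of _ 1] compact_imp_closed) auto
  then show "lo x \<in> {0..1}" by simp
  fix y :: real assume y: "y \<in> {0..1}"
  show "F x y = y \<longleftrightarrow> y \<le> lo x"
  proof
    assume "F x y = y"
    then show "y \<le> lo x" unfolding lo_def using y by (intro cSup_upper bdd_aboveI[of _ 1]) auto
  next
    assume "y \<le> lo x"
    from F_diff_le[OF this, of x] S F_le(2)[OF x y] show "F x y = y" by simp
  qed
qed

lemma hi_props:
  assumes x: "x \<in> {0..1}"
  shows "hi x \<in> {0..1}" "\<And>y. y \<in> {0..1} \<Longrightarrow> F x y = x \<longleftrightarrow> hi x \<le> y"
proof -
  let ?S = "{y \<in> {0..1}. F x y = x}"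
  have ne: "?S \<noteq> {}" using right[OF x] by force
  have "closed ?S"
  proof -
    have "closed {y. F x y = x}"
      by (intro closed_Collect_eq continuous_row continuous continuous_intros)
    then have "closed ({0..1} \<inter> {y. F x y = x})" by (intro closed_Int) auto
    moreover have "{0..1} \<inter> {y. F x y = x} = ?S" by blast
    ultimately show ?thesis by simp
  qed
  then have S: "hi x \<in> ?S"
    unfolding hi_def by (intro closed_contains_Inf ne bdd_belowI[of _ 0]) auto
  then show "hi x \<in> {0..1}" by simp
  fix y :: real assume y: "y \<in> {0..1}"
  show "F x y = x \<longleftrightarrow> hi x \<le> y"
  proof
    assume "F x y = x"
    then show "hi x \<le> y" unfolding hi_def using y by (intro cInf_lower bdd_belowI[of _ 0]) auto
  next
    assume "hi x \<le> y"
    from mono[OF order_refl this, of x] S F_le(1)[OF x y] show "F x y = x" by simp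
  qed
qed

lemma lo_le_hi:
  assumes x: "x \<in> {0..1}"
  shows "lo x \<le> x" "x \<le> hi x"
  using F_le[OF x lo_props(1)[OF x]] lo_props(2)[OF x lo_props(1)[OF x]]
    F_le[OF x hi_props(1)[OF x]] hi_props(2)[OF x hi_props(1)[OF x]] by auto

lemma F_less_iff:
  assumes x: "x \<in> {0..1}" and y: "y \<in> {0..1}"
  shows "F x y < x \<and> F x y < y \<longleftrightarrow> lo x < y \<and> y < hi x"
  using F_le[OF x y] lo_props(2)[OF x y] hi_props(2)[OF x y] by auto

lemma gap_pos:
  assumes x: "x \<in> {0..1}" and y: "lo x < y" "y < hi x"
  shows "gap F x y > 0"
proof -
  have "y \<in> {0..1}" using y lo_props(1)[OF x] hi_props(1)[OF x] by auto
  from F_less_iff[OF x this] y show ?thesis by (simp add: gap_def)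
qed

lemma F_eq_min:
  assumes x: "x \<in> {0..1}" and y: "y \<in> {0..1}" and "\<not> (lo x < y \<and> y < hi x)"
  shows "F x y = min x y"
  using F_le[OF x y] F_less_iff[OF x y] assms(3) by (auto simp: min_def)

text \<open>At a height \<open>y\<close> strictly between the two ends, \<open>F x y\<close> is
  below both \<open>x\<close> and \<open>y\<close>. Monotonicity gives
  \<open>lo x \<le> F x y\<close>, and slope at most 1 gives
  \<open>x - F x y \<le> hi x - y\<close>.\<close>

lemma lo_less_self:
  assumes x: "x \<in> {0..1}" and ne: "lo x < hi x"
  shows "lo x < x" "x < hi x"
proof -
  obtain y where y: "lo x < y" "y < hi x" using dense[OF ne] by blast
  then have y01: "y \<in> {0..1}" using lo_props(1)[OF x] hi_props(1)[OF x] by auto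
  have less: "F x y < x" "F x y < y" using F_less_iff[OF x y01] y by auto
  have "F x (lo x) = lo x" "F x (hi x) = x"
    using lo_props(2)[OF x lo_props(1)[OF x]] hi_props(2)[OF x hi_props(1)[OF x]] by auto
  moreover have "F x (lo x) \<le> F x y" using y by (intro mono) auto
  moreover have "F x (hi x) - F x y \<le> hi x - y" using y by (intro F_diff_le) auto
  ultimately show "lo x < x" "x < hi x" using less lo_le_hi[OF x] by auto
qed

end

section \<open>Consequences of the two identities for rows and components\<close>

locale forced_copula = copula +
  fixes \<alpha> :: real
  assumes \<alpha>: "0 < \<alpha>" "\<alpha> < 1"
    and slope: "\<lbrakk>x \<in> {0..1}; x' \<in> {0..1}; y1 \<in> {0..1}; y2 \<in> {0..1}; y3 \<in> {0..1}; y4 \<in> {0..1}\<rbrakk>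
      \<Longrightarrow> slope_identity (1 - \<alpha>) F x x' y1 y2 y3 y4"
    and size: "\<lbrakk>x \<in> {0..1}; y1 \<in> {0..1}; y2 \<in> {0..1}\<rbrakk> \<Longrightarrow> size_identity (1 - \<alpha>) F x y1 y2"
begin

text \<open>Within one row the slope identity makes \<open>F x\<close> affine on the interval of
  positive gap, say with slope \<open>m\<close>. The end values give
  \<open>x - l = m * (h - l)\<close>, the size identity gives
  \<open>x - l = m * ((1 - \<alpha>) * (1 - l))\<close>, and dividing by \<open>m\<close> yields the
  length.\<close>

lemma row:
  assumes x: "x \<in> {0..1}" and ne: "lo x < hi x"
  shows "hi x - lo x = (1 - \<alpha>) * (1 - lo x)"
    and "y \<in> {lo x..hi x} \<Longrightarrow> F x y = lo x + (x - lo x) * (y - lo x) / (hi x - lo x)"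
proof -
  let ?c = "1 - \<alpha>"
  define l h where "l = lo x" and "h = hi x"
  have lh: "l < h" "l < x" "x < h" "0 \<le> l" "h \<le> 1"
    using ne lo_less_self[OF x ne] lo_props(1)[OF x] hi_props(1)[OF x] by (auto simp: l_def h_def)
  have c: "?c > 0" using \<alpha> by simp
  define p q where "p = l + (h - l) / 3" and "q = l + 2 * (h - l) / 3"
  have pq: "l < p" "p < q" "q < h" using lh by (auto simp: p_def q_def field_simps)
  define m where "m = (F x q - F x p) / (q - p)"
  have G: "F x q - F x p = m * (q - p)" using pq by (simp add: m_def)
  have inner: "F x y = F x p + m * (y - p)" if y: "y \<in> {l<..<h}" for y
  proof -
    have pos: "gap F x y \<noteq> 0" "gap F x p \<noteq> 0" "gap F x q \<noteq> 0"
      using gap_pos[OF x, of y] gap_pos[OF x, of p] gap_pos[OF x, of q] y pq lh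
      by (auto simp: l_def h_def)
    \<comment> \<open>With both rows equal the factor \<open>1 - x\<close> is common, and the
      identity compares the difference quotient over \<open>y\<close>, \<open>p\<close> with the one
      over \<open>q\<close>, \<open>p\<close>.\<close>
    have "slope_identity ?c F x x y p q p"
      using y pq lh by (intro slope x) auto
    then have "(1 - x) * (y - p) * ((q - p) - ?c * (F x q - F x p)) -
        (1 - x) * (q - p) * ((y - p) - ?c * (F x y - F x p)) = 0"
      using pos unfolding slope_identity_def by simp
    then have "?c * (1 - x) * (q - p) * (F x y - F x p - m * (y - p)) = 0"
      unfolding G by (simp add: algebra_simps)
    then show ?thesis using c lh pq by simp
  qed
  \<comment> \<open>At the two ends the gap is zero and the identity is void, so the affine formula
    is carried there by continuity.\<close>
  have closed_eq: "F x y = F x p + m * (y - p)" if y: "y \<in> {l..h}" for y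
  proof -
    have "closed {y. F x y = F x p + m * (y - p)}"
      by (intro closed_Collect_eq continuous_row continuous continuous_intros)
    then have "closure {l<..<h} \<subseteq> {y. F x y = F x p + m * (y - p)}"
      using inner by (intro closure_minimal) auto
    then show ?thesis using y lh by (auto simp: closure_greaterThanLessThan)
  qed
  have "F x l = l" "F x h = x"
    using lo_props[OF x] hi_props[OF x] by (auto simp: l_def h_def)
  with closed_eq[of l] closed_eq[of h] lh
  have m: "x - l = m * (h - l)" and Fp: "F x p = l + m * (p - l)"
    by (auto simp: algebra_simps)
  have m01: "0 < m" "m < 1"
  proof -
    have "m = (x - l) / (h - l)" using m lh by (simp add: field_simps)
    then show "0 < m" "m < 1" using lh by simp_all
  qed
  have form: "F x y = l + m * (y - l)" if "y \<in> {l..h}" for y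
    using closed_eq[OF that] Fp by (simp add: algebra_simps)
  have "gap F x p \<noteq> 0" "gap F x q \<noteq> 0"
    using gap_pos[OF x, of p] gap_pos[OF x, of q] pq lh by (auto simp: l_def h_def)
  moreover have "size_identity ?c F x q p" using pq lh by (intro size x) auto
  ultimately have "(1 - x) * (q - p) * ((q - p) - (F x q - F x p)) -
     ((q - p) - ?c * (F x q - F x p)) * ((q - p) - (F x q - F x p) - F x q * (q - p) + (F x q - F x p) * q) = 0"
    unfolding size_identity_def by simp
  moreover have "F x q = l + m * (q - l)" using form[of q] pq by simp
  ultimately have "(q - p) * (q - p) * (1 - m) * ((1 - x) - (1 - ?c * m) * (1 - l)) = 0"
    unfolding G by (simp only:) (simp add: algebra_simps)
  then have "1 - x = (1 - ?c * m) * (1 - l)" using pq m01 by simp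
  then have "x - l = m * (?c * (1 - l))" by (simp add: algebra_simps)
  with m have "m * (h - l) = m * (?c * (1 - l))" by (simp only:)
  then show "hi x - lo x = (1 - \<alpha>) * (1 - lo x)"
    using m01 by (simp add: l_def h_def)
  show "y \<in> {lo x..hi x} \<Longrightarrow> F x y = lo x + (x - lo x) * (y - lo x) / (hi x - lo x)"
    using form[of y] m lh by (simp add: l_def h_def)
qed

text \<open>This identifies the ratio that the slope identity keeps constant from row to row: it is
  \<open>1 - lo x\<close>.\<close>

lemma row_slope:
  assumes x: "x \<in> {0..1}" and ne: "lo x < hi x" and y: "y \<in> {lo x..hi x}" "y' \<in> {lo x..hi x}"
  shows "(1 - x) * (y - y') = (1 - lo x) * ((y - y') - (1 - \<alpha>) * (F x y - F x y'))"
proof -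
  have "hi x - lo x \<noteq> 0" using ne by simp
  have "1 - lo x \<noteq> 0" using lo_less_self[OF x ne] x by auto
  have "F x y - F x y' = (x - lo x) * (y - y') / (hi x - lo x)"
    unfolding row(2)[OF x ne y(1)] row(2)[OF x ne y(2)]
    by (simp add: diff_divide_distrib[symmetric] algebra_simps)
  also have "\<dots> = (x - lo x) * (y - y') / ((1 - \<alpha>) * (1 - lo x))"
    using row(1)[OF x ne] by simp
  finally have "(1 - lo x) * ((1 - \<alpha>) * (F x y - F x y')) = (x - lo x) * (y - y')"
    using \<alpha> \<open>1 - lo x \<noteq> 0\<close> by simp
  then show ?thesis unfolding right_diff_distrib[of "1 - lo x"] by (simp add: algebra_simps)
qed

text \<open>The rows in the interval that share the lower end of \<open>x0\<close> form a relatively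
  open and closed set, and an interval is connected. The set is closed because its rows are given by
  equations in \<open>F\<close>. It is open because a nearby row still has positive gap at two
  common heights, where the slope identity transfers the ratio \<open>1 - lo x\<close>.\<close>

lemma block_constant:
  assumes x0: "x0 \<in> {0..1}" and ne: "lo x0 < hi x0" and x: "x \<in> {lo x0<..<hi x0}"
  shows "lo x = lo x0" "hi x = hi x0"
proof -
  define l h where "l = lo x0" and "h = hi x0"
  have lh: "l < h" "0 \<le> l" "h \<le> 1" "l < x0" "x0 < h" and size: "h - l = (1 - \<alpha>) * (1 - l)"
    using ne lo_props(1)[OF x0] hi_props(1)[OF x0] row(1)[OF x0 ne] lo_less_self[OF x0 ne]
    by (auto simp: l_def h_def)
  let ?I = "{l<..<h}"
  define A where "A = {x \<in> ?I. lo x < hi x \<and> lo x = l}"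
  have I01: "x \<in> {0..1}" if "x \<in> ?I" for x using that lh by auto
  have hi: "hi x = h" if "x \<in> A" for x
  proof -
    have "x \<in> ?I" "lo x < hi x" "lo x = l" using that by (simp_all add: A_def)
    then show ?thesis using row(1)[OF I01, of x] size by simp
  qed
  \<comment> \<open>Membership becomes one equation for each height, continuous in \<open>x\<close>.
    The prescribed row leaves the line \<open>F x y = y\<close> exactly at \<open>l\<close>, which
    recovers \<open>lo x = l\<close>.\<close>
  have A_eq: "A = ?I \<inter> (\<Inter>y\<in>{l..h}. {x. F x y = l + (x - l) * (y - l) / (h - l)})"
  proof (intro set_eqI iffI)
    fix x assume "x \<in> A"
    then show "x \<in> ?I \<inter> (\<Inter>y\<in>{l..h}. {x. F x y = l + (x - l) * (y - l) / (h - l)})"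
      using row(2)[OF I01] hi[OF \<open>x \<in> A\<close>] by (auto simp: A_def)
  next
    fix x assume "x \<in> ?I \<inter> (\<Inter>y\<in>{l..h}. {x. F x y = l + (x - l) * (y - l) / (h - l)})"
    then have xI: "x \<in> ?I" and form: "\<And>y. y \<in> {l..h} \<Longrightarrow> F x y = l + (x - l) * (y - l) / (h - l)"
      by auto
    note x01 = I01[OF xI]
    have below: "F x y < y" if "l < y" "y \<le> h" for y
    proof -
      have "(x - l) * (y - l) < (y - l) * (h - l)" using that xI by (simp add: mult.commute)
      then have "(x - l) * (y - l) / (h - l) < y - l" using lh by (simp add: divide_less_eq)
      then show ?thesis using form[of y] that by simp
    qed
    have "F x x < x" using below xI by simp
    then have "lo x < hi x" using F_less_iff[OF x01 x01] by simp
    moreover have "l \<le> lo x" using form[of l] lh lo_props(2)[OF x01, of l] by simp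
    moreover have "\<not> l < lo x"
    proof
      assume "l < lo x"
      then have "F x (min (lo x) h) = min (lo x) h"
        using lh lo_props[OF x01] by (subst lo_props(2)[OF x01]) auto
      then show False using below[of "min (lo x) h"] \<open>l < lo x\<close> lh by simp
    qed
    ultimately show "x \<in> A" using xI by (simp add: A_def)
  qed
  have "closedin (top_of_set ?I) A"
  proof -
    have "closed (\<Inter>y\<in>{l..h}. {x. F x y = l + (x - l) * (y - l) / (h - l)})"
      using lh by (intro closed_INT ballI closed_Collect_eq continuous_row continuous continuous_intros) auto
    then show ?thesis unfolding A_eq by (rule closedin_closed_Int)
  qed
  moreover have "openin (top_of_set ?I) A"
  proof -
    \<comment> \<open>Two heights strictly inside the interval. The set \<open>?T\<close> says that
      both factors of the gap are positive at each of them, an open condition on the row.\<close>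
    define p q where "p = l + (h - l) / 3" and "q = l + 2 * (h - l) / 3"
    have pq: "l < p" "p < q" "q < h" using lh by (auto simp: p_def q_def field_simps)
    have p01: "p \<in> {0..1}" and q01: "q \<in> {0..1}" using pq lh by auto
    let ?T = "{x. F x p < x} \<inter> {x. F x p < p} \<inter> {x. F x q < x} \<inter> {x. F x q < q}"
    have "open ?T"
      by (intro open_Int open_Collect_less continuous continuous_intros)
    moreover have "A = ?I \<inter> ?T \<or> A = {}"
    proof (cases "A = {}")
      case False
      then obtain x where xA: "x \<in> A" by blast
      have "lo x = l" "hi x = h" "x \<in> {0..1}" "lo x < hi x"
        using xA hi[OF xA] I01[of x] by (simp_all add: A_def)
      note x = this
      show ?thesis
      proof (intro disjI1 set_eqI iffI)
        fix x' assume "x' \<in> A"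
        then have "x' \<in> ?I" "lo x' = l" by (simp_all add: A_def)
        then have x': "lo x' = l" "hi x' = h" "x' \<in> {0..1}" "x' \<in> ?I"
          using hi[OF \<open>x' \<in> A\<close>] I01[of x'] by blast+
        then show "x' \<in> ?I \<inter> ?T"
          using F_less_iff[OF x'(3) p01] F_less_iff[OF x'(3) q01] pq by simp
      next
        fix x' assume x': "x' \<in> ?I \<inter> ?T"
        then have x'01: "x' \<in> {0..1}" using I01 by blast
        have p': "lo x' < p" "p < hi x'" "lo x' < q" "q < hi x'"
          using F_less_iff[OF x'01 p01] F_less_iff[OF x'01 q01] x' by simp_all
        then have ne': "lo x' < hi x'" by simp
        have "gap F x p \<noteq> 0" "gap F x q \<noteq> 0" "gap F x' p \<noteq> 0" "gap F x' q \<noteq> 0"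
          using gap_pos[OF x(3), of p] gap_pos[OF x(3), of q] gap_pos[OF x'01, of p] gap_pos[OF x'01, of q]
            p' pq x by auto
        moreover have "slope_identity (1 - \<alpha>) F x x' q p q p"
          using pq lh by (intro slope x x'01) auto
        ultimately have "(1 - x) * (q - p) * ((q - p) - (1 - \<alpha>) * (F x' q - F x' p)) =
            (1 - x') * (q - p) * ((q - p) - (1 - \<alpha>) * (F x q - F x p))"
          unfolding slope_identity_def by simp
        moreover have "(1 - x) * (q - p) = (1 - l) * ((q - p) - (1 - \<alpha>) * (F x q - F x p))"
          using row_slope[OF x(3,4), of q p] x pq by simp
        moreover have "(1 - x') * (q - p) = (1 - lo x') * ((q - p) - (1 - \<alpha>) * (F x' q - F x' p))"
          using row_slope[OF x'01 ne', of q p] p' by simp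
        moreover have "(1 - x) * (q - p) > 0" "(1 - x') * (q - p) > 0"
          using xA x' lh pq by (auto simp: A_def)
        ultimately have "1 - l = 1 - lo x'"
          by (rule proportional_cancel)
        then show "x' \<in> A" using ne' x' by (simp add: A_def)
      qed
    qed simp
    ultimately show ?thesis by (elim disjE) (simp_all only: openin_open_Int openin_empty)
  qed
  moreover have "x0 \<in> A" using x0 ne lh by (simp add: A_def l_def)
  moreover have "connected ?I" by (rule connected_Ioo)
  ultimately have "A = ?I"
    unfolding connected_clopen by blast
  then have "x \<in> A" using x by (simp add: l_def h_def)
  moreover from this have "lo x = l" by (simp add: A_def)
  ultimately show "lo x = lo x0" "hi x = hi x0"
    using hi[of x] by (simp_all only: l_def h_def)
qed

definition starts :: "real set" where
  "starts = {1 - lo x |x. x \<in> {0..1} \<and> lo x < hi x}"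

lemma starts_block:
  assumes "b \<in> starts"
  shows "0 < b" "b \<le> 1" "x \<in> block \<alpha> b \<Longrightarrow> x \<in> {0..1} \<and> lo x = 1 - b \<and> hi x = 1 - \<alpha> * b"
proof -
  from assms obtain x0 where x0: "x0 \<in> {0..1}" "lo x0 < hi x0" "b = 1 - lo x0"
    by (auto simp: starts_def)
  have l: "lo x0 = 1 - b" using x0(3) by simp
  have "hi x0 - lo x0 = (1 - \<alpha>) * (1 - lo x0)" by (rule row(1)[OF x0(1,2)])
  then have h: "hi x0 = 1 - \<alpha> * b" unfolding l by (simp add: algebra_simps)
  show "0 < b" "b \<le> 1"
    using lo_props(1)[OF x0(1)] lo_less_self(1)[OF x0(1,2)] x0 by auto
  assume "x \<in> block \<alpha> b"
  then have x: "x \<in> {lo x0<..<hi x0}" by (simp add: block_def l h)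
  then have "x \<in> {0..1}" using lo_props(1)[OF x0(1)] hi_props(1)[OF x0(1)] by auto
  then show "x \<in> {0..1} \<and> lo x = 1 - b \<and> hi x = 1 - \<alpha> * b"
    using block_constant[OF x0(1,2) x] l h by simp
qed

text \<open>The inequalities say \<open>1 - b \<le> 1 - b' < 1 - \<alpha> * b\<close>, so the two
  open blocks overlap, and a row in both has only one lower end.\<close>

lemma starts_unique:
  assumes "b \<in> starts" "b' \<in> starts" "\<alpha> * b < b'" "b' \<le> b"
  shows "b = b'"
proof -
  have "1 - b' < min (1 - \<alpha> * b) (1 - \<alpha> * b')"
    using assms(3) starts_block(1)[OF assms(2)] \<alpha> by simp
  then obtain x where "1 - b' < x" "x < min (1 - \<alpha> * b) (1 - \<alpha> * b')" using dense by blast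
  then have "x \<in> block \<alpha> b" "x \<in> block \<alpha> b'" using assms(4) by (auto simp: block_def)
  then show ?thesis using starts_block(3)[OF assms(1)] starts_block(3)[OF assms(2)] by fastforce
qed

lemma ex_tiled: "\<exists>\<beta>. tiled \<alpha> F \<beta>"
proof -
  define Q where "Q n b \<longleftrightarrow> b \<in> starts \<and> \<alpha> ^ Suc n < b \<and> b \<le> \<alpha> ^ n" for n b
  \<comment> \<open>A strip without a start gets the default 0, whose block is empty.\<close>
  define \<beta> where "\<beta> n = (if \<exists>b. Q n b then SOME b. Q n b else 0)" for n
  have Q: "Q n (\<beta> n)" if "\<exists>b. Q n b" for n
    using someI_ex[OF that] that by (simp add: \<beta>_def)
  have cases: "Q n (\<beta> n) \<or> \<beta> n = 0" for n using Q by (auto simp: \<beta>_def)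
  have unique: "b = b'" if "Q n b" "Q n b'" for n b b'
  proof -
    have *: "b = b'" if "Q n b" "Q n b'" "b' \<le> b" for b b'
    proof (rule starts_unique)
      \<comment> \<open>The strip is just short enough: \<open>\<alpha>\<close> times its upper
        bound is its excluded lower bound.\<close>
      have "\<alpha> * b \<le> \<alpha> ^ Suc n" using that(1) \<alpha> by (simp add: Q_def)
      then show "\<alpha> * b < b'" using that(2) by (simp add: Q_def)
    qed (use that in \<open>auto simp: Q_def\<close>)
    show ?thesis using *[of b b'] *[of b' b] that by (cases "b' \<le> b") auto
  qed
  have strip: "\<exists>n. Q n b" if "b \<in> starts" for b
    using ex_power_strip[OF \<alpha>] starts_block(1,2)[OF that] that by (simp add: Q_def)
  have block_Q: "Q n (\<beta> n)" if "x \<in> block \<alpha> (\<beta> n)" for x n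
    using cases[of n] that by (auto simp: block_def)
  show ?thesis
    unfolding tiled_def
  proof (intro exI[of _ \<beta>] conjI allI ballI impI)
    fix n
    show "0 \<le> \<beta> n" "\<beta> n \<le> \<alpha> ^ n"
      using cases[of n] \<alpha> starts_block(1)[of "\<beta> n"] by (auto simp: Q_def)
  next
    fix m n x
    assume x: "x \<in> block \<alpha> (\<beta> m)" "x \<in> block \<alpha> (\<beta> n)"
    note Qs = block_Q[OF x(1)] block_Q[OF x(2)]
    have eq: "\<beta> m = \<beta> n"
      using Qs starts_block(3)[OF _ x(1)] starts_block(3)[OF _ x(2)] by (simp add: Q_def)
    have "\<not> i < j" if "Q i b" "Q j b" for i j b
    proof
      assume "i < j"
      then have "\<alpha> ^ j \<le> \<alpha> ^ Suc i" using \<alpha> by (intro power_decreasing) auto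
      then show False using that by (auto simp: Q_def)
    qed
    then show "m = n" using Qs unfolding eq by (metis linorder_neqE_nat)
  next
    fix n x y
    assume x: "x \<in> block \<alpha> (\<beta> n)" and y: "y \<in> {0..1::real}"
    let ?b = "\<beta> n"
    have b: "?b \<in> starts" using block_Q[OF x] by (simp add: Q_def)
    have lh: "x \<in> {0..1}" "lo x = 1 - ?b" "hi x = 1 - \<alpha> * ?b" using starts_block(3)[OF b x] by auto
    have size: "hi x - lo x = (1 - \<alpha>) * ?b" unfolding lh by (simp add: algebra_simps)
    have ne: "lo x < hi x" using size starts_block(1)[OF b] \<alpha> by (smt (verit) mult_pos_pos)
    show "F x y = block_row \<alpha> ?b x y"
    proof (cases "y \<in> block \<alpha> ?b")
      case True
      then have "y \<in> {lo x..hi x}" by (auto simp: lh block_def)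
      from row(2)[OF lh(1) ne this] show ?thesis
        using True unfolding block_row_def size unfolding lh(2) by (simp only: if_True)
    next
      case False
      then have "F x y = min x y" by (intro F_eq_min lh(1) y) (auto simp: lh block_def)
      then show ?thesis using False by (simp add: block_row_def)
    qed
  next
    fix x y
    assume x: "x \<in> {0..1::real}" and y: "y \<in> {0..1::real}" and out: "\<forall>n. x \<notin> block \<alpha> (\<beta> n)"
    have "\<not> lo x < hi x"
    proof
      assume ne: "lo x < hi x"
      then have b: "1 - lo x \<in> starts" using x by (auto simp: starts_def)
      then obtain n where n: "Q n (1 - lo x)" using strip by blast
      then have "\<beta> n = 1 - lo x" using unique[OF n Q[OF exI[of "Q n", OF n]]] by simp
      moreover have "x \<in> block \<alpha> (1 - lo x)"
        using row(1)[OF x ne] lo_less_self[OF x ne] by (auto simp: block_def algebra_simps)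
      ultimately show False using out by metis
    qed
    then show "F x y = min x y" using F_eq_min[OF x y] by auto
  qed
qed

end

section \<open>Tilings by blocks\<close>

lemma tiled_disjoint: "tiled \<alpha> F \<beta> \<Longrightarrow> x \<in> block \<alpha> (\<beta> m) \<Longrightarrow> x \<in> block \<alpha> (\<beta> n) \<Longrightarrow> m = n"
  unfolding tiled_def by blast

lemma tiled_row: "tiled \<alpha> F \<beta> \<Longrightarrow> x \<in> block \<alpha> (\<beta> n) \<Longrightarrow> y \<in> {0..1} \<Longrightarrow> F x y = block_row \<alpha> (\<beta> n) x y"
  unfolding tiled_def by blast

lemma tiled_outside:
  "tiled \<alpha> F \<beta> \<Longrightarrow> x \<in> {0..1} \<Longrightarrow> y \<in> {0..1} \<Longrightarrow> (\<And>n. x \<notin> block \<alpha> (\<beta> n)) \<Longrightarrow> F x y = min x y"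
  unfolding tiled_def by blast

lemma tiled_gap_nonzero:
  assumes t: "tiled \<alpha> F \<beta>" and xy: "x \<in> {0..1}" "y \<in> {0..1}" and ne: "gap F x y \<noteq> 0"
  obtains n where "x \<in> block \<alpha> (\<beta> n)" "y \<in> block \<alpha> (\<beta> n)"
    "F x y = (1 - \<beta> n) + (x - (1 - \<beta> n)) * (y - (1 - \<beta> n)) / ((1 - \<alpha>) * \<beta> n)"
proof -
  have not_min: "F x y \<noteq> min x y" using ne by (auto simp: gap_def min_def split: if_splits)
  then obtain n where n: "x \<in> block \<alpha> (\<beta> n)" using tiled_outside[OF t xy] by blast
  then have F: "F x y = block_row \<alpha> (\<beta> n) x y" by (rule tiled_row[OF t _ xy(2)])
  have y: "y \<in> block \<alpha> (\<beta> n)"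
  proof (rule ccontr)
    assume "y \<notin> block \<alpha> (\<beta> n)"
    with F not_min show False by (simp add: block_row_def)
  qed
  with that[OF n] F show ?thesis by (simp add: block_row_def)
qed

text \<open>Both orders of the arguments are allowed, since a nonzero gap is used to pass from a row
  to a height and also from a height to a second row.\<close>

lemma tiled_same_block:
  assumes t: "tiled \<alpha> F \<beta>" and x: "x \<in> block \<alpha> (\<beta> n)" "x \<in> {0..1}" and y: "y \<in> {0..1}"
    and ne: "gap F x y \<noteq> 0 \<or> gap F y x \<noteq> 0"
  shows "y \<in> block \<alpha> (\<beta> n)"
proof -
  obtain m where "x \<in> block \<alpha> (\<beta> m)" "y \<in> block \<alpha> (\<beta> m)"
    using ne tiled_gap_nonzero[OF t x(2) y] tiled_gap_nonzero[OF t y x(2)] by metis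
  moreover from this(1) x(1) have "m = n" by (rule tiled_disjoint[OF t])
  ultimately show ?thesis by simp
qed

lemma tiled_row_diff:
  assumes t: "tiled \<alpha> F \<beta>" and \<alpha>: "\<alpha> < 1" and x: "x \<in> block \<alpha> (\<beta> n)"
    and y: "y \<in> {0..1}" "y' \<in> {0..1}" "y \<in> block \<alpha> (\<beta> n)" "y' \<in> block \<alpha> (\<beta> n)"
  shows "\<beta> n * (y - y' - (1 - \<alpha>) * (F x y - F x y')) = (1 - x) * (y - y')" "\<beta> n \<noteq> 0"
    "\<beta> n * (1 - \<alpha>) * F x y = \<beta> n * (1 - \<alpha>) * (1 - \<beta> n) + (x - (1 - \<beta> n)) * (y - (1 - \<beta> n))"
proof -
  show b: "\<beta> n \<noteq> 0" using x by (auto simp: block_def)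
  have "F x y = (1 - \<beta> n) + (x - (1 - \<beta> n)) * (y - (1 - \<beta> n)) / ((1 - \<alpha>) * \<beta> n)"
       "F x y' = (1 - \<beta> n) + (x - (1 - \<beta> n)) * (y' - (1 - \<beta> n)) / ((1 - \<alpha>) * \<beta> n)"
    using tiled_row[OF t x y(1)] tiled_row[OF t x y(2)] y by (simp_all add: block_row_def)
  then have e: "\<beta> n * (1 - \<alpha>) * F x y = \<beta> n * (1 - \<alpha>) * (1 - \<beta> n) + (x - (1 - \<beta> n)) * (y - (1 - \<beta> n))"
    "\<beta> n * (1 - \<alpha>) * F x y' = \<beta> n * (1 - \<alpha>) * (1 - \<beta> n) + (x - (1 - \<beta> n)) * (y' - (1 - \<beta> n))"
    using b \<alpha> by (simp_all add: distrib_left)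
  then show "\<beta> n * (1 - \<alpha>) * F x y = \<beta> n * (1 - \<alpha>) * (1 - \<beta> n) + (x - (1 - \<beta> n)) * (y - (1 - \<beta> n))" by simp
  have "\<beta> n * (y - y' - (1 - \<alpha>) * (F x y - F x y')) =
      \<beta> n * (y - y') - (\<beta> n * (1 - \<alpha>) * F x y - \<beta> n * (1 - \<alpha>) * F x y')"
    by (simp add: algebra_simps)
  also have "\<dots> = (1 - x) * (y - y')" unfolding e by (simp add: algebra_simps)
  finally show "\<beta> n * (y - y' - (1 - \<alpha>) * (F x y - F x y')) = (1 - x) * (y - y')" .
qed

text \<open>Nonzero gap factors force all six coordinates into one block. There
  \<open>(1 - x) * (y1 - y2)\<close> is \<open>\<beta> n * ?e\<close> and
  \<open>(1 - x') * (y3 - y4)\<close> is \<open>\<beta> n * ?e'\<close>, so both products in the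
  difference equal \<open>\<beta> n * ?e * ?e'\<close>.\<close>

lemma tiled_slope_identity:
  assumes t: "tiled \<alpha> F \<beta>" and \<alpha>: "\<alpha> < 1" and x: "x \<in> {0..1}" "x' \<in> {0..1}"
    and y: "y1 \<in> {0..1}" "y2 \<in> {0..1}" "y3 \<in> {0..1}" "y4 \<in> {0..1}"
  shows "slope_identity (1 - \<alpha>) F x x' y1 y2 y3 y4"
proof (cases "gap F x y1 * gap F x y2 * gap F x y3 * gap F x y4 *
    (gap F x' y1 * gap F x' y2 * gap F x' y3 * gap F x' y4) = 0")
  case False
  then have ne: "gap F x y1 \<noteq> 0" "gap F x y2 \<noteq> 0" "gap F x y3 \<noteq> 0" "gap F x y4 \<noteq> 0"
    "gap F x' y1 \<noteq> 0" by simp_all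
  obtain n where n: "x \<in> block \<alpha> (\<beta> n)" "y1 \<in> block \<alpha> (\<beta> n)"
    using tiled_gap_nonzero[OF t x(1) y(1) ne(1)] by metis
  have b: "y2 \<in> block \<alpha> (\<beta> n)" "y3 \<in> block \<alpha> (\<beta> n)" "y4 \<in> block \<alpha> (\<beta> n)" "x' \<in> block \<alpha> (\<beta> n)"
    using tiled_same_block[OF t n(1) x(1)] tiled_same_block[OF t n(2) y(1) x(2)] ne x y by blast+
  let ?e = "y1 - y2 - (1 - \<alpha>) * (F x y1 - F x y2)"
  let ?e' = "y3 - y4 - (1 - \<alpha>) * (F x' y3 - F x' y4)"
  have e: "\<beta> n * ?e = (1 - x) * (y1 - y2)" and e': "\<beta> n * ?e' = (1 - x') * (y3 - y4)" and b0: "\<beta> n \<noteq> 0"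
    using tiled_row_diff(1,2)[OF t \<alpha> n(1) y(1,2) n(2) b(1)] tiled_row_diff(1)[OF t \<alpha> b(4) y(3,4) b(2,3)]
    by simp_all
  have "(1 - x) * (y1 - y2) * ?e' - (1 - x') * (y3 - y4) * ?e = 0"
    unfolding e[symmetric] e'[symmetric] by simp
  then show ?thesis by (simp only: slope_identity_def mult_zero_right)
qed (simp only: slope_identity_def mult_zero_left)

text \<open>On a row with slope \<open>m\<close> and value \<open>l\<close> at height
  \<open>l\<close>, where \<open>l = 1 - ?b\<close>, the intercept \<open>F x y1 - m * y1\<close> is
  \<open>l * (1 - m)\<close>. The long last factor \<open>?r\<close> is therefore
  \<open>(y1 - y2) * (1 - m) * (1 - l)\<close>, that is, \<open>?b\<close> times
  \<open>(y1 - y2) - ?G\<close>.\<close>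

lemma tiled_size_identity:
  assumes t: "tiled \<alpha> F \<beta>" and \<alpha>: "\<alpha> < 1" and x: "x \<in> {0..1}" and y: "y1 \<in> {0..1}" "y2 \<in> {0..1}"
  shows "size_identity (1 - \<alpha>) F x y1 y2"
proof (cases "gap F x y1 * gap F x y2 = 0")
  case False
  then have ne: "gap F x y1 \<noteq> 0" "gap F x y2 \<noteq> 0" by simp_all
  obtain n where n: "x \<in> block \<alpha> (\<beta> n)" "y1 \<in> block \<alpha> (\<beta> n)"
    using tiled_gap_nonzero[OF t x y(1) ne(1)] by metis
  have b: "y2 \<in> block \<alpha> (\<beta> n)"
    using tiled_same_block[OF t n(1) x] ne y by blast
  let ?b = "\<beta> n" and ?G = "F x y1 - F x y2"
  let ?e = "y1 - y2 - (1 - \<alpha>) * ?G" and ?r = "(y1 - y2) - ?G - F x y1 * (y1 - y2) + ?G * y1"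
  note d = tiled_row_diff[OF t \<alpha> n(1) y n(2) b]
  note d' = tiled_row_diff(3)[OF t \<alpha> n(1) y(2,1) b n(2)]
  have c: "?b * (1 - \<alpha>) \<noteq> 0" using d(2) \<alpha> by simp
  have G: "?b * (1 - \<alpha>) * ?G = (x - (1 - ?b)) * (y1 - y2)"
    unfolding right_diff_distrib[of "?b * (1 - \<alpha>)"] d(3) d' by (simp add: algebra_simps)
  have "?b * (1 - \<alpha>) * ?r = ?b * (1 - \<alpha>) * (y1 - y2) - ?b * (1 - \<alpha>) * ?G -
      (?b * (1 - \<alpha>) * F x y1) * (y1 - y2) + (?b * (1 - \<alpha>) * ?G) * y1"
    by (simp add: algebra_simps)
  also have "\<dots> = ?b * (?b * (1 - \<alpha>) * ((y1 - y2) - ?G))"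
    unfolding right_diff_distrib[of "?b * (1 - \<alpha>)" "y1 - y2"] G d(3) by (simp add: algebra_simps)
  finally have "?b * (1 - \<alpha>) * ?r = ?b * (1 - \<alpha>) * (?b * ((y1 - y2) - ?G))" by (simp add: ac_simps)
  then have r: "?r = ?b * ((y1 - y2) - ?G)" by (rule mult_left_cancel[OF c, THEN iffD1])
  have "(1 - x) * (y1 - y2) * ((y1 - y2) - ?G) - ?e * ?r = 0"
    unfolding r d(1)[symmetric] by (simp only: ac_simps)
  then show ?thesis by (simp only: size_identity_def mult_zero_right)
qed (simp only: size_identity_def mult_zero_left)

lemma tiled_unique:
  assumes "tiled \<alpha> F \<beta>" "tiled \<alpha> G \<beta>" and x: "x \<in> {0..1}" and y: "y \<in> {0..1}"
  shows "F x y = G x y"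
proof (cases "\<exists>n. x \<in> block \<alpha> (\<beta> n)")
  case True
  then obtain n where "x \<in> block \<alpha> (\<beta> n)" ..
  then have "F x y = block_row \<alpha> (\<beta> n) x y" "G x y = block_row \<alpha> (\<beta> n) x y"
    using tiled_row[OF assms(1) _ y] tiled_row[OF assms(2) _ y] by simp_all
  then show ?thesis by simp
next
  case False
  then have "F x y = min x y" "G x y = min x y"
    using tiled_outside[OF assms(1) x y] tiled_outside[OF assms(2) x y] by simp_all
  then show ?thesis by simp
qed

text \<open>On a block with ends \<open>l\<close>, \<open>h\<close> and side \<open>s\<close>, the
  factors of the gap are \<open>(x - l) * (h - y) / s\<close> and
  \<open>(y - l) * (h - x) / s\<close>. Regrouped, their product is a function of \<open>x\<close>
  times the same function of \<open>y\<close>, which lets the integral of the gap factor.\<close>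

definition bump :: "real \<Rightarrow> real \<Rightarrow> real \<Rightarrow> real" where
  "bump \<alpha> b x = (if x \<in> block \<alpha> b then (x - (1 - b)) * (1 - \<alpha> * b - x) / ((1 - \<alpha>) * b) else 0)"

lemma bump_nonneg: "0 \<le> \<alpha> \<Longrightarrow> \<alpha> < 1 \<Longrightarrow> 0 \<le> b \<Longrightarrow> 0 \<le> bump \<alpha> b x"
  by (auto simp: bump_def block_def intro!: divide_nonneg_nonneg mult_nonneg_nonneg)

lemma measurable_bump: "bump \<alpha> b \<in> borel_measurable borel"
  unfolding bump_def block_def by measurable

lemma gap_eq_bump:
  assumes t: "tiled \<alpha> F \<beta>" and \<alpha>: "\<alpha> < 1" and x: "x \<in> block \<alpha> (\<beta> n)" "x \<in> {0..1}" and y: "y \<in> {0..1}"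
  shows "gap F x y = bump \<alpha> (\<beta> n) x * bump \<alpha> (\<beta> n) y"
proof (cases "y \<in> block \<alpha> (\<beta> n)")
  case True
  let ?b = "\<beta> n"
  let ?s = "?b * (1 - \<alpha>)"
  have F: "?s * F x y = ?s * (1 - ?b) + (x - (1 - ?b)) * (y - (1 - ?b))" and "?b \<noteq> 0"
    using tiled_row_diff(2,3)[OF t \<alpha> x(1) y y True True] by auto
  then have s: "?s \<noteq> 0" using \<alpha> by simp
  have "?s * (x - F x y) = (x - (1 - ?b)) * (1 - \<alpha> * ?b - y)"
    unfolding right_diff_distrib[of ?s] F by (simp add: algebra_simps)
  moreover have "?s * (y - F x y) = (y - (1 - ?b)) * (1 - \<alpha> * ?b - x)"
    unfolding right_diff_distrib[of ?s] F by (simp add: algebra_simps)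
  ultimately have "x - F x y = (x - (1 - ?b)) * (1 - \<alpha> * ?b - y) / ?s"
    "y - F x y = (y - (1 - ?b)) * (1 - \<alpha> * ?b - x) / ?s"
    using s by (simp_all only: eq_divide_eq mult.commute[of ?s] not_False_eq_True if_True)
  then show ?thesis
    using x(1) True by (simp add: gap_def bump_def ac_simps)
next
  case False
  have "gap F x y = 0"
    using tiled_same_block[OF t x y] False by blast
  then show ?thesis using False by (simp add: bump_def)
qed

lemma gap_sums_bump:
  assumes t: "tiled \<alpha> F \<beta>" and \<alpha>: "\<alpha> < 1" and x: "x \<in> {0..1}" and y: "y \<in> {0..1}"
  shows "(\<lambda>n. bump \<alpha> (\<beta> n) x * bump \<alpha> (\<beta> n) y) sums gap F x y"
proof (cases "\<exists>n. x \<in> block \<alpha> (\<beta> n)")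
  case True
  then obtain n where n: "x \<in> block \<alpha> (\<beta> n)" ..
  have "x \<notin> block \<alpha> (\<beta> m)" if "m \<noteq> n" for m
    using tiled_disjoint[OF t _ n] that by blast
  then have "(\<lambda>m. bump \<alpha> (\<beta> m) x * bump \<alpha> (\<beta> m) y) =
      (\<lambda>m. if m = n then bump \<alpha> (\<beta> n) x * bump \<alpha> (\<beta> n) y else 0)"
    by (auto simp: bump_def)
  then show ?thesis
    unfolding gap_eq_bump[OF t \<alpha> n x y] using sums_single[of n "\<lambda>_. bump \<alpha> (\<beta> n) x * bump \<alpha> (\<beta> n) y"] by simp
next
  case False
  then have "F x y = min x y" using tiled_outside[OF t x y] by simp
  then have "gap F x y = 0" by (simp add: gap_def min_def)
  moreover have "bump \<alpha> (\<beta> n) x = 0" for n using False by (simp add: bump_def)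
  ultimately show ?thesis by simp
qed

text \<open>After a shift this is the integral of \<open>t * (s - t) / s\<close> over
  \<open>{0..s}\<close>, namely \<open>s ^ 2 / 2 - s ^ 2 / 3\<close>.\<close>

lemma nn_integral_bump:
  assumes \<alpha>: "0 < \<alpha>" "\<alpha> < 1" and b: "0 \<le> b"
  shows "(\<integral>\<^sup>+ x. ennreal (bump \<alpha> b x) \<partial>lborel) = ennreal (((1 - \<alpha>) * b)\<^sup>2 / 6)"
proof (cases "b = 0")
  case True
  then have "bump \<alpha> b x = 0" for x by (simp add: bump_def)
  then show ?thesis using True by simp
next
  case False
  define s where "s = (1 - \<alpha>) * b"
  define l where "l = 1 - b"
  have s: "s > 0" using False b \<alpha> by (simp add: s_def)
  have h: "1 - \<alpha> * b = l + s" by (simp add: s_def l_def algebra_simps)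
  have bump: "bump \<alpha> b x = (if x \<in> {l<..<l + s} then (x - l) * (l + s - x) / s else 0)" for x
    unfolding bump_def block_def h unfolding l_def[symmetric] s_def[symmetric] ..
  have "(\<integral>\<^sup>+ x. ennreal (bump \<alpha> b x) \<partial>lborel) =
      (\<integral>\<^sup>+ x. ennreal ((x - l) * (l + s - x) / s) * indicator {l..l + s} x \<partial>lborel)"
    by (intro nn_integral_cong) (auto simp: bump split: split_indicator)
  also have "\<dots> = ennreal (((l + s - l)\<^sup>2 / 2 - (l + s - l) ^ 3 / (3 * s)) - ((l - l)\<^sup>2 / 2 - (l - l) ^ 3 / (3 * s)))"
  proof (rule nn_integral_FTC_Icc)
    show "((\<lambda>x. (x - l)\<^sup>2 / 2 - (x - l) ^ 3 / (3 * s)) has_real_derivative (x - l) * (l + s - x) / s) (at x)" for x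
      using s by (auto intro!: derivative_eq_intros simp: field_simps power2_eq_square)
  qed (use s in \<open>auto intro!: divide_nonneg_nonneg mult_nonneg_nonneg\<close>)
  also have "((l + s - l)\<^sup>2 / 2 - (l + s - l) ^ 3 / (3 * s)) - ((l - l)\<^sup>2 / 2 - (l - l) ^ 3 / (3 * s)) = s\<^sup>2 / 6"
    using s by (simp add: power2_eq_square power3_eq_cube field_simps)
  finally show ?thesis by (simp add: s_def)
qed

section \<open>From distribution functions back to permutons\<close>

lemma copula_cdf2: "permuton \<mu> \<Longrightarrow> copula (cdf2 \<mu>)"
  by unfold_locales (simp_all add: cdf2_nonneg cdf2_mono cdf2_lipschitz cdf2_right cdf2_top continuous_on_cdf2)

lemma distr_permuton:
  assumes \<mu>: "permuton \<mu>" and f: "f \<in> borel_measurable \<mu>"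
    and unif: "\<And>t. t \<in> {0..1} \<Longrightarrow> measure \<mu> {q \<in> space \<mu>. f q \<in> {0..t}} = t"
    and ran: "\<And>q. q \<in> space \<mu> \<Longrightarrow> f q \<in> {0..1}"
  shows "distr \<mu> borel f = uniform_measure lborel {0..1::real}"
proof (rule cdf_unique)
  interpret \<mu>: prob_space \<mu> by (rule prob_space_permuton[OF \<mu>])
  show "real_distribution (distr \<mu> borel f)" using f by (rule \<mu>.real_distribution_distr)
  have "prob_space (uniform_measure lborel {0..1::real})"
    by (rule prob_space_uniform_measure) simp_all
  then show "real_distribution (uniform_measure lborel {0..1::real})"
    by (simp add: real_distribution_def real_distribution_axioms_def)
  show "cdf (distr \<mu> borel f) = cdf (uniform_measure lborel {0..1::real})"
  proof
    fix t :: real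
    let ?t = "max 0 (min 1 t)"
    have l: "cdf (distr \<mu> borel f) t = measure \<mu> {q \<in> space \<mu>. f q \<le> t}"
      using f by (simp add: cdf_def measure_distr vimage_def Int_def conj_commute)
    have r: "cdf (uniform_measure lborel {0..1::real}) t = ?t"
    proof -
      have "{0..1} \<inter> {..t} = {0..min 1 t}" by auto
      then have "cdf (uniform_measure lborel {0..1::real}) t = measure lborel {0..min 1 t}"
        by (simp add: cdf_def measure_uniform_measure)
      also have "\<dots> = ?t" by (cases "0 \<le> t") auto
      finally show ?thesis .
    qed
    show "cdf (distr \<mu> borel f) t = cdf (uniform_measure lborel {0..1::real}) t"
    proof (cases "0 \<le> t")
      case True
      then have "{q \<in> space \<mu>. f q \<le> t} = {q \<in> space \<mu>. f q \<in> {0..?t}}"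
        using ran by auto
      then show ?thesis unfolding l r using unif[of ?t] True by simp
    next
      case False
      then have "{q \<in> space \<mu>. f q \<le> t} = {}" using ran by force
      then have "measure \<mu> {q \<in> space \<mu>. f q \<le> t} = 0" by (simp only: measure_empty)
      then show ?thesis unfolding l r using False by simp
    qed
  qed
qed

lemma nn_integral_permuton:
  assumes \<mu>: "permuton \<mu>" and g: "g \<in> borel_measurable borel" and out: "\<And>t. t \<notin> {0..1} \<Longrightarrow> g t = 0"
  shows "(\<integral>\<^sup>+ q. g (fst q) \<partial>\<mu>) = (\<integral>\<^sup>+ t. g t \<partial>lborel)" "(\<integral>\<^sup>+ q. g (snd q) \<partial>\<mu>) = (\<integral>\<^sup>+ t. g t \<partial>lborel)"
proof -
  have u: "(\<integral>\<^sup>+ t. g t \<partial>uniform_measure lborel {0..1}) = (\<integral>\<^sup>+ t. g t \<partial>lborel)"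
  proof -
    have "(\<integral>\<^sup>+ t. g t \<partial>uniform_measure lborel {0..1}) = (\<integral>\<^sup>+ t. g t * indicator {0..1} t \<partial>lborel)"
      using g by (simp add: nn_integral_uniform_measure divide_ennreal_def)
    also have "\<dots> = (\<integral>\<^sup>+ t. g t \<partial>lborel)"
      using out by (intro nn_integral_cong) (auto split: split_indicator)
    finally show ?thesis .
  qed
  have s: "measure \<mu> {q \<in> space \<mu>. fst q \<in> {0..t}} = t" "measure \<mu> {q \<in> space \<mu>. snd q \<in> {0..t}} = t"
    if "t \<in> {0..1}" for t
    using measure_permuton_strip[OF \<mu>, of 0 t] that by simp_all
  have r: "fst q \<in> {0..1}" "snd q \<in> {0..1}" if "q \<in> space \<mu>" for q
    using that by (auto simp: space_permuton[OF \<mu>] unit_square_def)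
  have "(\<integral>\<^sup>+ q. g (fst q) \<partial>\<mu>) = (\<integral>\<^sup>+ t. g t \<partial>distr \<mu> borel fst)"
    by (rule nn_integral_distr[OF fst_measurable_permuton[OF \<mu>], symmetric]) (simp add: g)
  then show "(\<integral>\<^sup>+ q. g (fst q) \<partial>\<mu>) = (\<integral>\<^sup>+ t. g t \<partial>lborel)"
    by (simp only: distr_permuton[OF \<mu> fst_measurable_permuton[OF \<mu>] s(1) r(1)] u)
  have "(\<integral>\<^sup>+ q. g (snd q) \<partial>\<mu>) = (\<integral>\<^sup>+ t. g t \<partial>distr \<mu> borel snd)"
    by (rule nn_integral_distr[OF snd_measurable_permuton[OF \<mu>], symmetric]) (simp add: g)
  then show "(\<integral>\<^sup>+ q. g (snd q) \<partial>\<mu>) = (\<integral>\<^sup>+ t. g t \<partial>lborel)"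
    by (simp only: distr_permuton[OF \<mu> snd_measurable_permuton[OF \<mu>] s(2) r(2)] u)
qed

section \<open>The integral of the gap as an invariant of a tiling\<close>

definition gap_at :: "nat \<Rightarrow> nat \<Rightarrow> grid_functional" where
  "gap_at i j = (\<lambda>F x y. (F (x i) (y 0) - F (x i) (y j)) * (F (x 0) (y j) - F (x i) (y j)))"

lemma grid_poly_gap_at:
  assumes "i \<in> I" "j \<in> J" "0 \<in> I" "0 \<in> J"
  shows "grid_poly I J (\<lambda>F x y. gap_at i j F x y)"
  unfolding gap_at_def by (intro grid_poly_intros assms)

lemma (in copula) gap_at_eq:
  assumes "x 0 = 1" "y 0 = 1" "x i \<in> {0..1}" "y j \<in> {0..1}"
  shows "gap_at i j F x y = gap F (x i) (y j)"
  using assms by (simp add: gap_at_def gap_def right top)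

text \<open>The x-coordinate of point 1 and the y-coordinate of point 2 are independent and uniform,
  so each product of two bumps integrates to the square of one bump integral; nonnegativity permits
  summing term by term.\<close>

lemma expect_gap_sums:
  assumes \<mu>: "permuton \<mu>" and t: "tiled \<alpha> (cdf2 \<mu>) \<beta>" and \<alpha>: "0 < \<alpha>" "\<alpha> < 1"
  shows "(\<lambda>n. (((1 - \<alpha>) * \<beta> n)\<^sup>2 / 6)\<^sup>2) sums expect 2 (gap_at 1 2) \<mu>"
proof -
  interpret product_sigma_finite "\<lambda>_::nat. \<mu>" by (rule product_sigma_finite_permuton[OF \<mu>])
  interpret copula "cdf2 \<mu>" by (rule copula_cdf2[OF \<mu>])
  let ?M = "Pi\<^sub>M {1..2::nat} (\<lambda>_. \<mu>)" and ?g = "\<lambda>p. gap_at 1 2 (cdf2 \<mu>) (grid_x p) (grid_y p)"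
  have gp: "grid_poly {..2} {..2} (gap_at 1 2)"
    using grid_poly_gap_at[of 1 "{..2}" 2 "{..2}"] by simp
  have \<beta>: "0 \<le> \<beta> n" for n using t by (simp add: tiled_def)
  have b0: "0 \<le> bump \<alpha> (\<beta> n) x" for n x using \<alpha> \<beta> by (intro bump_nonneg) auto
  have p01: "fst (p i) \<in> {0..1}" "snd (p i) \<in> {0..1}" if "p \<in> space ?M" "i \<in> {1..2}" for p i
  proof -
    have "p i \<in> unit_square"
      using that(1) unfolding space_PiM space_permuton[OF \<mu>] by (rule PiE_mem) (rule that(2))
    then show "fst (p i) \<in> {0..1}" "snd (p i) \<in> {0..1}" by (simp_all add: unit_square_def mem_Times_iff)
  qed
  have g: "?g p = gap (cdf2 \<mu>) (fst (p 1)) (snd (p 2))" if "p \<in> space ?M" for p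
  proof -
    have "?g p = gap (cdf2 \<mu>) (grid_x p 1) (grid_y p 2)"
      using p01[OF that, of 1] p01[OF that, of 2] by (intro gap_at_eq) (simp_all add: grid_x_def grid_y_def)
    then show ?thesis by (simp add: grid_x_def grid_y_def)
  qed
  have gs: "(\<lambda>n. bump \<alpha> (\<beta> n) (fst (p 1)) * bump \<alpha> (\<beta> n) (snd (p 2))) sums ?g p" if "p \<in> space ?M" for p
    unfolding g[OF that] using p01[OF that, of 1] p01[OF that, of 2] by (intro gap_sums_bump[OF t \<alpha>(2)]) auto
  have g0: "0 \<le> ?g p" if "p \<in> space ?M" for p
    unfolding g[OF that] using F_le[OF p01(1)[OF that, of 1] p01(2)[OF that, of 2]] by (simp add: gap_def)
  have meas: "(\<lambda>p. ennreal (bump \<alpha> (\<beta> n) (fst p))) \<in> borel_measurable \<mu>"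
    "(\<lambda>p. ennreal (bump \<alpha> (\<beta> n) (snd p))) \<in> borel_measurable \<mu>" for n
    using measurable_compose[OF fst_measurable_permuton[OF \<mu>] measurable_bump]
      measurable_compose[OF snd_measurable_permuton[OF \<mu>] measurable_bump]
    by (auto intro!: measurable_compose[OF _ measurable_ennreal])
  define f where "f n i = (if i = (1::nat) then (\<lambda>q. ennreal (bump \<alpha> (\<beta> n) (fst q)))
     else (\<lambda>q. ennreal (bump \<alpha> (\<beta> n) (snd q))))" for n i
  have fm: "f n i \<in> borel_measurable \<mu>" for n i using meas by (simp add: f_def)
  have two: "{1..2::nat} = {1, 2}" by auto
  have bump_out: "ennreal (bump \<alpha> (\<beta> n) s) = 0" if "s \<notin> {0..1}" for n s
  proof -
    have "\<beta> n \<le> 1" "0 \<le> \<alpha> * \<beta> n" using t \<beta> \<alpha> power_le_one[of \<alpha> n] by (auto simp: tiled_def intro: order_trans)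
    then have "s \<notin> block \<alpha> (\<beta> n)" using that by (auto simp: block_def)
    then show ?thesis by (simp add: bump_def)
  qed
  have bm: "(\<lambda>s. ennreal (bump \<alpha> (\<beta> n) s)) \<in> borel_measurable borel" for n
    by (rule measurable_compose[OF measurable_bump measurable_ennreal])
  have int: "(\<integral>\<^sup>+ q. f n i q \<partial>\<mu>) = ennreal (((1 - \<alpha>) * \<beta> n)\<^sup>2 / 6)" for n i
    using nn_integral_permuton[OF \<mu> bm bump_out] nn_integral_bump[OF \<alpha> \<beta>] by (simp add: f_def)
  have "ennreal (expect 2 (gap_at 1 2) \<mu>) = (\<integral>\<^sup>+ p. ennreal (?g p) \<partial>?M)"
    unfolding expect_def using integrable_grid_poly[OF \<mu> gp] g0
    by (intro nn_integral_eq_integral[symmetric]) auto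
  also have "\<dots> = (\<integral>\<^sup>+ p. (\<Sum>n. (\<Prod>i\<in>{1..2}. f n i (p i))) \<partial>?M)"
  proof (rule nn_integral_cong)
    fix p assume p: "p \<in> space ?M"
    have "(\<lambda>n. ennreal (bump \<alpha> (\<beta> n) (fst (p 1)) * bump \<alpha> (\<beta> n) (snd (p 2)))) sums ennreal (?g p)"
      using gs[OF p] b0 g0[OF p] by (subst sums_ennreal) (auto intro: mult_nonneg_nonneg)
    then show "ennreal (?g p) = (\<Sum>n. (\<Prod>i\<in>{1..2}. f n i (p i)))"
      unfolding two by (simp add: f_def ennreal_mult' b0 sums_iff)
  qed
  also have "\<dots> = (\<Sum>n. (\<integral>\<^sup>+ p. (\<Prod>i\<in>{1..2}. f n i (p i)) \<partial>?M))"
  proof (intro nn_integral_suminf borel_measurable_prod_ennreal)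
    fix n i assume "i \<in> {1..2::nat}"
    from measurable_compose[OF measurable_component_singleton[OF this, of "\<lambda>_. \<mu>"] fm[of n i]]
    show "(\<lambda>p. f n i (p i)) \<in> borel_measurable ?M" .
  qed
  also have "\<dots> = (\<Sum>n. (\<Prod>i\<in>{1..2}. (\<integral>\<^sup>+ q. f n i q \<partial>\<mu>)))"
    using fm by (intro suminf_cong product_nn_integral_prod) auto
  also have "\<dots> = (\<Sum>n. ennreal ((((1 - \<alpha>) * \<beta> n)\<^sup>2 / 6)\<^sup>2))"
  proof (rule suminf_cong)
    fix n
    let ?a = "((1 - \<alpha>) * \<beta> n)\<^sup>2 / 6"
    have "(\<Prod>i\<in>{1..2::nat}. (\<integral>\<^sup>+ q. f n i q \<partial>\<mu>)) = ennreal ?a * ennreal ?a"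
      unfolding two int by simp
    also have "\<dots> = ennreal (?a * ?a)" by (rule ennreal_mult[symmetric]) simp_all
    finally show "(\<Prod>i\<in>{1..2::nat}. (\<integral>\<^sup>+ q. f n i q \<partial>\<mu>)) = ennreal (?a\<^sup>2)"
      by (simp only: power2_eq_square[of ?a])
  qed
  finally have "(\<lambda>n. ennreal ((((1 - \<alpha>) * \<beta> n)\<^sup>2 / 6)\<^sup>2)) sums ennreal (expect 2 (gap_at 1 2) \<mu>)"
    by (simp add: sums_iff)
  moreover have "0 \<le> expect 2 (gap_at 1 2) \<mu>"
    unfolding expect_def using g0 by (intro integral_nonneg_AE AE_I2)
  ultimately show ?thesis by (subst (asm) sums_ennreal) auto
qed

text \<open>The termwise differences of the two series are nonnegative because
  \<open>\<beta> n \<le> \<alpha> ^ n\<close>, and they sum to 0, so each of them is 0.\<close>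

lemma tiling_eq:
  assumes "permuton \<mu>" "tiled \<alpha> (cdf2 \<mu>) \<beta>" "permuton \<nu>" "tiled \<alpha> (cdf2 \<nu>) (\<lambda>n. \<alpha> ^ n)"
    and \<alpha>: "0 < \<alpha>" "\<alpha> < 1" and eq: "expect 2 (gap_at 1 2) \<mu> = expect 2 (gap_at 1 2) \<nu>"
  shows "\<beta> = (\<lambda>n. \<alpha> ^ n)"
proof
  fix n
  let ?a = "\<lambda>b. (((1 - \<alpha>) * b)\<^sup>2 / 6)\<^sup>2"
  let ?d = "\<lambda>n. ?a (\<alpha> ^ n) - ?a (\<beta> n)"
  have \<beta>: "0 \<le> \<beta> n" "\<beta> n \<le> \<alpha> ^ n" for n using assms(2) by (auto simp: tiled_def)
  have "?d sums 0"
    using sums_diff[OF expect_gap_sums[OF assms(3,4) \<alpha>] expect_gap_sums[OF assms(1,2) \<alpha>]] eq by simp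
  moreover have "?d n \<ge> 0" for n
    using \<beta>[of n] \<alpha> by (auto intro!: power_mono divide_right_mono mult_left_mono)
  ultimately have "?d n = 0"
    using suminf_eq_zero_iff[of ?d] by (simp add: sums_iff)
  then have "?a (\<alpha> ^ n) = ?a (\<beta> n)" by (rule eq_iff_diff_eq_0[THEN iffD2])
  then have "((1 - \<alpha>) * \<alpha> ^ n)\<^sup>2 / 6 = ((1 - \<alpha>) * \<beta> n)\<^sup>2 / 6"
    by (rule power2_eq_imp_eq) simp_all
  then have e: "((1 - \<alpha>) * \<alpha> ^ n)\<^sup>2 = ((1 - \<alpha>) * \<beta> n)\<^sup>2" by simp
  have "(1 - \<alpha>) * \<alpha> ^ n = (1 - \<alpha>) * \<beta> n"
    by (rule power2_eq_imp_eq[OF e]) (use \<beta>(1)[of n] \<alpha> in simp_all)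
  then show "\<beta> n = \<alpha> ^ n" using \<alpha> by simp
qed

text \<open>Quadrants are stable under intersection and generate the Borel sets of the plane. The
  measures are therefore pushed forward to the plane, compared there and restricted to the unit
  square again.\<close>

lemma permuton_eqI:
  assumes \<mu>: "permuton \<mu>" "permuton \<nu>"
    and eq: "\<And>x y. x \<in> {0..1} \<Longrightarrow> y \<in> {0..1} \<Longrightarrow> cdf2 \<mu> x y = cdf2 \<nu> x y"
  shows "\<mu> = \<nu>"
proof -
  have em: "emeasure (distr \<rho> borel (\<lambda>q. q)) {..(x, y)} = ennreal (cdf2 \<rho> x y)" if "permuton \<rho>" for \<rho> x y
  proof -
    interpret prob_space \<rho> by (rule prob_space_permuton[OF that])
    have "{..(x, y)} \<in> sets (borel :: (real \<times> real) measure)" by simp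
    then have "emeasure (distr \<rho> borel (\<lambda>q. q)) {..(x, y)} = emeasure \<rho> ((\<lambda>q. q) -` {..(x, y)} \<inter> space \<rho>)"
      by (rule emeasure_distr[OF id_measurable_permuton[OF that]])
    also have "(\<lambda>q. q) -` {..(x, y)} \<inter> space \<rho> = {q \<in> space \<rho>. fst q \<le> x \<and> snd q \<le> y}"
      by (auto simp: less_eq_prod_def)
    finally show ?thesis by (simp add: cdf2_def emeasure_eq_measure)
  qed
  have clamp: "cdf2 \<rho> x y = (if x < 0 \<or> y < 0 then 0 else cdf2 \<rho> (min x 1) (min y 1))" if "permuton \<rho>" for \<rho> x y
  proof -
    have "{q \<in> space \<rho>. fst q \<le> x \<and> snd q \<le> y} =
        (if x < 0 \<or> y < 0 then {} else {q \<in> space \<rho>. fst q \<le> min x 1 \<and> snd q \<le> min y 1})"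
      by (auto simp: space_permuton[OF that] unit_square_def)
    then show ?thesis by (simp add: cdf2_def)
  qed
  have eq': "cdf2 \<mu> x y = cdf2 \<nu> x y" for x y
    unfolding clamp[OF \<mu>(1), of x y] clamp[OF \<mu>(2), of x y] using eq[of "min x 1" "min y 1"] by auto
  have "distr \<mu> borel (\<lambda>q. q) = distr \<nu> borel (\<lambda>q. q)"
  proof (rule measure_eqI_generator_eq[where \<Omega> = UNIV and E = "range atMost" and A = "\<lambda>n. {..(real n, real n)}"])
    have "{..a} \<inter> {..b} = {..(min (fst a) (fst b), min (snd a) (snd b))}" for a b :: "real \<times> real"
      by (auto simp: less_eq_prod_def)
    then show "Int_stable (range (atMost :: real \<times> real \<Rightarrow> _))"
      unfolding Int_stable_def by blast
    show "sets (distr \<mu> borel (\<lambda>q. q)) = sigma_sets UNIV (range atMost)"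
      "sets (distr \<nu> borel (\<lambda>q. q)) = sigma_sets UNIV (range atMost)"
      by (simp_all add: borel_eq_atMost)
    show "(\<Union>n. {..(real n, real n)}) = UNIV"
    proof (intro set_eqI iffI UNIV_I)
      fix q :: "real \<times> real"
      obtain n where "max (fst q) (snd q) \<le> real n" using real_arch_simple by blast
      then show "q \<in> (\<Union>n. {..(real n, real n)})" by (auto simp: less_eq_prod_def)
    qed
    show "range (\<lambda>n. {..(real n, real n)}) \<subseteq> range atMost" by blast
    show "emeasure (distr \<mu> borel (\<lambda>q. q)) {..(real n, real n)} \<noteq> \<infinity>" for n
      by (simp add: em[OF \<mu>(1)])
    fix X :: "(real \<times> real) set" assume "X \<in> range atMost"
    then obtain x y where "X = {..(x, y)}" by auto
    then show "emeasure (distr \<mu> borel (\<lambda>q. q)) X = emeasure (distr \<nu> borel (\<lambda>q. q)) X"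
      by (simp add: em[OF \<mu>(1)] em[OF \<mu>(2)] eq')
  qed simp
  then have d: "emeasure (distr \<mu> borel (\<lambda>q. q)) A = emeasure (distr \<nu> borel (\<lambda>q. q)) A" for A by simp
  show ?thesis
  proof (rule measure_eqI)
    show "sets \<mu> = sets \<nu>" using sets_permuton[OF \<mu>(1)] sets_permuton[OF \<mu>(2)] by simp
    fix A assume A: "A \<in> sets \<mu>"
    have "unit_square \<in> sets borel" unfolding unit_square_def by (intro borel_closed closed_Times) auto
    then have Ab: "A \<in> sets borel" "A \<subseteq> unit_square"
      using A sets_permuton[OF \<mu>(1)] by (auto simp: sets_restrict_space)
    have "emeasure (distr \<rho> borel (\<lambda>q. q)) A = emeasure \<rho> A" if "permuton \<rho>" for \<rho>
    proof -
      have "(\<lambda>q. q) -` A \<inter> space \<rho> = A" using Ab(2) by (auto simp: space_permuton[OF that])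
      then show ?thesis using emeasure_distr[OF id_measurable_permuton[OF that] Ab(1)] by simp
    qed
    then show "emeasure \<mu> A = emeasure \<nu> A" using d[of A] \<mu> by simp
  qed
qed

section \<open>The permuton with geometric blocks\<close>

text \<open>For \<open>x\<close> in the unit interval this is the length of the part of the
  \<open>i\<close>th interval to the left of \<open>x\<close>. The distribution function of
  \<open>mu_r\<close> is the sum of products of two such lengths, each divided by the side
  length.\<close>

definition overlap :: "real \<Rightarrow> nat \<Rightarrow> real \<Rightarrow> real" where
  "overlap \<alpha> i x = max 0 (min (x - (1 - \<alpha> ^ i)) ((1 - \<alpha>) * \<alpha> ^ i))"

lemma emeasure_lborel_rectangle:
  fixes a b c d :: real
  assumes "a \<le> b" "c \<le> d"
  shows "emeasure lborel ({a..b} \<times> {c..d}) = ennreal ((b - a) * (d - c))"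
proof -
  have "emeasure lborel ({a..b} \<times> {c..d}) = emeasure (lborel \<Otimes>\<^sub>M lborel) ({a..b} \<times> {c..d})"
    by (simp only: lborel_prod)
  also have "\<dots> = emeasure lborel {a..b} * emeasure lborel {c..d}"
    by (rule lborel.emeasure_pair_measure_Times) simp_all
  also have "\<dots> = ennreal ((b - a) * (d - c))"
    using assms by (simp add: ennreal_mult)
  finally show ?thesis .
qed

context
  fixes \<alpha> :: real
  assumes \<alpha>: "0 < \<alpha>" "\<alpha> < 1"
begin

lemma pow01: "0 < \<alpha> ^ i" "\<alpha> ^ i \<le> 1"
  using \<alpha> by (auto intro: power_le_one)

lemma overlap_nonneg: "0 \<le> overlap \<alpha> i x" and overlap_0: "overlap \<alpha> i 0 = 0"
  and overlap_mono: "x \<le> y \<Longrightarrow> overlap \<alpha> i x \<le> overlap \<alpha> i y"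
  using pow01[of i] by (auto simp: overlap_def)

lemma overlap_before: "x \<le> 1 - \<alpha> ^ i \<Longrightarrow> overlap \<alpha> i x = 0"
  by (simp add: overlap_def)

lemma overlap_after: "1 - \<alpha> ^ Suc i \<le> x \<Longrightarrow> overlap \<alpha> i x = (1 - \<alpha>) * \<alpha> ^ i"
  using pow01[of i] \<alpha> by (simp add: overlap_def algebra_simps max_def)

lemma overlap_1: "overlap \<alpha> i 1 = (1 - \<alpha>) * \<alpha> ^ i"
  using pow01[of "Suc i"] by (intro overlap_after) simp

lemma overlap_sums:
  assumes "x \<in> {0..1}"
  shows "(\<lambda>i. overlap \<alpha> i x) sums x"
proof -
  have "(\<Sum>i<n. overlap \<alpha> i x) = min x (1 - \<alpha> ^ n)" for n
  proof (induction n)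
    case (Suc n)
    have s: "(1 - \<alpha>) * \<alpha> ^ n = (1 - \<alpha> ^ Suc n) - (1 - \<alpha> ^ n)" "0 \<le> (1 - \<alpha>) * \<alpha> ^ n"
      using \<alpha> by (simp_all add: algebra_simps)
    have "min x (1 - \<alpha> ^ n) + max 0 (min (x - (1 - \<alpha> ^ n)) ((1 - \<alpha> ^ Suc n) - (1 - \<alpha> ^ n))) =
        min x (1 - \<alpha> ^ Suc n)"
      using s unfolding s(1) by (auto simp: min_def max_def simp del: power_Suc)
    then have "min x (1 - \<alpha> ^ n) + overlap \<alpha> n x = min x (1 - \<alpha> ^ Suc n)"
      by (simp only: overlap_def s(1))
    then show ?case by (simp only: sum.lessThan_Suc Suc)
  qed (use assms in simp)
  moreover have "(\<lambda>n. min x (1 - \<alpha> ^ n)) \<longlonglongrightarrow> min x (1 - 0)"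
    using \<alpha> by (intro tendsto_intros LIMSEQ_realpow_zero) auto
  ultimately show ?thesis using assms by (simp add: sums_def min_def)
qed

lemma sets_mu_r: "sets (mu_r \<alpha>) = sets (restrict_space borel unit_square)"
  and space_mu_r: "space (mu_r \<alpha>) = unit_square"
proof -
  let ?N = "restrict_space borel unit_square :: (real \<times> real) measure"
  have sp: "space ?N = unit_square" by (simp add: space_restrict_space)
  have "sigma_algebra unit_square (sets ?N)"
    using sets.sigma_algebra_axioms[of ?N] sp by simp
  moreover have "sets ?N \<subseteq> Pow unit_square" using sets.space_closed[of ?N] sp by simp
  ultimately show "sets (mu_r \<alpha>) = sets ?N" "space (mu_r \<alpha>) = unit_square"
    unfolding mu_r_def by (simp_all add: sets_measure_of sigma_algebra.sigma_sets_eq space_measure_of)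
qed

lemma unit_square_borel: "unit_square \<in> sets borel"
  unfolding unit_square_def by (intro borel_closed closed_Times) auto

text \<open>The weight of a square is its side length \<open>s\<close>, while normalising divides by
  the area \<open>s * s\<close>; one factor \<open>s\<close> remains in the denominator.\<close>

lemma emeasure_uniform_on_rectangle:
  assumes "0 \<le> u" "u \<le> x" "x \<le> 1" "0 \<le> v" "v \<le> y" "y \<le> 1"
  shows "ennreal ((1 - \<alpha>) * \<alpha> ^ i) * emeasure (uniform_on (mu_square \<alpha> i)) ({u..x} \<times> {v..y}) =
    ennreal ((overlap \<alpha> i x - overlap \<alpha> i u) * (overlap \<alpha> i y - overlap \<alpha> i v) / ((1 - \<alpha>) * \<alpha> ^ i))"
proof -
  let ?s = "(1 - \<alpha>) * \<alpha> ^ i" and ?a = "1 - \<alpha> ^ i" and ?h = "1 - \<alpha> ^ Suc i"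
  let ?M = "restrict_space lborel unit_square :: (real \<times> real) measure"
  have s: "0 < ?s" using pow01[of i] \<alpha> by simp
  have ah: "?a \<le> ?h" "0 \<le> ?a" "?h \<le> 1" "?h - ?a = ?s" using pow01[of i] pow01[of "Suc i"] s by (auto simp: algebra_simps)
  have sub: "mu_square \<alpha> i \<subseteq> unit_square" "{u..x} \<times> {v..y} \<subseteq> unit_square"
    using assms ah by (auto simp: mu_square_def unit_square_def simp del: power_Suc)
  have em: "emeasure ?M A = emeasure lborel A" if "A \<subseteq> unit_square" for A
    using that unit_square_borel by (intro emeasure_restrict_space) auto
  have rect: "{p..q} \<times> {r..t} \<in> sets ?M" if "{p..q} \<times> {r..t} \<subseteq> unit_square" for p q r t
  proof -
    have "{p..q} \<times> {r..t} \<in> sets borel" by (intro borel_closed closed_Times) auto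
    then show ?thesis using that by (auto simp: sets_restrict_space_iff unit_square_borel)
  qed
  \<comment> \<open>The length of an interval clipped to the \<open>i\<close>th one is a difference
    of overlaps; the outer maximum covers an empty intersection.\<close>
  have clip: "max 0 (min ?h q - max ?a p) = overlap \<alpha> i q - overlap \<alpha> i p" if "p \<le> q" for p q
    using that ah(1) unfolding overlap_def ah(4)[symmetric] by (auto simp: min_def max_def simp del: power_Suc)
  have len: "emeasure lborel ({max ?a u..min ?h x} \<times> {max ?a v..min ?h y}) =
      ennreal ((overlap \<alpha> i x - overlap \<alpha> i u) * (overlap \<alpha> i y - overlap \<alpha> i v))"
  proof (cases "max ?a u \<le> min ?h x \<and> max ?a v \<le> min ?h y")
    case True
    then show ?thesis
      using emeasure_lborel_rectangle clip[OF assms(2)] clip[OF assms(5)] by (simp only: max_absorb2 diff_ge_0_iff_ge)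
  next
    case False
    then have "{max ?a u..min ?h x} \<times> {max ?a v..min ?h y} = {}" by auto
    moreover have "(overlap \<alpha> i x - overlap \<alpha> i u) * (overlap \<alpha> i y - overlap \<alpha> i v) = 0"
      using False clip[OF assms(2)] clip[OF assms(5)] by (auto simp: max_def simp del: power_Suc split: if_splits)
    ultimately show ?thesis by (simp only: emeasure_empty ennreal_0)
  qed
  have "mu_square \<alpha> i \<inter> ({u..x} \<times> {v..y}) = {max ?a u..min ?h x} \<times> {max ?a v..min ?h y}"
    unfolding mu_square_def by auto
  then have "emeasure ?M (mu_square \<alpha> i \<inter> ({u..x} \<times> {v..y})) =
      ennreal ((overlap \<alpha> i x - overlap \<alpha> i u) * (overlap \<alpha> i y - overlap \<alpha> i v))"
    using em[of "mu_square \<alpha> i \<inter> ({u..x} \<times> {v..y})"] sub len by auto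
  moreover have "emeasure ?M (mu_square \<alpha> i) = ennreal (?s * ?s)"
    using em[OF sub(1)] emeasure_lborel_rectangle[OF ah(1) ah(1)] unfolding ah(4) by (simp add: mu_square_def)
  moreover have "mu_square \<alpha> i \<in> sets ?M" "{u..x} \<times> {v..y} \<in> sets ?M"
    using rect sub by (auto simp: mu_square_def)
  ultimately have "emeasure (uniform_on (mu_square \<alpha> i)) ({u..x} \<times> {v..y}) =
      ennreal ((overlap \<alpha> i x - overlap \<alpha> i u) * (overlap \<alpha> i y - overlap \<alpha> i v)) / ennreal (?s * ?s)"
    unfolding uniform_on_def by (simp add: emeasure_uniform_measure)
  also have "\<dots> = ennreal ((overlap \<alpha> i x - overlap \<alpha> i u) * (overlap \<alpha> i y - overlap \<alpha> i v) / (?s * ?s))"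
    using s assms overlap_mono by (intro divide_ennreal mult_nonneg_nonneg) auto
  finally have e: "emeasure (uniform_on (mu_square \<alpha> i)) ({u..x} \<times> {v..y}) =
      ennreal ((overlap \<alpha> i x - overlap \<alpha> i u) * (overlap \<alpha> i y - overlap \<alpha> i v) / (?s * ?s))" .
  have cancel: "t * (r / (t * t)) = r / t" if "t \<noteq> 0" for r t :: real using that by simp
  have "?s \<noteq> 0" using s by (rule less_imp_neq[symmetric])
  show ?thesis
    unfolding e ennreal_mult'[OF less_imp_le[OF s], symmetric] cancel[OF \<open>?s \<noteq> 0\<close>] ..
qed

lemma emeasure_mu_r_rectangle:
  assumes "0 \<le> u" "u \<le> x" "x \<le> 1" "0 \<le> v" "v \<le> y" "y \<le> 1"
    and r: "(\<lambda>i. (overlap \<alpha> i x - overlap \<alpha> i u) * (overlap \<alpha> i y - overlap \<alpha> i v) / ((1 - \<alpha>) * \<alpha> ^ i)) sums r"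
  shows "emeasure (mu_r \<alpha>) ({u..x} \<times> {v..y}) = ennreal r"
proof -
  have nonneg: "0 \<le> (overlap \<alpha> i x - overlap \<alpha> i u) * (overlap \<alpha> i y - overlap \<alpha> i v) / ((1 - \<alpha>) * \<alpha> ^ i)" for i
    using overlap_mono assms(2,5) pow01[of i] \<alpha> by (intro divide_nonneg_nonneg mult_nonneg_nonneg) auto
  have "{u..x} \<times> {v..y} \<in> sets borel" by (intro borel_closed closed_Times) auto
  moreover have "{u..x} \<times> {v..y} \<subseteq> unit_square" using assms by (auto simp: unit_square_def)
  ultimately have "{u..x} \<times> {v..y} \<in> sets (restrict_space borel unit_square)"
    by (auto simp: sets_restrict_space_iff unit_square_borel)
  from emeasure_mu_r[OF this, of \<alpha>]
  have "emeasure (mu_r \<alpha>) ({u..x} \<times> {v..y}) =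
      (\<Sum>i. ennreal ((overlap \<alpha> i x - overlap \<alpha> i u) * (overlap \<alpha> i y - overlap \<alpha> i v) / ((1 - \<alpha>) * \<alpha> ^ i)))"
    by (simp only: emeasure_uniform_on_rectangle[OF assms(1-6)])
  also have "\<dots> = ennreal r"
  proof -
    have "0 \<le> r" using sums_le[OF nonneg sums_zero r] .
    then show ?thesis using r nonneg by (intro sums_unique[symmetric]) (simp add: sums_ennreal)
  qed
  finally show ?thesis .
qed

text \<open>For a full strip one factor is the whole side length and cancels the denominator,
  leaving a sum of overlap differences.\<close>

lemma permuton_mu_r: "permuton (mu_r \<alpha>)"
proof -
  have s: "(1 - \<alpha>) * \<alpha> ^ i \<noteq> 0" for i using pow01[of i] \<alpha> by simp
  have strip: "emeasure (mu_r \<alpha>) ({a..b} \<times> {0..1}) = ennreal (b - a)"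
    "emeasure (mu_r \<alpha>) ({0..1} \<times> {a..b}) = ennreal (b - a)" if "0 \<le> a" "a \<le> b" "b \<le> 1" for a b
  proof -
    have "(\<lambda>i. overlap \<alpha> i b - overlap \<alpha> i a) sums (b - a)"
      using that by (intro sums_diff overlap_sums) auto
    then show "emeasure (mu_r \<alpha>) ({a..b} \<times> {0..1}) = ennreal (b - a)"
      "emeasure (mu_r \<alpha>) ({0..1} \<times> {a..b}) = ennreal (b - a)"
      using that s by (auto intro!: emeasure_mu_r_rectangle simp: overlap_0 overlap_1)
  qed
  have "prob_space (mu_r \<alpha>)"
  proof
    have "emeasure (mu_r \<alpha>) ({0..1} \<times> {0..1}) = ennreal (1 - 0)" by (rule strip) simp_all
    then show "emeasure (mu_r \<alpha>) (space (mu_r \<alpha>)) = 1" by (simp add: space_mu_r unit_square_def)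
  qed
  then show ?thesis
    unfolding permuton_def using sets_mu_r strip by (auto simp: measure_def)
qed

lemma cdf2_mu_r_eqI:
  assumes xy: "x \<in> {0..1}" "y \<in> {0..1}" and r: "(\<lambda>i. overlap \<alpha> i x * overlap \<alpha> i y / ((1 - \<alpha>) * \<alpha> ^ i)) sums r"
  shows "cdf2 (mu_r \<alpha>) x y = r"
proof -
  have "{q \<in> space (mu_r \<alpha>). fst q \<le> x \<and> snd q \<le> y} = {0..x} \<times> {0..y}"
    using xy by (auto simp: space_mu_r unit_square_def)
  moreover have "emeasure (mu_r \<alpha>) ({0..x} \<times> {0..y}) = ennreal r"
    using xy r by (intro emeasure_mu_r_rectangle) (auto simp: overlap_0)
  moreover have "0 \<le> r"
    using overlap_nonneg pow01 \<alpha> by (intro sums_le[OF _ sums_zero r] divide_nonneg_nonneg mult_nonneg_nonneg) (auto simp: less_imp_le)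
  ultimately show ?thesis by (simp add: cdf2_def measure_def)
qed

text \<open>The series is symmetric in \<open>x\<close> and \<open>y\<close>; what has to be shown
  is its convergence, by comparison with the overlaps of \<open>x\<close>.\<close>

lemma cdf2_mu_r_commute:
  assumes "x \<in> {0..1}" "y \<in> {0..1}"
  shows "cdf2 (mu_r \<alpha>) x y = cdf2 (mu_r \<alpha>) y x"
proof -
  have s: "0 < (1 - \<alpha>) * \<alpha> ^ i" for i using pow01[of i] \<alpha> by simp
  have "overlap \<alpha> i y / ((1 - \<alpha>) * \<alpha> ^ i) \<le> 1" for i
    using overlap_mono[OF atLeastAtMost_iff[THEN iffD1, THEN conjunct2, OF assms(2)], of i] s[of i] by (simp add: overlap_1)
  then have "overlap \<alpha> i x * overlap \<alpha> i y / ((1 - \<alpha>) * \<alpha> ^ i) \<le> overlap \<alpha> i x" for i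
    using mult_left_mono[of "overlap \<alpha> i y / ((1 - \<alpha>) * \<alpha> ^ i)" 1 "overlap \<alpha> i x"] overlap_nonneg by simp
  moreover have "0 \<le> overlap \<alpha> i x * overlap \<alpha> i y / ((1 - \<alpha>) * \<alpha> ^ i)" for i
    by (rule divide_nonneg_nonneg[OF mult_nonneg_nonneg[OF overlap_nonneg overlap_nonneg] less_imp_le[OF s]])
  ultimately have "norm (overlap \<alpha> i x * overlap \<alpha> i y / ((1 - \<alpha>) * \<alpha> ^ i)) \<le> overlap \<alpha> i x" for i
    by (simp only: real_norm_def abs_of_nonneg)
  then have "summable (\<lambda>i. overlap \<alpha> i x * overlap \<alpha> i y / ((1 - \<alpha>) * \<alpha> ^ i))"
    by (rule summable_comparison_test'[OF sums_summable[OF overlap_sums[OF assms(1)]]])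
  from summable_sums[OF this]
  show ?thesis
    using cdf2_mu_r_eqI[OF assms] cdf2_mu_r_eqI[OF assms(2,1)] by (simp add: mult.commute)
qed

text \<open>The squares before the boundary \<open>1 - \<alpha> ^ k\<close> lie wholly below
  \<open>y\<close> and those after it have no mass to the left of \<open>x\<close>, so each term
  reduces to the overlap of \<open>x\<close>.\<close>

lemma cdf2_mu_r_separated:
  assumes xy: "x \<in> {0..1}" "y \<in> {0..1}" and k: "x \<le> 1 - \<alpha> ^ k" "1 - \<alpha> ^ k \<le> y"
  shows "cdf2 (mu_r \<alpha>) x y = x"
proof (rule cdf2_mu_r_eqI[OF xy])
  have "overlap \<alpha> i x * overlap \<alpha> i y / ((1 - \<alpha>) * \<alpha> ^ i) = overlap \<alpha> i x" for i
  proof (cases "i < k")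
    case True
    then have "\<alpha> ^ k \<le> \<alpha> ^ Suc i" using \<alpha> by (intro power_decreasing) auto
    then have "overlap \<alpha> i y = (1 - \<alpha>) * \<alpha> ^ i" using k by (intro overlap_after) simp
    then show ?thesis using pow01[of i] \<alpha> by simp
  next
    case False
    then have "\<alpha> ^ i \<le> \<alpha> ^ k" using \<alpha> by (intro power_decreasing) auto
    then have "overlap \<alpha> i x = 0" using k by (intro overlap_before) simp
    then show ?thesis by simp
  qed
  then show "(\<lambda>i. overlap \<alpha> i x * overlap \<alpha> i y / ((1 - \<alpha>) * \<alpha> ^ i)) sums x"
    using overlap_sums[OF xy(1)] by simp
qed

lemma cdf2_mu_r_min:
  assumes xy: "x \<in> {0..1}" "y \<in> {0..1}" and k: "x \<le> 1 - \<alpha> ^ k \<and> 1 - \<alpha> ^ k \<le> y \<or> y \<le> 1 - \<alpha> ^ k \<and> 1 - \<alpha> ^ k \<le> x"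
  shows "cdf2 (mu_r \<alpha>) x y = min x y"
  using k cdf2_mu_r_separated[OF xy, of k] cdf2_mu_r_separated[OF xy(2,1), of k] cdf2_mu_r_commute[OF xy]
  by auto

lemma cdf2_mu_r_block:
  assumes x: "x \<in> block \<alpha> (\<alpha> ^ n)" and y: "y \<in> block \<alpha> (\<alpha> ^ n)"
  shows "cdf2 (mu_r \<alpha>) x y = (1 - \<alpha> ^ n) + (x - (1 - \<alpha> ^ n)) * (y - (1 - \<alpha> ^ n)) / ((1 - \<alpha>) * \<alpha> ^ n)"
proof -
  let ?l = "1 - \<alpha> ^ n" and ?s = "(1 - \<alpha>) * \<alpha> ^ n"
  have s: "0 < ?s" using pow01[of n] \<alpha> by simp
  have bx: "?l < x" "x < 1 - \<alpha> ^ Suc n" and "?l < y" "y < 1 - \<alpha> ^ Suc n"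
    using x y by (auto simp: block_def)
  moreover have b: "0 \<le> ?l" "1 - \<alpha> ^ Suc n \<le> 1" using pow01[of n] pow01[of "Suc n"] by auto
  ultimately have xy: "x \<in> {0..1}" "y \<in> {0..1}" by auto
  \<comment> \<open>Only the \<open>n\<close>th term differs from the overlap of \<open>x\<close>,
    so the series is computed as \<open>x\<close> plus this correction.\<close>
  let ?d = "(x - ?l) * (y - ?l) / ?s - (x - ?l)"
  have ov: "overlap \<alpha> n z = z - ?l" if "z \<in> block \<alpha> (\<alpha> ^ n)" for z
  proof -
    have "?l < z" "z - ?l \<le> ?s" using that by (auto simp: block_def algebra_simps)
    then show ?thesis by (simp add: overlap_def)
  qed
  have "overlap \<alpha> i x * overlap \<alpha> i y / ((1 - \<alpha>) * \<alpha> ^ i) = overlap \<alpha> i x + (if i = n then ?d else 0)" for i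
  proof (cases i n rule: linorder_cases)
    case less
    then have "\<alpha> ^ n \<le> \<alpha> ^ Suc i" using \<alpha> by (intro power_decreasing) auto
    then have "overlap \<alpha> i y = (1 - \<alpha>) * \<alpha> ^ i" using y by (intro overlap_after) (auto simp: block_def)
    then show ?thesis using pow01[of i] \<alpha> less by simp
  next
    case equal
    then show ?thesis using ov[OF x] ov[OF y] by simp
  next
    case greater
    then have "\<alpha> ^ i \<le> \<alpha> ^ Suc n" using \<alpha> by (intro power_decreasing) auto
    then have "overlap \<alpha> i x = 0" using bx by (intro overlap_before) simp
    then show ?thesis using greater by simp
  qed
  moreover have "(\<lambda>i. overlap \<alpha> i x + (if i = n then ?d else 0)) sums (x + ?d)"
    using sums_add[OF overlap_sums[OF xy(1)] sums_single[of n "\<lambda>_. ?d"]] by simp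
  ultimately have "cdf2 (mu_r \<alpha>) x y = x + ?d"
    by (intro cdf2_mu_r_eqI[OF xy]) simp
  then show ?thesis by simp
qed

lemma tiled_mu_r: "tiled \<alpha> (cdf2 (mu_r \<alpha>)) (\<lambda>n. \<alpha> ^ n)"
  unfolding tiled_def
proof (intro conjI allI ballI impI)
  show "0 \<le> \<alpha> ^ n" "\<alpha> ^ n \<le> \<alpha> ^ n" for n using pow01[of n] by simp_all
next
  fix m n x
  assume x: "x \<in> block \<alpha> (\<alpha> ^ m)" "x \<in> block \<alpha> (\<alpha> ^ n)"
  have "\<not> i < j" if "x \<in> block \<alpha> (\<alpha> ^ i)" "x \<in> block \<alpha> (\<alpha> ^ j)" for i j
  proof
    assume "i < j"
    then have "\<alpha> ^ j \<le> \<alpha> ^ Suc i" using \<alpha> by (intro power_decreasing) auto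
    then show False using that by (auto simp: block_def)
  qed
  from this[OF x] this[OF x(2,1)] show "m = n" by simp
next
  fix n x y
  assume x: "x \<in> block \<alpha> (\<alpha> ^ n)" and y: "y \<in> {0..1::real}"
  have b: "1 - \<alpha> ^ n < x" "x < 1 - \<alpha> ^ Suc n" using x by (auto simp: block_def)
  then have x01: "x \<in> {0..1}" using pow01[of n] pow01[of "Suc n"] by auto
  show "cdf2 (mu_r \<alpha>) x y = block_row \<alpha> (\<alpha> ^ n) x y"
  proof (cases "y \<in> block \<alpha> (\<alpha> ^ n)")
    case True
    then show ?thesis using cdf2_mu_r_block[OF x True] by (simp add: block_row_def)
  next
    case False
    then consider "y \<le> 1 - \<alpha> ^ n" | "1 - \<alpha> ^ Suc n \<le> y" by (force simp: block_def)
    then have "cdf2 (mu_r \<alpha>) x y = min x y"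
      using b by cases (blast intro: cdf2_mu_r_min[OF x01 y] less_imp_le)+
    then show ?thesis using False by (simp add: block_row_def)
  qed
next
  fix x y
  assume x: "x \<in> {0..1::real}" and y: "y \<in> {0..1::real}" and out: "\<forall>n. x \<notin> block \<alpha> (\<alpha> ^ n)"
  show "cdf2 (mu_r \<alpha>) x y = min x y"
  proof (cases "x = 1")
    case True
    then show ?thesis using cdf2_top[OF permuton_mu_r y] y by simp
  next
    case False
    then obtain n where "\<alpha> ^ Suc n < 1 - x" "1 - x \<le> \<alpha> ^ n"
      using ex_power_strip[OF \<alpha>, of "1 - x"] x by auto
    \<comment> \<open>Apart from 1, only left ends of blocks are outside all open blocks, and such
      an \<open>x\<close> is itself the boundary separating it from every \<open>y\<close>.\<close>
    then have "x = 1 - \<alpha> ^ n" using out[rule_format, of n] by (auto simp: block_def)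
    then show ?thesis using cdf2_mu_r_min[OF x y, of n] by linarith
  qed
qed

end

section \<open>The two identities as polynomials, and the final assembly\<close>

definition slope_poly :: "real \<Rightarrow> grid_functional" where
  "slope_poly c = (\<lambda>F x y.
    gap_at 1 3 F x y * gap_at 1 4 F x y * gap_at 1 5 F x y * gap_at 1 6 F x y *
    (gap_at 2 3 F x y * gap_at 2 4 F x y * gap_at 2 5 F x y * gap_at 2 6 F x y) *
    ((1 - F (x 1) (y 0)) * (F (x 0) (y 3) - F (x 0) (y 4)) *
       ((F (x 0) (y 5) - F (x 0) (y 6)) - c * (F (x 2) (y 5) - F (x 2) (y 6))) -
     (1 - F (x 2) (y 0)) * (F (x 0) (y 5) - F (x 0) (y 6)) *
       ((F (x 0) (y 3) - F (x 0) (y 4)) - c * (F (x 1) (y 3) - F (x 1) (y 4)))))"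

definition size_poly :: "real \<Rightarrow> grid_functional" where
  "size_poly c = (\<lambda>F x y.
    gap_at 1 3 F x y * gap_at 1 4 F x y *
    ((1 - F (x 1) (y 0)) * (F (x 0) (y 3) - F (x 0) (y 4)) *
       ((F (x 0) (y 3) - F (x 0) (y 4)) - (F (x 1) (y 3) - F (x 1) (y 4))) -
     ((F (x 0) (y 3) - F (x 0) (y 4)) - c * (F (x 1) (y 3) - F (x 1) (y 4))) *
     ((F (x 0) (y 3) - F (x 0) (y 4)) - (F (x 1) (y 3) - F (x 1) (y 4)) -
       F (x 1) (y 3) * (F (x 0) (y 3) - F (x 0) (y 4)) +
       (F (x 1) (y 3) - F (x 1) (y 4)) * F (x 0) (y 3))))"

text \<open>Points 1 and 2 supply the x-variables and points 3 to 6 the y-variables, so the index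
  sets meet only in 0, as the transfer of zeros requires.\<close>

lemma grid_poly_slope_size:
  "grid_poly {0, 1, 2} {0, 3, 4, 5, 6} (slope_poly c)" "grid_poly {0, 1, 2} {0, 3, 4, 5, 6} (size_poly c)"
  unfolding slope_poly_def size_poly_def
  by (intro grid_poly_gap_at grid_poly_intros; simp)+

lemma (in copula) slope_size_poly_iff:
  assumes "x 0 = 1" "y 0 = 1" "range x \<subseteq> {0..1}" "range y \<subseteq> {0..1}"
  shows "slope_poly c F x y = 0 \<longleftrightarrow> slope_identity c F (x 1) (x 2) (y 3) (y 4) (y 5) (y 6)"
    "size_poly c F x y = 0 \<longleftrightarrow> size_identity c F (x 1) (y 3) (y 4)"
proof -
  have xy: "x i \<in> {0..1}" "y i \<in> {0..1}" for i using assms by blast+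
  have "gap_at i j F x y = gap F (x i) (y j)" for i j using assms xy by (intro gap_at_eq)
  moreover have "F (x i) (y 0) = x i" "F (x 0) (y i) = y i" for i
    unfolding assms(1,2) by (rule right top, rule xy)+
  ultimately show "slope_poly c F x y = 0 \<longleftrightarrow> slope_identity c F (x 1) (x 2) (y 3) (y 4) (y 5) (y 6)"
    "size_poly c F x y = 0 \<longleftrightarrow> size_identity c F (x 1) (y 3) (y 4)"
    by (simp_all only: slope_poly_def size_poly_def slope_identity_def size_identity_def)
qed

theorem theorem10:
  fixes \<alpha> :: real
  assumes "0 < \<alpha>" and "\<alpha> < 1"
  shows "finitely_forcible (mu_r \<alpha>)"
proof -
  let ?\<mu> = "mu_r \<alpha>" and ?I = "{0, 1, 2::nat}" and ?J = "{0, 3, 4, 5, 6::nat}"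
  let ?seq = "\<lambda>x :: nat \<Rightarrow> real. range x \<subseteq> {0..1} \<and> x 0 = 1"
  note \<mu> = permuton_mu_r[OF assms] and t = tiled_mu_r[OF assms]
  interpret \<mu>: copula "cdf2 ?\<mu>" by (rule copula_cdf2[OF \<mu>])
  have IJ: "?I \<subseteq> {..6}" "?J \<subseteq> {..6}" "?I \<inter> ?J \<subseteq> {0}" by auto
  have zero: "slope_poly (1 - \<alpha>) (cdf2 ?\<mu>) x y = 0" "size_poly (1 - \<alpha>) (cdf2 ?\<mu>) x y = 0"
    if "range x \<subseteq> {0..1}" "range y \<subseteq> {0..1}" "x 0 = 1" "y 0 = 1" for x y
  proof -
    have xy: "x i \<in> {0..1}" "y i \<in> {0..1}" for i using that by blast+
    show "slope_poly (1 - \<alpha>) (cdf2 ?\<mu>) x y = 0" "size_poly (1 - \<alpha>) (cdf2 ?\<mu>) x y = 0"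
      unfolding \<mu>.slope_size_poly_iff[OF that(3,4,1,2)]
      by (intro tiled_slope_identity[OF t assms(2)] tiled_size_identity[OF t assms(2)] xy)+
  qed
  obtain N1 where N1: "\<And>\<mu>' x y. permuton \<mu>' \<Longrightarrow> same_densities N1 ?\<mu> \<mu>' \<Longrightarrow> ?seq x \<Longrightarrow> ?seq y \<Longrightarrow>
      slope_poly (1 - \<alpha>) (cdf2 \<mu>') x y = 0"
    using grid_poly_zero_transfer[OF \<mu> grid_poly_slope_size(1) IJ zero(1)] by blast
  obtain N2 where N2: "\<And>\<mu>' x y. permuton \<mu>' \<Longrightarrow> same_densities N2 ?\<mu> \<mu>' \<Longrightarrow> ?seq x \<Longrightarrow> ?seq y \<Longrightarrow>
      size_poly (1 - \<alpha>) (cdf2 \<mu>') x y = 0"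
    using grid_poly_zero_transfer[OF \<mu> grid_poly_slope_size(2) IJ zero(2)] by blast
  obtain N3 where N3: "\<And>\<mu>'. permuton \<mu>' \<Longrightarrow> same_densities N3 ?\<mu> \<mu>' \<Longrightarrow>
      expect 2 (gap_at 1 2) ?\<mu> = expect 2 (gap_at 1 2) \<mu>'"
    using expect_eq[of 2 "gap_at 1 2"] grid_poly_gap_at[of 1 "{..2}" 2 "{..2}"] \<mu> by auto
  define N where "N = max N1 (max N2 N3)"
  \<comment> \<open>All permutations up to order \<open>N\<close> are taken, so that one finite set
    serves the two identities and the integral.\<close>
  define S where "S = (SIGMA n:{..N}. {\<sigma>. \<sigma> permutes {1..n}})"
  have unique: "\<mu>' = ?\<mu>" if \<mu>': "permuton \<mu>'" and same: "same_densities N ?\<mu> \<mu>'" for \<mu>'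
  proof -
    interpret copula "cdf2 \<mu>'" by (rule copula_cdf2[OF \<mu>'])
    have same': "same_densities N1 ?\<mu> \<mu>'" "same_densities N2 ?\<mu> \<mu>'" "same_densities N3 ?\<mu> \<mu>'"
      using same by (auto intro: same_densities_mono simp: N_def)
    interpret forced_copula "cdf2 \<mu>'" \<alpha>
    proof
      fix u u' v1 v2 v3 v4 :: real
      assume u: "u \<in> {0..1}" "u' \<in> {0..1}" "v1 \<in> {0..1}" "v2 \<in> {0..1}" "v3 \<in> {0..1}" "v4 \<in> {0..1}"
      \<comment> \<open>All other entries are 1, in particular entry 0, which stands for the
        coordinate 1.\<close>
      let ?x = "(\<lambda>_. 1)(1 := u, 2 := u')" and ?y = "(\<lambda>_. 1)(3 := v1, 4 := v2, 5 := v3, 6 := v4)"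
      have xy: "?seq ?x" "?seq ?y" using u by auto
      from N1[OF \<mu>' same'(1) xy] slope_size_poly_iff(1)[of ?x ?y "1 - \<alpha>"] xy
      show "slope_identity (1 - \<alpha>) (cdf2 \<mu>') u u' v1 v2 v3 v4" by simp
    next
      fix u v1 v2 :: real
      assume u: "u \<in> {0..1}" "v1 \<in> {0..1}" "v2 \<in> {0..1}"
      let ?x = "(\<lambda>_. 1)(1 := u)" and ?y = "(\<lambda>_. 1)(3 := v1, 4 := v2)"
      have xy: "?seq ?x" "?seq ?y" using u by auto
      from N2[OF \<mu>' same'(2) xy] slope_size_poly_iff(2)[of ?x ?y "1 - \<alpha>"] xy
      show "size_identity (1 - \<alpha>) (cdf2 \<mu>') u v1 v2" by simp
    qed (use assms in auto)
    obtain \<beta> where \<beta>: "tiled \<alpha> (cdf2 \<mu>') \<beta>" using ex_tiled ..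
    have "\<beta> = (\<lambda>n. \<alpha> ^ n)"
      by (rule tiling_eq[OF \<mu>' \<beta> \<mu> t assms N3[OF \<mu>' same'(3), symmetric]])
    with \<beta> have "tiled \<alpha> (cdf2 \<mu>') (\<lambda>n. \<alpha> ^ n)" by simp
    then show ?thesis by (intro permuton_eqI[OF \<mu>' \<mu>] tiled_unique[OF _ t])
  qed
  have "finite S" unfolding S_def by (intro finite_SigmaI finite_permutations) auto
  moreover have "\<forall>(n, \<sigma>)\<in>S. \<sigma> permutes {1..n}" by (auto simp: S_def)
  moreover have "\<mu>' = ?\<mu>" if "permuton \<mu>'" "\<forall>(n, \<sigma>)\<in>S. perm_density n \<sigma> \<mu>' = perm_density n \<sigma> ?\<mu>" for \<mu>'
  proof (rule unique[OF that(1)])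
    show "same_densities N ?\<mu> \<mu>'"
      using that(2) unfolding same_densities_def S_def by fastforce
  qed
  ultimately show ?thesis
    unfolding finitely_forcible_def using \<mu> by blast
qed

end
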